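(* Two nonempty compositions $\alpha$ and $\beta$ satisfy $$X_{(P_{\ell(\alpha)},\alpha)}=X_{(P_{\ell(\beta)},\beta)}\quad\text{if and only if}\quad\alpha\sim\beta.$$
   Context: A composition $\alpha=(\alpha_1,\dots,\alpha_{\ell(\alpha)})$ is a finite ordered list of positive integers; $\ell(\alpha)$ is its length. Its reversal is $\alpha^r=(\alpha_{\ell(\alpha)},\dots,\alpha_1)$. For nonempty compositions $\alpha,\beta$, the concatenation is $\alpha\cdot\beta=(\alpha_1,\dots,\alpha_{\ell(\alpha)},\beta_1,\dots,\beta_{\ell(\beta)})$ and the near concatenation is $\alpha\odot\beta=(\alpha_1,\dots,\alpha_{\ell(\alpha)}+\beta_1,\dots,\beta_{\ell(\beta)})$. Define $$\alpha\circ\beta=\beta^{\odot\alpha_1}\cdot\ \cdots\ \cdot\beta^{\odot\alpha_{\ell(\alpha)}},\qquad \beta^{\odot i}=\underbrace{\beta\odot\cdots\odot\beta}_{i};$$ the operation $\circ$ is associative. Write $\alpha\sim\beta$ if for some $\ell$ there exist compositions $\alpha^{(1)},\dots,\alpha^{(\ell)}$ and $\beta^{(1)},\dots,\beta^{(\ell)}$ such that $\alpha=\alpha^{(1)}\circ\cdots\circ\alpha^{(\ell)}$ and $\beta=\beta^{(1)}\circ\cdots\circ\beta^{(\ell)}$, where for each $i$ either $\beta^{(i)}=\alpha^{(i)}$ or $\beta^{(i)}=(\alpha^{(i)})^r$. (By a theorem of Billera, Thomas and van Willigenburg, $\alpha\sim\beta$ if and only if the ribbon Schur functions satisfy $r_\alpha=r_\beta$.)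 $P_n$ ($n\ge1$) is the path on vertices $v_1,\dots,v_n$ with edge set $\{v_iv_{i+1}\mid 1\le i\le n-1\}$, and $(P_{\ell(\alpha)},\alpha)$ is this path with $v_i$ given weight $\alpha_i$. A proper colouring of a graph $G$ is a map $\kappa:V(G)\to\mathbb{Z}^+$ with $\kappa(u)\neq\kappa(v)$ whenever $uv$ is an edge. For a weighted graph $(G,w)$ with vertices $v_1,\dots,v_N$ and weight function $w:V(G)\to\mathbb{Z}^+$, the extended chromatic symmetric function is $X_{(G,w)}=\sum_\kappa x_{\kappa(v_1)}^{w(v_1)}\cdots x_{\kappa(v_N)}^{w(v_N)}$, summed over all proper colourings $\kappa$ of $G$. *)

theory Defs
  imports Main "HOL-Library.FuncSet" "HOL-Library.Poly_Mapping"
begin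

section \<open>Compositions\<close>

definition is_composition :: "nat list \<Rightarrow> bool" where
  "is_composition \<alpha> \<longleftrightarrow> (\<forall>a\<in>set \<alpha>. 0 < a)"

text \<open>Meaningful for nonempty arguments only, as are the operations built on it.\<close>

definition near_concat :: "nat list \<Rightarrow> nat list \<Rightarrow> nat list" where
  "near_concat \<alpha> \<beta> = butlast \<alpha> @ [last \<alpha> + hd \<beta>] @ tl \<beta>"

text \<open>The \<open>i\<close>-fold near concatenation of \<open>\<beta>\<close> with itself, for \<open>i \<ge> 1\<close>.\<close>

definition near_pow :: "nat list \<Rightarrow> nat \<Rightarrow> nat list" where
  "near_pow \<beta> i = (near_concat \<beta> ^^ (i - 1)) \<beta>"

definition comp_circ :: "nat list \<Rightarrow> nat list \<Rightarrow> nat list" where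
  "comp_circ \<alpha> \<beta> = concat (map (near_pow \<beta>) \<alpha>)"

text \<open>The product of a nonempty list of compositions. As \<open>comp_circ\<close> is associative on nonempty
  compositions, the choice of bracketing (here to the left) is immaterial.\<close>

definition comp_circ_list :: "nat list list \<Rightarrow> nat list" where
  "comp_circ_list as = foldl comp_circ (hd as) (tl as)"

definition comp_equiv :: "nat list \<Rightarrow> nat list \<Rightarrow> bool" where
  "comp_equiv \<alpha> \<beta> \<longleftrightarrow>
    (\<exists>as bs. as \<noteq> [] \<and> length bs = length as \<and>
       (\<forall>a\<in>set as. is_composition a \<and> a \<noteq> []) \<and>
       (\<forall>b\<in>set bs. is_composition b \<and> b \<noteq> []) \<and>
       \<alpha> = comp_circ_list as \<and> \<beta> = comp_circ_list bs \<and>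
       (\<forall>i<length as. bs ! i = as ! i \<or> bs ! i = rev (as ! i)))"

section \<open>Extended chromatic symmetric functions\<close>

text \<open>A graph is a vertex set \<open>V\<close> together with a set \<open>E\<close> of edges \<open>{u, v}\<close>. Colourings are
  extensional functions on \<open>V\<close>, so that they can be counted.\<close>

definition proper_colourings :: "'v set \<Rightarrow> 'v set set \<Rightarrow> ('v \<Rightarrow> nat) set" where
  "proper_colourings V E =
    {\<kappa> \<in> V \<rightarrow>\<^sub>E {1..}. \<forall>u\<in>V. \<forall>v\<in>V. {u, v} \<in> E \<longrightarrow> \<kappa> u \<noteq> \<kappa> v}"

text \<open>A monomial in \<open>x\<^sub>1, x\<^sub>2, \<dots>\<close> is given by its exponent vector, so a product of variable
  powers is a sum of \<open>Poly_Mapping.single\<close>s.\<close>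

definition colouring_monomial :: "'v set \<Rightarrow> ('v \<Rightarrow> nat) \<Rightarrow> ('v \<Rightarrow> nat) \<Rightarrow> (nat \<Rightarrow>\<^sub>0 nat)" where
  "colouring_monomial V w \<kappa> = (\<Sum>v\<in>V. Poly_Mapping.single (\<kappa> v) (w v))"

text \<open>A formal power series in \<open>x\<^sub>1, x\<^sub>2, \<dots>\<close> is given by its coefficients. The coefficient of \<open>m\<close> in
  a formal sum of monomials is the number of summands equal to \<open>m\<close>; the set counted below is
  finite when \<open>V\<close> is finite and the weights are positive.\<close>

definition extended_csf ::
    "'v set \<Rightarrow> 'v set set \<Rightarrow> ('v \<Rightarrow> nat) \<Rightarrow> ((nat \<Rightarrow>\<^sub>0 nat) \<Rightarrow> int)" where
  "extended_csf V E w =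
    (\<lambda>m. int (card {\<kappa> \<in> proper_colourings V E. colouring_monomial V w \<kappa> = m}))"

lemma finite_colourings_of_monomial:
  assumes V: "finite V" and w: "\<And>v. v \<in> V \<Longrightarrow> 0 < w v"
  shows "finite {\<kappa> \<in> proper_colourings V E. colouring_monomial V w \<kappa> = m}"
proof (rule finite_subset)
  show "{\<kappa> \<in> proper_colourings V E. colouring_monomial V w \<kappa> = m}
          \<subseteq> V \<rightarrow>\<^sub>E Poly_Mapping.keys m"
  proof
    fix \<kappa> assume k: "\<kappa> \<in> {\<kappa> \<in> proper_colourings V E. colouring_monomial V w \<kappa> = m}"
    have "\<kappa> v \<in> Poly_Mapping.keys m" if v: "v \<in> V" for v
    proof -
      have "0 < w v" using w v .
      also have "w v = Poly_Mapping.lookup (Poly_Mapping.single (\<kappa> v) (w v)) (\<kappa> v)" by simp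
      also have "\<dots> \<le> (\<Sum>u\<in>V. Poly_Mapping.lookup (Poly_Mapping.single (\<kappa> u) (w u)) (\<kappa> v))"
        by (rule member_le_sum) (use v V in auto)
      also have "\<dots> = Poly_Mapping.lookup m (\<kappa> v)"
        using k by (auto simp: colouring_monomial_def Poly_Mapping.lookup_sum)
      finally show ?thesis by (simp add: in_keys_iff)
    qed
    then show "\<kappa> \<in> V \<rightarrow>\<^sub>E Poly_Mapping.keys m"
      using k by (auto simp: proper_colourings_def PiE_iff)
  qed
  show "finite (V \<rightarrow>\<^sub>E Poly_Mapping.keys m)" using V by (simp add: finite_PiE)
qed

definition path_vertices :: "nat \<Rightarrow> nat set" where
  "path_vertices n = {1..n}"

definition path_edges :: "nat \<Rightarrow> nat set set" where
  "path_edges n = {{i, i + 1} | i. 1 \<le> i \<and> i \<le> n - 1}"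

text \<open>Vertices are numbered from 1, list positions from 0.\<close>

definition path_csf :: "nat list \<Rightarrow> ((nat \<Rightarrow>\<^sub>0 nat) \<Rightarrow> int)" where
  "path_csf \<alpha> =
    extended_csf (path_vertices (length \<alpha>)) (path_edges (length \<alpha>)) (\<lambda>i. \<alpha> ! (i - 1))"

end

theory Submission
  imports Defs "HOL-Library.Multiset"
begin

text \<open>
  By deletion and contraction, the chromatic symmetric function of a weighted path expands, with
  signs determined by the numbers of parts, in the products of power sums indexed by the coarsenings
  of \<open>\<alpha>\<close>. Power sums being algebraically independent, \<open>X\<^sub>\<alpha> = X\<^sub>\<beta>\<close> says that \<open>\<alpha>\<close> and \<open>\<beta>\<close> have the same
  multiset of coarsenings up to order of the parts, that is, \<open>F\<^sub>\<alpha> = F\<^sub>\<beta>\<close> for the generating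
  polynomials \<open>F\<^sub>\<alpha> \<in> \<int>[x\<^sub>1, x\<^sub>2, \<dots>]\<close> of the coarsenings.

  Substituting \<open>F\<close> of the near powers of \<open>\<delta>\<close> for the variables in \<open>F\<^sub>\<gamma>\<close> yields the polynomial of
  \<open>\<gamma> \<circ> \<delta>\<close>; so \<open>F\<close> does not change when factors are reversed.

  Conversely, identify \<open>\<alpha>\<close> and \<open>\<beta>\<close> of size \<open>n\<close> with their sets \<open>S\<close> and \<open>T\<close> of partial sums, and let
  \<open>P\<^sub>S\<close> be the sum of the monomials of all compositions whose partial sums, including the last one, lie
  in \<open>S\<close>. Differentiating \<open>F\<close> shows that \<open>F\<^sub>\<alpha> = F\<^sub>\<beta>\<close> means \<open>P\<^sub>S P\<^sub>n\<^sub>-\<^sub>S = P\<^sub>T P\<^sub>n\<^sub>-\<^sub>T\<close> in degrees below \<open>n\<close>.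
  Let \<open>f\<close> and \<open>g\<close> be the differences of the indicator function of \<open>S\<close> on \<open>\<int>/n\<close> and those of \<open>n - T\<close>
  and \<open>T\<close>. They are odd with disjoint supports, and the coefficients of monomials with two parts show
  that every pair is additive for \<open>f\<close> or for \<open>g\<close>. If neither vanishes, this forces the support of one of
  them, say \<open>f\<close>, not to lie in the subgroup generated by the support of the other. The
  coefficients of \<open>u = P\<^sub>S / P\<^sub>T = P\<^sub>n\<^sub>-\<^sub>T / P\<^sub>n\<^sub>-\<^sub>S\<close> then allow one to enlarge this subgroup, without ever
  swallowing the support of \<open>f\<close>, to a proper subgroup \<open>h\<int>/n\<close> outside which \<open>S\<close> and \<open>T\<close> agree and are
  \<open>h\<close>-periodic. So \<open>\<alpha> = \<gamma> \<circ> \<delta>\<close> and \<open>\<beta> = \<gamma>' \<circ> \<delta>\<close> (or \<open>\<beta>\<close> reversed), where \<open>\<delta>\<close> has size \<open>h\<close>; comparing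
  the monomials with all parts divisible by \<open>h\<close> gives \<open>F\<^sub>\<gamma> = F\<^sub>\<gamma>\<^sub>'\<close>, and induction applies.
\<close>

section \<open>Coarsenings\<close>

text \<open>The total is left out, so that the compositions of n > 0 correspond to the subsets of
  \<open>{0<..<n}\<close> (\<open>psums_inj\<close>, \<open>psums_surj\<close>).\<close>

fun psums :: "nat list \<Rightarrow> nat set" where
  "psums [] = {}"
| "psums [a] = {}"
| "psums (a # b # l) = insert a ((+) a ` psums (b # l))"

text \<open>With partial sums in place of explicit merging, a coarsening is a choice of cuts among
  those of \<alpha>.\<close>

definition coarse :: "nat list \<Rightarrow> nat list set" where
  "coarse \<alpha> = {L. is_composition L \<and> L \<noteq> [] \<and> sum_list L = sum_list \<alpha> \<and> psums L \<subseteq> psums \<alpha>}"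

lemma is_composition_simps [simp]:
  "is_composition []"
  "is_composition (a # l) \<longleftrightarrow> 0 < a \<and> is_composition l"
  "is_composition (l @ l') \<longleftrightarrow> is_composition l \<and> is_composition l'"
  "is_composition (rev l) \<longleftrightarrow> is_composition l"
  by (auto simp: is_composition_def)

lemma finite_psums [simp]: "finite (psums \<alpha>)"
  by (induction \<alpha> rule: psums.induct) auto

lemma sum_list_pos: "is_composition \<alpha> \<Longrightarrow> \<alpha> \<noteq> [] \<Longrightarrow> 0 < sum_list \<alpha>"
  by (cases \<alpha>) auto

lemma psums_bounds: "is_composition \<alpha> \<Longrightarrow> psums \<alpha> \<subseteq> {0<..<sum_list \<alpha>}"
proof (induction \<alpha> rule: psums.induct)
  case (3 a b l)
  then show ?case using sum_list_pos[of "b # l"] by auto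
qed auto

lemma psums_append:
  "\<alpha> \<noteq> [] \<Longrightarrow> \<beta> \<noteq> [] \<Longrightarrow>
     psums (\<alpha> @ \<beta>) = psums \<alpha> \<union> insert (sum_list \<alpha>) ((+) (sum_list \<alpha>) ` psums \<beta>)"
proof (induction \<alpha> rule: psums.induct)
  case (2 a)
  then show ?case by (cases \<beta>) auto
next
  case (3 a b l)
  have "psums (a # b # l @ \<beta>) = insert a ((+) a ` psums ((b # l) @ \<beta>))" by simp
  also have "\<dots> = insert a ((+) a ` (psums (b # l) \<union>
      insert (sum_list (b # l)) ((+) (sum_list (b # l)) ` psums \<beta>)))"
    using 3 by simp
  finally show ?case by (auto simp: image_Un image_image add.assoc)
qed simp

lemma psums_rev:
  assumes "is_composition \<alpha>"
  shows "psums (rev \<alpha>) = (\<lambda>x. sum_list \<alpha> - x) ` psums \<alpha>"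
  using assms
proof (induction \<alpha> rule: psums.induct)
  case (3 a b l)
  have "psums (rev (a # b # l)) = psums (rev (b # l) @ [a])" by simp
  also have "\<dots> = insert (sum_list (b # l)) (psums (rev (b # l)))"
    by (subst psums_append) auto
  also have "\<dots> = insert (sum_list (b # l)) ((\<lambda>x. sum_list (b # l) - x) ` psums (b # l))"
    using 3 by simp
  also have "\<dots> = (\<lambda>x. sum_list (a # b # l) - x) ` psums (a # b # l)"
    by (simp add: image_image add.commute add.left_commute)
  finally show ?case .
qed auto

lemma psums_empty_iff: "psums \<alpha> = {} \<longleftrightarrow> length \<alpha> \<le> 1"
  by (cases \<alpha> rule: psums.cases) auto

text \<open>The first part is the least partial sum; it can be read off and removed, and the
  remaining sums shifted back.\<close>

lemma psums_inj:
  assumes "is_composition \<alpha>" "is_composition \<beta>" "sum_list \<alpha> = sum_list \<beta>" "psums \<alpha> = psums \<beta>"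
  shows "\<alpha> = \<beta>"
  using assms
proof (induction \<alpha> arbitrary: \<beta> rule: psums.induct)
  case 1
  then show ?case by (cases \<beta>) auto
next
  case (2 a)
  then show ?case by (cases \<beta> rule: psums.cases) auto
next
  case (3 a b l)
  then obtain a' b' l' where \<beta>: "\<beta> = a' # b' # l'" by (cases \<beta> rule: psums.cases) auto
  have least: "Min (psums (c # d # m)) = c" for c d and m
    by (rule Min_eqI) auto
  have a: "a' = a" using least[of a b l] least[of a' b' l'] 3 \<beta> by simp
  have notin: "c \<notin> (+) c ` psums (d # m)" if "is_composition (d # m)" for c d :: nat and m
    using psums_bounds[OF that] by auto
  have "(+) a ` psums (b # l) = (+) a ` psums (b' # l')"
    using 3 \<beta> a notin[of b l a] notin[of b' l' a'] by (simp add: insert_ident)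
  then have "psums (b # l) = psums (b' # l')"
    by (simp add: inj_image_eq_iff)
  then have "b # l = b' # l'"
    using 3 \<beta> a by (intro "3.IH") auto
  then show ?case using a \<beta> by simp
qed

lemma psums_surj:
  assumes "finite S" "S \<subseteq> {0<..<n}" "0 < n"
  shows "\<exists>\<alpha>. is_composition \<alpha> \<and> \<alpha> \<noteq> [] \<and> sum_list \<alpha> = n \<and> psums \<alpha> = S"
  using assms
proof (induction S arbitrary: n rule: finite_linorder_max_induct)
  case empty
  then show ?case by (intro exI[of _ "[n]"]) auto
next
  case (insert b S)
  then obtain \<alpha> where \<alpha>: "is_composition \<alpha>" "\<alpha> \<noteq> []" "sum_list \<alpha> = b" "psums \<alpha> = S"
    using insert.IH[of b] by fastforce
  show ?case
    using \<alpha> insert.prems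
    by (intro exI[of _ "\<alpha> @ [n - b]"]) (auto simp: psums_append)
qed

lemma finite_comps: "finite {L. is_composition L \<and> sum_list L = n}"
proof (rule finite_subset)
  have "length L \<le> sum_list L" if "is_composition L" for L
    using that by (induction L) auto
  moreover have "x \<le> sum_list L" if "x \<in> set L" for x and L :: "nat list"
    using that by (simp add: member_le_sum_list)
  ultimately show "{L. is_composition L \<and> sum_list L = n} \<subseteq> {L. set L \<subseteq> {..n} \<and> length L \<le> n}"
    by auto
  show "finite {L. set L \<subseteq> {..n} \<and> length L \<le> n}"
    by (rule finite_lists_length_le) simp
qed

lemma finite_coarse [simp]: "finite (coarse \<alpha>)"
  by (rule finite_subset[OF _ finite_comps[of "sum_list \<alpha>"]]) (auto simp: coarse_def)

lemma coarse_single: "0 < a \<Longrightarrow> coarse [a] = {[a]}"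
  by (auto simp: coarse_def psums_empty_iff le_Suc_eq length_Suc_conv)

text \<open>A coarsening either keeps the first cut, and then begins with the part a, or drops it
  and merges a with b.\<close>

lemma coarse_Cons:
  assumes "is_composition (a # b # l)"
  shows "coarse (a # b # l) = (#) a ` coarse (b # l) \<union> coarse ((a + b) # l)"
    and "(#) a ` coarse (b # l) \<inter> coarse ((a + b) # l) = {}"
proof -
  have ps: "psums (a # b # l) = insert a (psums ((a + b) # l))"
    by (cases l) (auto simp: image_image add.assoc)
  have bd: "psums ((a + b) # l) \<subseteq> {a<..}" using assms
    by (cases l) auto
  have hd: "L = [sum_list L] \<or> (\<exists>c d m. L = c # d # m)" if "L \<noteq> []" for L :: "nat list"
    using that by (cases L rule: psums.cases) auto
  have 1: "L \<in> (#) a ` coarse (b # l)" if L: "L \<in> coarse (a # b # l)" and "a \<in> psums L" for L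
  proof -
    obtain c d m where cdm: "L = c # d # m"
      using \<open>a \<in> psums L\<close> by (cases L rule: psums.cases) auto
    have "c \<in> insert a ((+) a ` psums (b # l))" "psums L \<subseteq> {c..}"
      using L cdm by (auto simp: coarse_def)
    then have c: "c = a" using \<open>a \<in> psums L\<close> by force
    have "psums (d # m) \<subseteq> psums (b # l)"
    proof
      fix x assume x: "x \<in> psums (d # m)"
      have "0 < x" using x L cdm psums_bounds[of "d # m"] by (auto simp: coarse_def)
      moreover have "a + x \<in> psums L" using x c cdm by auto
      then have "a + x \<in> psums (a # b # l)" using L by (auto simp: coarse_def)
      ultimately show "x \<in> psums (b # l)" by auto
    qed
    then show ?thesis using L cdm c by (auto simp: coarse_def)
  qed
  have 2: "(#) a ` coarse (b # l) \<subseteq> coarse (a # b # l)"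
  proof
    fix L assume "L \<in> (#) a ` coarse (b # l)"
    then obtain L' where L': "L = a # L'" "L' \<in> coarse (b # l)" by auto
    then obtain c m where "L' = c # m" by (cases L') (auto simp: coarse_def)
    then show "L \<in> coarse (a # b # l)" using L' assms by (auto simp: coarse_def)
  qed
  have 3: "a \<in> psums L" if "L \<in> (#) a ` coarse (b # l)" for L
  proof -
    obtain L' where L': "L = a # L'" "L' \<in> coarse (b # l)"
      using \<open>L \<in> (#) a ` coarse (b # l)\<close> by auto
    then obtain c m where "L' = c # m" by (cases L') (auto simp: coarse_def)
    then show ?thesis using L' by simp
  qed
  have 4: "L \<in> coarse ((a + b) # l) \<longleftrightarrow> L \<in> coarse (a # b # l) \<and> a \<notin> psums L" for L
    using ps bd by (auto simp: coarse_def)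
  show "coarse (a # b # l) = (#) a ` coarse (b # l) \<union> coarse ((a + b) # l)"
    using 1 2 3 4 by blast
  show "(#) a ` coarse (b # l) \<inter> coarse ((a + b) # l) = {}"
    using 3 4 by blast
qed

text \<open>The polynomial F of \<alpha>, evaluated at a point of an arbitrary commutative ring:
  variables, polynomials of other compositions and negated power sums will be substituted.\<close>

definition coarse_poly :: "(nat \<Rightarrow> 'a::comm_ring_1) \<Rightarrow> nat list \<Rightarrow> 'a" where
  "coarse_poly x \<alpha> = (\<Sum>L\<in>coarse \<alpha>. prod_list (map x L))"

definition coarse_types :: "nat list \<Rightarrow> nat multiset multiset" where
  "coarse_types \<alpha> = image_mset mset (mset_set (coarse \<alpha>))"

lemma coarse_poly_single: "0 < a \<Longrightarrow> coarse_poly x [a] = x a"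
  by (simp add: coarse_poly_def coarse_single)

lemma coarse_poly_Cons:
  assumes "is_composition (a # b # l)"
  shows "coarse_poly x (a # b # l) = x a * coarse_poly x (b # l) + coarse_poly x ((a + b) # l)"
proof -
  have "coarse_poly x (a # b # l) =
      (\<Sum>L\<in>(#) a ` coarse (b # l). prod_list (map x L)) + coarse_poly x ((a + b) # l)"
    unfolding coarse_poly_def coarse_Cons(1)[OF assms]
    by (rule sum.union_disjoint) (use coarse_Cons(2)[OF assms] in auto)
  also have "(\<Sum>L\<in>(#) a ` coarse (b # l). prod_list (map x L)) = x a * coarse_poly x (b # l)"
    by (simp add: sum.reindex coarse_poly_def sum_distrib_left)
  finally show ?thesis .
qed

lemma coarse_poly_types:
  "coarse_poly x \<alpha> = (\<Sum>N\<in>#coarse_types \<alpha>. \<Prod>k\<in>#N. x k)"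
  by (simp add: coarse_poly_def coarse_types_def multiset.map_comp comp_def
      sum_unfold_sum_mset prod_mset_prod_list flip: mset_map)

lemma coarse_poly_cong:
  "coarse_types \<alpha> = coarse_types \<beta> \<Longrightarrow> coarse_poly x \<alpha> = coarse_poly x \<beta>"
  by (simp add: coarse_poly_types)

lemma count_coarse_types: "count (coarse_types \<alpha>) N = card {L \<in> coarse \<alpha>. mset L = N}"
  unfolding coarse_types_def
  by (simp add: count_image_mset Int_def vimage_def conj_commute)

text \<open>Being a coarsening of itself, \<alpha> gives its multiset of parts positive multiplicity
  on both sides. This transfers size and length between \<alpha> and \<beta>.\<close>

lemma coarse_with_parts:
  assumes "is_composition \<alpha>" "\<alpha> \<noteq> []" "coarse_types \<alpha> = coarse_types \<beta>"
  shows "\<exists>L\<in>coarse \<beta>. mset L = mset \<alpha>"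
proof -
  have "\<alpha> \<in> coarse \<alpha>" using assms by (simp add: coarse_def)
  then have "0 < card {L \<in> coarse \<alpha>. mset L = mset \<alpha>}" by (auto simp: card_gt_0_iff)
  then have "0 < card {L \<in> coarse \<beta>. mset L = mset \<alpha>}"
    using assms(3) by (metis count_coarse_types)
  then show ?thesis by (auto simp: card_gt_0_iff)
qed

lemma coarse_rev:
  assumes "is_composition \<alpha>"
  shows "coarse (rev \<alpha>) = rev ` coarse \<alpha>"
proof -
  have sub: "rev ` coarse \<beta> \<subseteq> coarse (rev \<beta>)" if "is_composition \<beta>" for \<beta>
    using that by (fastforce simp: coarse_def psums_rev)
  have "coarse (rev \<alpha>) = rev ` rev ` coarse (rev \<alpha>)" by (simp add: image_image)
  also have "\<dots> \<subseteq> rev ` coarse \<alpha>" using sub[of "rev \<alpha>"] assms by auto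
  finally show ?thesis using sub[OF assms] by blast
qed

lemma coarse_types_rev: "is_composition \<alpha> \<Longrightarrow> coarse_types (rev \<alpha>) = coarse_types \<alpha>"
proof -
  assume "is_composition \<alpha>"
  then have "coarse_types (rev \<alpha>) = image_mset mset (image_mset rev (mset_set (coarse \<alpha>)))"
    by (simp add: coarse_types_def coarse_rev image_mset_mset_set)
  then show ?thesis by (simp add: coarse_types_def multiset.map_comp comp_def)
qed

section \<open>Composition of compositions\<close>

lemma near_concat_nonempty [simp]: "near_concat \<alpha> \<beta> \<noteq> []"
  by (simp add: near_concat_def)

lemma near_concat_append: "\<beta> \<noteq> [] \<Longrightarrow> near_concat \<alpha> (\<beta> @ \<gamma>) = near_concat \<alpha> \<beta> @ \<gamma>"
  by (simp add: near_concat_def)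

lemma near_concat_append_left: "\<beta> \<noteq> [] \<Longrightarrow> near_concat (\<alpha> @ \<beta>) \<gamma> = \<alpha> @ near_concat \<beta> \<gamma>"
  by (simp add: near_concat_def butlast_append)

lemma near_concat_assoc:
  assumes "\<alpha> \<noteq> []" "\<beta> \<noteq> []" "\<gamma> \<noteq> []"
  shows "near_concat (near_concat \<alpha> \<beta>) \<gamma> = near_concat \<alpha> (near_concat \<beta> \<gamma>)"
proof -
  obtain \<alpha>' a where a: "\<alpha> = \<alpha>' @ [a]" using assms by (meson rev_exhaust)
  obtain c \<gamma>' where c: "\<gamma> = c # \<gamma>'" using assms by (cases \<gamma>) auto
  show ?thesis
  proof (cases "tl \<beta>" rule: rev_cases)
    case Nil
    then obtain b where "\<beta> = [b]" using assms by (cases \<beta>) auto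
    then show ?thesis by (simp add: near_concat_def a c)
  next
    case (snoc m b')
    then obtain b where "\<beta> = b # m @ [b']" using assms by (cases \<beta>) auto
    then show ?thesis by (simp add: near_concat_def a c butlast_append)
  qed
qed

lemma near_concat_comp:
  "is_composition \<alpha> \<Longrightarrow> is_composition \<beta> \<Longrightarrow> \<alpha> \<noteq> [] \<Longrightarrow> \<beta> \<noteq> [] \<Longrightarrow> is_composition (near_concat \<alpha> \<beta>)"
  by (cases \<alpha> rule: rev_cases; cases \<beta>) (auto simp: near_concat_def)

lemma sum_list_near_concat:
  "\<alpha> \<noteq> [] \<Longrightarrow> \<beta> \<noteq> [] \<Longrightarrow> sum_list (near_concat \<alpha> \<beta>) = sum_list \<alpha> + sum_list \<beta>"
  by (cases \<alpha> rule: rev_cases; cases \<beta>) (auto simp: near_concat_def)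

lemma rev_near_concat:
  "\<alpha> \<noteq> [] \<Longrightarrow> \<beta> \<noteq> [] \<Longrightarrow> rev (near_concat \<alpha> \<beta>) = near_concat (rev \<beta>) (rev \<alpha>)"
  by (cases \<alpha> rule: rev_cases; cases \<beta>) (auto simp: near_concat_def)

lemma near_pow_1 [simp]: "near_pow \<beta> (Suc 0) = \<beta>"
  by (simp add: near_pow_def)

lemma near_pow_Suc: "0 < i \<Longrightarrow> near_pow \<beta> (Suc i) = near_concat \<beta> (near_pow \<beta> i)"
  by (cases i) (simp_all add: near_pow_def)

lemma near_pow_nonempty [simp]: "\<beta> \<noteq> [] \<Longrightarrow> near_pow \<beta> i \<noteq> []"
  by (cases "i - 1") (simp_all add: near_pow_def)

lemma near_pow_add:
  assumes "\<beta> \<noteq> []" "0 < i" "0 < j"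
  shows "near_pow \<beta> (i + j) = near_concat (near_pow \<beta> i) (near_pow \<beta> j)"
  using \<open>0 < i\<close>
proof (induction i rule: nat_induct_non_zero)
  case 1
  then show ?case using assms near_pow_Suc[of j] by simp
next
  case (Suc i)
  then show ?case using assms by (simp add: near_pow_Suc near_concat_assoc)
qed

lemma near_pow_comp: "0 < i \<Longrightarrow> is_composition \<beta> \<Longrightarrow> \<beta> \<noteq> [] \<Longrightarrow> is_composition (near_pow \<beta> i)"
  by (induction i rule: nat_induct_non_zero) (auto simp: near_pow_Suc near_concat_comp)

lemma sum_list_near_pow: "0 < i \<Longrightarrow> \<beta> \<noteq> [] \<Longrightarrow> sum_list (near_pow \<beta> i) = i * sum_list \<beta>"
  by (induction i rule: nat_induct_non_zero) (auto simp: near_pow_Suc sum_list_near_concat)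

lemma rev_near_pow: "0 < i \<Longrightarrow> \<beta> \<noteq> [] \<Longrightarrow> rev (near_pow \<beta> i) = near_pow (rev \<beta>) i"
proof (induction i rule: nat_induct_non_zero)
  case (Suc i)
  have "near_pow (rev \<beta>) (i + 1) = near_concat (near_pow (rev \<beta>) i) (near_pow (rev \<beta>) 1)"
    using Suc by (intro near_pow_add) auto
  then show ?case using Suc by (simp add: near_pow_Suc rev_near_concat)
qed simp

lemma comp_circ_simps [simp]:
  "comp_circ [] \<beta> = []"
  "comp_circ (a # \<alpha>) \<beta> = near_pow \<beta> a @ comp_circ \<alpha> \<beta>"
  "comp_circ (\<alpha> @ \<alpha>') \<beta> = comp_circ \<alpha> \<beta> @ comp_circ \<alpha>' \<beta>"
  by (simp_all add: comp_circ_def)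

lemma comp_circ_eq_Nil_iff [simp]: "\<beta> \<noteq> [] \<Longrightarrow> comp_circ \<alpha> \<beta> = [] \<longleftrightarrow> \<alpha> = []"
  by (cases \<alpha>) auto

lemma comp_circ_comp:
  "is_composition \<alpha> \<Longrightarrow> is_composition \<beta> \<Longrightarrow> \<beta> \<noteq> [] \<Longrightarrow> is_composition (comp_circ \<alpha> \<beta>)"
  by (induction \<alpha>) (auto simp: near_pow_comp)

lemma sum_list_comp_circ:
  "is_composition \<alpha> \<Longrightarrow> \<beta> \<noteq> [] \<Longrightarrow> sum_list (comp_circ \<alpha> \<beta>) = sum_list \<alpha> * sum_list \<beta>"
  by (induction \<alpha>) (auto simp: sum_list_near_pow algebra_simps)

lemma rev_comp_circ:
  "is_composition \<alpha> \<Longrightarrow> \<beta> \<noteq> [] \<Longrightarrow> rev (comp_circ \<alpha> \<beta>) = comp_circ (rev \<alpha>) (rev \<beta>)"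
  by (induction \<alpha>) (auto simp: rev_near_pow)

lemma near_concat_comp_circ:
  assumes "is_composition \<alpha>" "is_composition \<beta>" "\<alpha> \<noteq> []" "\<beta> \<noteq> []" "\<gamma> \<noteq> []"
  shows "comp_circ (near_concat \<alpha> \<beta>) \<gamma> = near_concat (comp_circ \<alpha> \<gamma>) (comp_circ \<beta> \<gamma>)"
proof -
  obtain \<alpha>' a where a: "\<alpha> = \<alpha>' @ [a]" using assms by (meson rev_exhaust)
  obtain b \<beta>' where b: "\<beta> = b # \<beta>'" using assms by (cases \<beta>) auto
  show ?thesis
    using assms by (simp add: a b near_concat_def[of "\<alpha>' @ [a]"] near_pow_add near_concat_append
        near_concat_append_left)
qed

lemma comp_circ_near_pow:
  assumes "is_composition \<alpha>" "\<alpha> \<noteq> []" "\<gamma> \<noteq> []" "0 < i"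
  shows "comp_circ (near_pow \<alpha> i) \<gamma> = near_pow (comp_circ \<alpha> \<gamma>) i"
  using \<open>0 < i\<close>
proof (induction i rule: nat_induct_non_zero)
  case (Suc i)
  then show ?case using assms
    by (simp add: near_pow_Suc near_concat_comp_circ near_pow_comp)
qed (use assms in simp)

text \<open>The cut between \<alpha> and \<beta> is either kept, which gives the product, or
  dropped, which gives the near concatenation.\<close>

lemma coarse_poly_append:
  assumes "is_composition \<alpha>" "is_composition \<beta>" "\<alpha> \<noteq> []" "\<beta> \<noteq> []"
  shows "coarse_poly x (\<alpha> @ \<beta>) =
    coarse_poly x \<alpha> * coarse_poly x \<beta> + coarse_poly x (near_concat \<alpha> \<beta>)"
  using assms
proof (induction "length \<alpha>" arbitrary: \<alpha> rule: less_induct)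
  case less
  obtain b \<beta>' where \<beta>: "\<beta> = b # \<beta>'" using less.prems by (cases \<beta>) auto
  show ?case
  proof (cases \<alpha> rule: psums.cases)
    case (2 a)
    then show ?thesis using less.prems \<beta>
      by (simp add: coarse_poly_Cons coarse_poly_single near_concat_def)
  next
    case (3 a c l)
    have nc: "near_concat (a # c # l) \<beta> = a # near_concat (c # l) \<beta>"
      by (simp add: near_concat_def)
    have nc': "near_concat ((a + c) # l) \<beta> = (a + hd (near_concat (c # l) \<beta>)) # tl (near_concat (c # l) \<beta>)"
      by (cases l) (auto simp: near_concat_def)
    have comp: "is_composition (near_concat (c # l) \<beta>)"
      using less.prems 3 by (intro near_concat_comp) auto
    obtain d m where dm: "near_concat (c # l) \<beta> = d # m"
      using near_concat_nonempty by (meson list.exhaust)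
    have "coarse_poly x (\<alpha> @ \<beta>) = x a * coarse_poly x ((c # l) @ \<beta>) + coarse_poly x (((a + c) # l) @ \<beta>)"
      using less.prems 3 by (simp add: coarse_poly_Cons)
    also have "coarse_poly x ((c # l) @ \<beta>) =
        coarse_poly x (c # l) * coarse_poly x \<beta> + coarse_poly x (near_concat (c # l) \<beta>)"
      using less.prems 3 by (intro less.hyps) auto
    also have "coarse_poly x (((a + c) # l) @ \<beta>) =
        coarse_poly x ((a + c) # l) * coarse_poly x \<beta> + coarse_poly x (near_concat ((a + c) # l) \<beta>)"
      using less.prems 3 by (intro less.hyps) auto
    also have "coarse_poly x (near_concat \<alpha> \<beta>) =
        x a * coarse_poly x (near_concat (c # l) \<beta>) + coarse_poly x (near_concat ((a + c) # l) \<beta>)"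
      using comp less.prems by (simp add: 3 nc nc' dm coarse_poly_Cons)
    moreover have "coarse_poly x \<alpha> = x a * coarse_poly x (c # l) + coarse_poly x ((a + c) # l)"
      using less.prems 3 by (simp add: coarse_poly_Cons)
    ultimately show ?thesis by (simp add: algebra_simps)
  qed (use less.prems in auto)
qed

text \<open>Merging two parts of \<alpha> amounts to near concatenation of the two near powers of
  \<beta>; so \<open>coarse_poly_append\<close> for the blocks mirrors
  \<open>coarse_poly_Cons\<close> for the parts.\<close>

lemma coarse_poly_comp_circ:
  assumes "is_composition \<alpha>" "is_composition \<beta>" "\<alpha> \<noteq> []" "\<beta> \<noteq> []"
  shows "coarse_poly x (comp_circ \<alpha> \<beta>) = coarse_poly (\<lambda>k. coarse_poly x (near_pow \<beta> k)) \<alpha>"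
  using assms
proof (induction "length \<alpha>" arbitrary: \<alpha> rule: less_induct)
  case less
  show ?case
  proof (cases \<alpha> rule: psums.cases)
    case (2 a)
    then show ?thesis using less.prems by (simp add: coarse_poly_single)
  next
    case (3 a b l)
    have "coarse_poly x (comp_circ \<alpha> \<beta>) = coarse_poly x (near_pow \<beta> a @ comp_circ (b # l) \<beta>)"
      by (simp add: 3)
    also have "\<dots> = coarse_poly x (near_pow \<beta> a) * coarse_poly x (comp_circ (b # l) \<beta>) +
        coarse_poly x (near_concat (near_pow \<beta> a) (comp_circ (b # l) \<beta>))"
      using less.prems 3 by (intro coarse_poly_append comp_circ_comp near_pow_comp) auto
    also have "near_concat (near_pow \<beta> a) (comp_circ (b # l) \<beta>) = comp_circ ((a + b) # l) \<beta>"
      using less.prems 3 by (simp add: near_pow_add near_concat_append)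
    finally show ?thesis
      using less.prems 3 less.hyps[of "b # l"] less.hyps[of "(a + b) # l"]
      by (simp add: coarse_poly_Cons)
  qed (use less.prems in auto)
qed

section \<open>Pairs of odd functions on a cyclic group\<close>

definition subgroup_int :: "int set \<Rightarrow> bool" where
  "subgroup_int G \<longleftrightarrow> 0 \<in> G \<and> (\<forall>x\<in>G. \<forall>y\<in>G. x - y \<in> G)"

lemma subgroup_int_add: "subgroup_int G \<Longrightarrow> x \<in> G \<Longrightarrow> y \<in> G \<Longrightarrow> x + y \<in> G"
  unfolding subgroup_int_def by (metis diff_0 diff_minus_eq_add)

lemma subgroup_int_mult:
  assumes G: "subgroup_int G" and "x \<in> G"
  shows "k * x \<in> G"
proof -
  have nat: "int m * x \<in> G" for m
    using assms by (induction m) (auto simp: subgroup_int_def[of G] algebra_simps intro: subgroup_int_add)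
  then have "0 - int (nat (- k)) * x \<in> G"
    using G unfolding subgroup_int_def by blast
  then show ?thesis using nat[of "nat k"] by (cases "k \<ge> 0") auto
qed

text \<open>By division with remainder, the least positive element of G divides all of G, hence also
  the Gcd of X. Without positive elements G is trivial and the Gcd is 0.\<close>

lemma Gcd_in_subgroup_int:
  assumes G: "subgroup_int G" and X: "X \<subseteq> G"
  shows "Gcd X \<in> G"
proof (cases "\<exists>x\<in>G. x > 0")
  case True
  define d where "d = (LEAST m. 0 < m \<and> int m \<in> G)"
  have ex: "\<exists>m. 0 < m \<and> int m \<in> G"
    using True by (metis zero_less_imp_eq_int)
  have d: "0 < d" "int d \<in> G" using LeastI_ex[OF ex] by (auto simp: d_def)
  have "int d dvd x" if x: "x \<in> G" for x
  proof (rule ccontr)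
    assume "\<not> int d dvd x"
    then have "x mod int d \<noteq> 0" by (simp add: mod_eq_0_iff_dvd)
    then have pos: "x mod int d > 0" using d pos_mod_sign[of "int d" x] by linarith
    have "x - x div int d * int d \<in> G"
      using G x subgroup_int_mult[OF G d(2)] unfolding subgroup_int_def by blast
    then have "x mod int d \<in> G" by (simp only: minus_div_mult_eq_mod)
    then have "d \<le> nat (x mod int d)"
      using pos unfolding d_def by (intro Least_le) auto
    then show False using d pos pos_mod_bound[of "int d" x] by linarith
  qed
  then have "int d dvd Gcd X" using X by (intro Gcd_greatest) auto
  then show ?thesis using subgroup_int_mult[OF G d(2)] by (metis dvd_def mult.commute)
next
  case False
  have "x = 0" if "x \<in> G" for x
  proof -
    have "0 - x \<in> G" using that G unfolding subgroup_int_def by blast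
    then have "\<not> 0 < 0 - x" "\<not> 0 < x" using that False by blast+
    then show ?thesis by simp
  qed
  then have "X \<subseteq> {0}" using X by auto
  then have "Gcd X = 0" by (simp add: Gcd_0_iff)
  then show ?thesis using G by (metis subgroup_int_def)
qed

lemma gcd_in_subgroup_int:
  assumes "subgroup_int G" "x \<in> G" "y \<in> G"
  shows "gcd x y \<in> G"
  using Gcd_in_subgroup_int[of G "{x, y}"] assms by simp

text \<open>Together with \<open>Gcd_in_subgroup_int\<close>: a function invariant under all shifts
  in X is invariant under the shift by the Gcd of X.\<close>

lemma subgroup_int_periods: "subgroup_int {d. \<forall>z. F (z + d) = F z}"
  unfolding subgroup_int_def
proof (intro conjI ballI CollectI allI)
  fix a b z assume "a \<in> {d. \<forall>z. F (z + d) = F z}" "b \<in> {d. \<forall>z. F (z + d) = F z}"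
  then have "F (z - b + a) = F (z - b)" "F (z - b + b) = F (z - b)" by blast+
  moreover have "z - b + a = z + (a - b)" "z - b + b = z" by simp_all
  ultimately show "F (z + (a - b)) = F z" by metis
qed simp

text \<open>Functions on the integers modulo n are represented by n-periodic functions. The axioms
  are symmetric in f and g (\<open>swap\<close>), so that lemmas about f also serve for g.\<close>

locale odd_pair =
  fixes n :: int and f g :: "int \<Rightarrow> int"
  assumes n_pos: "0 < n"
    and f_per: "f (x + n) = f x" and g_per: "g (x + n) = g x"
    and f_odd: "f (- x) = - f x" and g_odd: "g (- x) = - g x"
    and f_range: "f x \<in> {-1, 0, 1}" and g_range: "g x \<in> {-1, 0, 1}"
    and disj: "f x = 0 \<or> g x = 0"
    and additive: "f (x + y) = f x + f y \<or> g (x + y) = g x + g y"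
begin

lemma swap: "odd_pair n g f"
proof
  show "g x = 0 \<or> f x = 0" for x using disj[of x] by blast
  show "g (x + y) = g x + g y \<or> f (x + y) = f x + f y" for x y using additive[of x y] by blast
qed (rule n_pos f_per g_per f_odd g_odd f_range g_range)+

lemma f_0: "f 0 = 0"
  using f_odd[of 0] by simp

lemma f_mult_n: "f (x + int k * n) = f x"
proof (induction k)
  case (Suc k)
  then show ?case using f_per[of "x + int k * n"] by (simp add: algebra_simps)
qed simp

text \<open>Disjointness gives f x = 0 and g y = 0. So additivity says that y + x inherits f y or g
  x, and disjointness excludes both at once. In the first case y beats x, in the second y loses to
  x.\<close>

lemma winner:
  assumes "f y \<noteq> 0" "g x \<noteq> 0"
  shows "(f (y + x) = f y \<and> g (y + x) = 0) \<or> (f (y + x) = 0 \<and> g (y + x) = g x)"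
  using additive[of y x] disj[of x] disj[of y] disj[of "y + x"] assms by auto

text \<open>The sum f y + f y' = 2 f y is outside the range of f, so additivity holds for g, which
  vanishes at y and y'.\<close>

lemma g_add_eq_0:
  assumes "f y \<noteq> 0" "f y' = f y"
  shows "g (y + y') = 0"
  using additive[of y y'] disj[of y] disj[of y'] f_range[of "y + y'"] f_range[of y] assms by auto

text \<open>If \<open>y + x\<close> were in the support of \<open>f\<close> but \<open>y - x\<close> in that of \<open>g\<close>, then \<open>f\<close> would take the
  value \<open>f y\<close> at all positive multiples of \<open>y\<close>, in particular at \<open>0\<close>.\<close>

lemma winner_minus:
  assumes y: "f y \<noteq> 0" and x: "g x \<noteq> 0" and yx: "f (y + x) \<noteq> 0"
  shows "f (y - x) = f y"
proof (rule ccontr)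
  assume "f (y - x) \<noteq> f y"
  then have m: "g (y - x) \<noteq> 0" using winner[of y "- x"] y x g_odd[of x] by auto
  have "f (int (Suc k) * y) = f y \<and> f (int (Suc k) * y + x) = f y" for k
  proof (induction k)
    case 0
    then show ?case using winner[OF y x] yx by auto
  next
    case (Suc k)
    let ?z = "int (Suc k) * y"
    \<comment> \<open>The argument is \<open>y + ?z\<close>. Either f wins there, or g takes the
      nonzero value g (y - x), which \<open>g_add_eq_0\<close> excludes.\<close>
    have "f ((?z + x) + (y - x)) = f (?z + x) \<or> g ((?z + x) + (y - x)) = g (y - x)"
      using Suc y winner[OF _ m, of "?z + x"] by auto
    moreover have "g (y + ?z) = 0" using Suc y by (intro g_add_eq_0) auto
    ultimately have 1: "f (y + ?z) = f y" using m Suc by (auto simp: add.commute)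
    have "g (y + (?z + x)) = 0" using Suc y by (intro g_add_eq_0) auto
    moreover have "f ((y + ?z) + x) = f (y + ?z) \<or> g ((y + ?z) + x) = g x"
      using winner[of "y + ?z" x] 1 y x by auto
    ultimately have "f (y + ?z + x) = f y" using 1 x by (auto simp: add.assoc)
    then show ?case using 1 by (simp add: algebra_simps)
  qed
  from this[of "nat n - 1"] have "f (n * y) = f y" using n_pos by auto
  moreover have "f (n * y) = 0"
  proof (cases "y \<ge> 0")
    case True
    then show ?thesis using f_mult_n[of 0 "nat y"] f_0 by (simp add: mult.commute)
  next
    case False
    then show ?thesis using f_mult_n[of "n * y" "nat (- y)"] f_0 by (simp add: algebra_simps)
  qed
  ultimately show False using y by simp
qed

lemma winner_minus_iff:
  assumes "f y \<noteq> 0" "g x \<noteq> 0"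
  shows "f (y - x) \<noteq> 0 \<longleftrightarrow> f (y + x) \<noteq> 0"
proof
  assume "f (y - x) \<noteq> 0"
  then show "f (y + x) \<noteq> 0" using winner_minus[of y "- x"] assms g_odd[of x] by auto
next
  assume "f (y + x) \<noteq> 0"
  then show "f (y - x) \<noteq> 0" using winner_minus[of y x] assms by auto
qed

text \<open>Write y + y' as (y - x) + (y' + x) and as (y + x) + (y' - x). If f did not have the
  value f y there, g would win in both, with the opposite values g x and - g x.\<close>

lemma winner_trans:
  assumes y: "f y \<noteq> 0" and x: "g x \<noteq> 0" and y': "f y' \<noteq> 0"
    and 1: "f (y + x) \<noteq> 0" and 2: "f (y' + x) = 0"
  shows "f (y + y') = f y"
proof -
  have a: "f (y - x) = f y" "f (y + x) = f y"
    using winner_minus[OF y x 1] winner[OF y x] 1 by auto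
  have b: "g (y' + x) = g x" using winner[OF y' x] 2 y' by auto
  have c: "g (y' - x) = - g x"
    using winner[of y' "- x"] winner_minus_iff[OF y' x] 2 y' x g_odd[of x] by auto
  have "f (y + y') = f y \<or> g (y + y') = g x"
    using winner[of "y - x" "y' + x"] a b y x by auto
  moreover have "f (y + y') = f y \<or> g (y + y') = - g x"
    using winner[of "y + x" "y' - x"] a c y x by auto
  ultimately show ?thesis using x by auto
qed

lemma f_mod: "f (x mod n) = f x"
proof -
  have "x = x mod n + n * (x div n)" by simp
  show ?thesis
  proof (cases "x div n \<ge> 0")
    case True
    then show ?thesis using f_mult_n[of "x mod n" "nat (x div n)"] by (simp add: mult.commute)
  next
    case False
    then show ?thesis using f_mult_n[of x "nat (- (x div n))"]
      by (simp add: minus_mult_div_eq_mod algebra_simps)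
  qed
qed

text \<open>Take y in the support of f that beats the most x modulo n. If the claim fails, y loses
  to some x, which loses to some y2; by maximality some x2 is beaten by y but not by y2. Now
  \<open>winner_trans\<close>, used with both signs, makes f y equal to f y2 and to - f y2.\<close>

lemma top_exists:
  assumes "\<exists>y. f y \<noteq> 0"
  shows "(\<exists>y. f y \<noteq> 0 \<and> (\<forall>x. g x \<noteq> 0 \<longrightarrow> f (y + x) \<noteq> 0)) \<or>
         (\<exists>x. g x \<noteq> 0 \<and> (\<forall>y. f y \<noteq> 0 \<longrightarrow> g (x + y) \<noteq> 0))"
proof (rule ccontr)
  assume contra: "\<not> ?thesis"
  define W where "W y = {x \<in> {0..<n}. g x \<noteq> 0 \<and> f (y + x) \<noteq> 0}" for y
  interpret s: odd_pair n g f by (rule swap)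
  have fin: "finite (W y)" for y by (rule finite_subset[of _ "{0..<n}"]) (auto simp: W_def)
  have W: "x mod n \<in> W y \<longleftrightarrow> g x \<noteq> 0 \<and> f (y + x) \<noteq> 0" for x y
  proof -
    have "f (y + x mod n) = f (y + x)"
      by (metis f_mod mod_add_right_eq)
    then show ?thesis using n_pos s.f_mod[of x] by (simp add: W_def)
  qed
  have bound: "card (W y) < nat n + 1" for y
  proof -
    have "card (W y) \<le> card {0..<n}" by (rule card_mono) (auto simp: W_def)
    then show ?thesis by simp
  qed
  obtain y where y: "f y \<noteq> 0" and max: "\<And>z. f z \<noteq> 0 \<Longrightarrow> card (W z) \<le> card (W y)"
  proof -
    obtain y0 where "f y0 \<noteq> 0" using assms by blast
    then show ?thesis
      using ex_has_greatest_nat[of "\<lambda>y. f y \<noteq> 0" y0 "\<lambda>y. card (W y)" "nat n + 1"] bound that by blast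
  qed
  from contra y obtain x where x: "g x \<noteq> 0" "f (y + x) = 0" by auto
  from contra x obtain y2 where y2: "f y2 \<noteq> 0" "g (x + y2) = 0" by auto
  then have y2x: "f (y2 + x) \<noteq> 0" using winner[of y2 x] x by (auto simp: add.commute)
  have "x mod n \<in> W y2" "x mod n \<notin> W y" using W x y2x by auto
  then have "\<not> W y \<subseteq> W y2"
    using max[OF y2(1)] psubset_card_mono[OF fin, of "W y" y2] by auto
  then obtain x2 where x2: "g x2 \<noteq> 0" "f (y + x2) \<noteq> 0" "f (y2 + x2) = 0"
    by (auto simp: W_def)
  \<comment> \<open>With z also - z loses to w; so \<open>winner_trans\<close> applies to - y and -
    y2 as well.\<close>
  have neg: "f (- z) \<noteq> 0" "f (- z + w) = 0" if "f z \<noteq> 0" "g w \<noteq> 0" "f (z + w) = 0" for z w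
    using that winner_minus_iff[of z w] f_odd[of z] f_odd[of "z - w"] by auto
  have "f (y2 + y) = f y2" using winner_trans[of y2 x y] y2 y x y2x by auto
  moreover have "f (y2 + - y) = f y2"
    using winner_trans[of y2 x "- y"] y2 y x y2x neg[of y x] by auto
  moreover have "f (y + y2) = f y" using winner_trans[of y x2 y2] y2 y x2 by auto
  moreover have "f (y + - y2) = f y"
    using winner_trans[of y x2 "- y2"] y2 y x2 neg[of y2 x2] by auto
  moreover have "f (y + - y2) = - f (y2 + - y)" using f_odd[of "y2 - y"] by simp
  moreover have "f (y2 + y) = f (y + y2)" by (rule arg_cong[of _ _ f]) simp
  ultimately show False using y by linarith
qed

text \<open>The set Y of points beating the whole support of g is invariant under shifts by that
  support, hence under the subgroup generated by it and n. If y were in this subgroup, 0 would lie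
  in Y.\<close>

lemma top_outside_subgroup:
  assumes y: "f y \<noteq> 0" and top: "\<And>x. g x \<noteq> 0 \<Longrightarrow> f (y + x) \<noteq> 0"
  shows "\<not> Gcd (insert n {x. g x \<noteq> 0}) dvd y"
proof (rule notI)
  define Y where "Y = {y. f y \<noteq> 0 \<and> (\<forall>x. g x \<noteq> 0 \<longrightarrow> f (y + x) \<noteq> 0)}"
  define G where "G = {z. \<forall>y. y + z \<in> Y \<longleftrightarrow> y \<in> Y}"
  interpret s: odd_pair n g f by (rule swap)
  have G: "subgroup_int G" unfolding G_def by (rule subgroup_int_periods)
  have step: "z + b \<in> Y" if z: "z \<in> Y" and b: "g b \<noteq> 0" for z b
  proof -
    have fz: "f z \<noteq> 0" "f (z + b) \<noteq> 0" using z b by (auto simp: Y_def)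
    have "f (z + b + b') \<noteq> 0" if b': "g b' \<noteq> 0" for b'
    proof
      assume "f (z + b + b') = 0"
      then have 0: "f (- (z + b) + b') = 0"
      proof -
        have "f (z + b - b') = 0" using winner_minus_iff[OF fz(2) b'] \<open>f (z + b + b') = 0\<close> by blast
        moreover have "- (z + b) + b' = - (z + b - b')" by simp
        ultimately show ?thesis using f_odd[of "z + b - b'"] by presburger
      qed
      have "f (z + b') \<noteq> 0" using z b' unfolding Y_def by blast
      moreover have "f (- (z + b)) \<noteq> 0" using fz(2) f_odd[of "z + b"] by presburger
      \<comment> \<open>Here z beats b' while - (z + b) loses to it; the conclusion is that f does
        not vanish at - b, a point of the support of g.\<close>
      ultimately have "f (z + - (z + b)) = f z"
        using winner_trans[OF fz(1) b' _ _ 0] by blast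
      then have "f (- b) = f z" by simp
      then show False using fz(1) b disj[of "- b"] g_odd[of b] by simp
    qed
    then show ?thesis using fz unfolding Y_def by blast
  qed
  have "insert n {x. g x \<noteq> 0} \<subseteq> G"
  proof
    fix b assume "b \<in> insert n {x. g x \<noteq> 0}"
    then show "b \<in> G"
    proof
      assume "b = n"
      have "f (z + n + x) = f (z + x)" for z x
        using f_per[of "z + x"] by (metis add.assoc add.commute)
      then have "y + n \<in> Y \<longleftrightarrow> y \<in> Y" for y unfolding Y_def using f_per by simp
      then show ?thesis unfolding G_def \<open>b = n\<close> by blast
    next
      assume "b \<in> {x. g x \<noteq> 0}"
      then have b: "g b \<noteq> 0" "g (- b) \<noteq> 0" using g_odd[of b] by auto
      have "y \<in> Y" if "y + b \<in> Y" for y using step[OF that b(2)] by simp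
      then show ?thesis using step[OF _ b(1)] unfolding G_def by blast
    qed
  qed
  then have "Gcd (insert n {x. g x \<noteq> 0}) \<in> G" using Gcd_in_subgroup_int[OF G] by blast
  moreover assume "Gcd (insert n {x. g x \<noteq> 0}) dvd y"
  ultimately have "y \<in> G" using subgroup_int_mult[OF G] by (metis dvd_def mult.commute)
  then have "0 + y \<in> Y \<longleftrightarrow> 0 \<in> Y" unfolding G_def by blast
  moreover have "y \<in> Y" using y top unfolding Y_def by blast
  moreover have "0 \<notin> Y" using f_0 unfolding Y_def by blast
  ultimately show False by simp
qed

end

section \<open>The ratio of two chain series\<close>

lemma finite_submultisets [simp]: "finite {N. N \<subseteq># (M :: 'a multiset)}"
proof (rule finite_subset)
  show "{N. N \<subseteq># M} \<subseteq> mset ` {xs. set xs \<subseteq> set_mset M \<and> length xs \<le> size M}"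
  proof
    fix N assume N: "N \<in> {N. N \<subseteq># M}"
    obtain xs where "mset xs = N" using ex_mset by blast
    then show "N \<in> mset ` {xs. set xs \<subseteq> set_mset M \<and> length xs \<le> size M}"
      using N by (intro image_eqI[of _ _ xs]) (auto dest: set_mset_mono size_mset_mono mset_subset_eqD)
  qed
qed (simp add: finite_lists_length_le)

lemma submultisets_single: "{N. N \<subseteq># {#a#}} = {{#}, {#a#}}"
proof -
  have "N = {#} \<or> N = {#a#}" if "N \<subseteq># {#a#}" for N
    using that by (cases N) (auto simp: insert_subset_eq_iff)
  then show ?thesis by auto
qed

lemma submultisets_pair: "{N. N \<subseteq># {#a, b#}} = {{#}, {#a#}, {#b#}, {#a, b#}}"
proof -
  have "N \<in> {{#}, {#a#}, {#b#}, {#a, b#}}" if N: "N \<subseteq># {#a, b#}" for N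
  proof (cases "a \<in># N")
    case True
    then obtain N' where N': "N = add_mset a N'" by (metis mset_add)
    then have "N' \<subseteq># {#b#}" using N by simp
    then show ?thesis using N' submultisets_single[of b] by auto
  next
    case False
    then have "N \<subseteq># {#b#}" using N
      by (metis diff_single_trivial insert_subset_eq_iff add_mset_remove_trivial subset_eq_diff_conv
          union_mset_add_mset_right add_0_right)
    then show ?thesis using submultisets_single[of b] by auto
  qed
  then show ?thesis by auto
qed

definition weight :: "nat multiset \<Rightarrow> int" where
  "weight M = int (sum_mset M)"

lemma weight_simps [simp]:
  "weight {#} = 0" "weight (add_mset a M) = int a + weight M" "weight (M + N) = weight M + weight N"
  by (simp_all add: weight_def del: of_nat_sum_mset)

lemma dvd_weight: "\<forall>e\<in>#N. h dvd int e \<Longrightarrow> h dvd weight N"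
  by (induction N) auto

lemma weight_nonneg [simp]: "0 \<le> weight N"
  by (simp add: weight_def del: of_nat_sum_mset)

lemma weight_pos: "N \<noteq> {#} \<Longrightarrow> 0 \<notin># N \<Longrightarrow> 0 < weight N"
  by (induction N) (auto intro: add_pos_nonneg)

lemma weight_submset_less:
  assumes "N \<subset># M" "0 \<notin># M"
  shows "weight N < weight M"
proof -
  have M: "M = N + (M - N)" "M - N \<noteq> {#}"
    using assms(1) by (auto simp: subset_mset.less_le Diff_eq_empty_iff_mset)
  then have "0 < weight (M - N)" using assms by (intro weight_pos) (auto dest: in_diffD)
  then show ?thesis using M(1) weight_simps(3)[of N "M - N"] by simp
qed

text \<open>\<open>A\<close> and \<open>C\<close> stand for the indicator functions on \<open>\<int>/n\<close> of two sets \<open>S\<close> and \<open>T\<close>, and \<open>u\<close> for the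
  coefficients of the quotient \<open>P\<^sub>S / P\<^sub>T\<close>, which equals \<open>P\<^sub>n\<^sub>-\<^sub>T / P\<^sub>n\<^sub>-\<^sub>S\<close>; \<open>FC\<close> and \<open>FB\<close> stand for the
  coefficients of \<open>(x\<^sub>1 + x\<^sub>2 + \<dots>) P\<^sub>T\<close> and \<open>(x\<^sub>1 + x\<^sub>2 + \<dots>) P\<^sub>n\<^sub>-\<^sub>S\<close>.\<close>

locale chain_ratio =
  fixes n :: int and A C :: "int \<Rightarrow> int" and u FC FB :: "nat multiset \<Rightarrow> int"
  assumes n_pos: "0 < n"
    and A_per: "A (x + n) = A x" and C_per: "C (x + n) = C x"
    and A_range: "A x \<in> {0, 1}" and C_range: "C x \<in> {0, 1}"
    and balanced: "A x + A (- x) = C x + C (- x)"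
    and u_single: "0 < e \<Longrightarrow> int e < n \<Longrightarrow> u {#e#} = A (int e) - C (int e)"
    and u_A: "M \<noteq> {#} \<Longrightarrow> 0 \<notin># M \<Longrightarrow> weight M < n \<Longrightarrow>
      A (weight M) = C (weight M) \<Longrightarrow>
      u M = (\<Sum>N\<in>{N. N \<subset># M \<and> N \<noteq> {#}}.
        u N * FC (M - N) * (A (weight M) - C (weight M - weight N)))"
    and u_B: "M \<noteq> {#} \<Longrightarrow> 0 \<notin># M \<Longrightarrow> weight M < n \<Longrightarrow>
      A (weight M) = C (weight M) \<Longrightarrow>
      u M = (\<Sum>N\<in>{N. N \<subset># M \<and> N \<noteq> {#}}.
        u N * FB (M - N) * (A (- weight M) - A (weight N - weight M)))"
    and FC_single: "0 < e \<Longrightarrow> int e < n \<Longrightarrow> FC {#e#} = 1" and FB_single: "0 < e \<Longrightarrow> int e < n \<Longrightarrow> FB {#e#} = 1"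
    and FC_pair: "0 < e \<Longrightarrow> 0 < e' \<Longrightarrow> e \<noteq> e' \<Longrightarrow> int e + int e' < n \<Longrightarrow>
      FC {#e, e'#} = C (int e) + C (int e')"
    and FB_pair: "0 < e \<Longrightarrow> 0 < e' \<Longrightarrow> e \<noteq> e' \<Longrightarrow> int e + int e' < n \<Longrightarrow>
      FB {#e, e'#} = A (- int e) + A (- int e')"
    and additive_pos: "0 < x \<Longrightarrow> 0 < y \<Longrightarrow> x + y < n \<Longrightarrow>
      A (x + y) - C (- (x + y)) = (A x - C (- x)) + (A y - C (- y)) \<or>
      A (x + y) - C (x + y) = (A x - C x) + (A y - C y)"
begin

section \<open>The pair f, g of a chain ratio\<close>

definition f :: "int \<Rightarrow> int" where "f x = A x - C (- x)"
definition g :: "int \<Rightarrow> int" where "g x = A x - C x"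

lemma C_minus_per: "C (x - n) = C x"
  using C_per[of "x - n"] by simp

lemma f_per: "f (x + n) = f x" and g_per: "g (x + n) = g x"
  using C_minus_per[of "- x"] by (auto simp: f_def g_def A_per C_per)

lemma f_odd: "f (- x) = - f x" and g_odd: "g (- x) = - g x"
  using balanced[of x] by (auto simp: f_def g_def)

lemma f_range: "f x \<in> {-1, 0, 1}" and g_range: "g x \<in> {-1, 0, 1}"
  using A_range[of x] C_range[of x] C_range[of "- x"] by (auto simp: f_def g_def)

lemma disj: "f x = 0 \<or> g x = 0"
  using A_range[of x] C_range[of x] A_range[of "- x"] C_range[of "- x"] balanced[of x]
  by (auto simp: f_def g_def)

lemma A_mult_n: "A (x + j * n) = A x" and C_mult_n: "C (x + j * n) = C x"
proof -
  have nat: "A (x + int m * n) = A x \<and> C (x + int m * n) = C x" for x m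
  proof (induction m)
    case (Suc m)
    then show ?case using A_per[of "x + int m * n"] C_per[of "x + int m * n"]
      by (simp add: algebra_simps)
  qed simp
  have "A (x + j * n) = A x \<and> C (x + j * n) = C x"
  proof (cases "j \<ge> 0")
    case True
    then show ?thesis using nat[of x "nat j"] by simp
  next
    case False
    then show ?thesis using nat[of "x + j * n" "nat (- j)"] by (simp add: algebra_simps)
  qed
  then show "A (x + j * n) = A x" "C (x + j * n) = C x" by auto
qed

lemma A_cong: "n dvd y - x \<Longrightarrow> A y = A x" and C_cong: "n dvd y - x \<Longrightarrow> C y = C x"
  using A_mult_n[of x "(y - x) div n"] C_mult_n[of x "(y - x) div n"] by auto

lemma f_cong_n: "n dvd y - x \<Longrightarrow> f y = f x" and g_cong_n: "n dvd y - x \<Longrightarrow> g y = g x"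
  using A_cong[of y x] C_cong[of y x] C_cong[of "- y" "- x"]
  by (auto simp: f_def g_def dvd_diff_commute)

text \<open>\<open>additive_pos\<close> covers representatives whose sum is below n. For a larger
  sum, oddness allows one to pass to n - x and n - y, whose sum is below n.\<close>

lemma additive: "f (x + y) = f x + f y \<or> g (x + y) = g x + g y"
proof -
  let ?x = "x mod n" and ?y = "y mod n"
  have x: "n dvd x - ?x" "0 \<le> ?x" "?x < n" and y: "n dvd y - ?y" "0 \<le> ?y" "?y < n"
    using n_pos by auto
  have xy: "n dvd (x + y) - (?x + ?y)" using dvd_add[OF x(1) y(1)] by (simp add: algebra_simps)
  have 0: "f 0 = 0" "g 0 = 0" using f_odd[of 0] g_odd[of 0] by auto
  have "f (?x + ?y) = f ?x + f ?y \<or> g (?x + ?y) = g ?x + g ?y"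
  proof -
    consider "?x = 0" | "?y = 0" | "?x > 0" "?y > 0" "?x + ?y < n" | "?x > 0" "?y > 0" "?x + ?y = n"
      | "?x > 0" "?y > 0" "?x + ?y > n" using x y by linarith
    then show ?thesis
    proof cases
      case 3
      then show ?thesis using additive_pos[of ?x ?y] by (simp add: f_def g_def)
    next
      case 4
      then have "f ?y = f (- ?x)" by (intro f_cong_n) (simp add: add.commute)
      moreover have "f (?x + ?y) = f 0" using 4 by (intro f_cong_n) auto
      ultimately show ?thesis using f_odd[of ?x] 0 by auto
    next
      case 5
      let ?x' = "n - ?x" and ?y' = "n - ?y"
      have "f (?x' + ?y') = f ?x' + f ?y' \<or> g (?x' + ?y') = g ?x' + g ?y'"
        using additive_pos[of ?x' ?y'] 5 x y by (simp add: f_def g_def)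
      moreover have "n dvd ?x' + ?y' - (- (?x + ?y))" by simp
      then have "f (?x' + ?y') = f (- (?x + ?y))" "g (?x' + ?y') = g (- (?x + ?y))"
        by (blast intro: f_cong_n g_cong_n)+
      moreover have "f ?x' = f (- ?x)" "g ?x' = g (- ?x)" "f ?y' = f (- ?y)" "g ?y' = g (- ?y)"
        by (auto intro: f_cong_n g_cong_n)
      ultimately show ?thesis unfolding f_odd g_odd by linarith
    qed (use 0 in auto)
  qed
  then show ?thesis
    using f_cong_n[OF x(1)] f_cong_n[OF y(1)] f_cong_n[OF xy] g_cong_n[OF x(1)] g_cong_n[OF y(1)]
      g_cong_n[OF xy] by auto
qed

sublocale odd_pair n f g
  using n_pos f_per g_per f_odd g_odd f_range g_range disj additive by unfold_locales

text \<open>Where A and C agree at x they agree at - x too, by \<open>balanced\<close>; there f is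
  the antisymmetrisation of A.\<close>

lemma f_alt: "g x = 0 \<Longrightarrow> f x = A x - A (- x)" and f_alt': "g x = 0 \<Longrightarrow> f x = C x - A (- x)"
  using balanced[of x] by (auto simp: f_def g_def)

text \<open>These are the shifts by which the recursions for u compare values of A outside the
  multiples of h, and so the candidates for periods.\<close>

definition K :: "int \<Rightarrow> int set" where
  "K h = {k. k < n \<and> (\<exists>M. M \<noteq> {#} \<and> weight M = k \<and> u M \<noteq> 0 \<and> (\<forall>e\<in>#M. 0 < e \<and> h dvd int e))}"

lemma K_pos: "k \<in> K h \<Longrightarrow> 0 < k"
proof -
  assume "k \<in> K h"
  then obtain M where "M \<noteq> {#}" "weight M = k" "\<forall>e\<in>#M. 0 < e \<and> h dvd int e" unfolding K_def by blast
  then show ?thesis using weight_pos[of M] by blast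
qed

lemma K_mono: "h' dvd h \<Longrightarrow> K h \<subseteq> K h'"
  unfolding K_def by (auto dest: dvd_trans)

lemma g_in_K:
  assumes "0 < b" "b < n" "g b \<noteq> 0" "h dvd b"
  shows "b \<in> K h"
proof -
  have "u {#nat b#} \<noteq> 0" using assms u_single[of "nat b"] by (simp add: g_def)
  moreover have "weight {#nat b#} = b" using assms by simp
  ultimately show ?thesis using assms unfolding K_def
    by (intro CollectI conjI exI[of _ "{#nat b#}"]) auto
qed

text \<open>The bounds on c reflect that the recursions for u only reach sizes below n; nothing is
  claimed about shifts that wrap around modulo n.\<close>

definition inert :: "int \<Rightarrow> int \<Rightarrow> bool" where
  "inert h k \<longleftrightarrow> (\<forall>c. \<not> h dvd c \<longrightarrow> k < c \<longrightarrow> c < n \<longrightarrow> A c = A (c - k))"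

text \<open>The multiples of h contain the support of g, and f is h-periodic outside them. In the
  application k is the least size in \<open>K h\<close> that is not inert, and M is a monomial of u
  of that size.\<close>

context
  fixes h k :: int and M :: "nat multiset"
  assumes g_supp: "\<And>x. g x \<noteq> 0 \<Longrightarrow> h dvd x"
    and f_h: "\<And>x. \<not> h dvd x \<Longrightarrow> f (x + h) = f x"
    and hn: "h dvd n" "0 < h"
    and inert: "\<And>k'. k' \<in> K h \<Longrightarrow> k' < k \<Longrightarrow> inert h k'"
    and M: "M \<noteq> {#}" "\<forall>e\<in>#M. 0 < e \<and> h dvd int e" "weight M = k" "u M \<noteq> 0"
begin

lemma C_eq_A: "\<not> h dvd x \<Longrightarrow> C x = A x"
  using g_supp[of x] unfolding g_def by force

lemma f_eq_A: "\<not> h dvd x \<Longrightarrow> f x = A x - A (- x)" and f_eq_C: "\<not> h dvd x \<Longrightarrow> f x = C x - A (- x)"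
  using g_supp[of x] f_alt[of x] f_alt'[of x] by metis+

lemma f_cong:
  assumes "\<not> h dvd x" "h dvd y - x"
  shows "f y = f x"
proof -
  have nat: "f (x + int m * h) = f x" if "\<not> h dvd x" for x m
  proof (induction m)
    case (Suc m)
    have "\<not> h dvd x + int m * h" using that by (simp add: dvd_add_left_iff)
    then show ?case using f_h[of "x + int m * h"] Suc by (simp add: algebra_simps)
  qed simp
  obtain j where j: "y - x = h * j" using assms by (auto simp: dvd_def)
  have ny: "\<not> h dvd y" using assms dvd_diff[of h y "y - x"] by auto
  show ?thesis
  proof (cases "j \<ge> 0")
    case True
    then show ?thesis using nat[OF assms(1), of "nat j"] j by (simp add: algebra_simps)
  next
    case False
    then show ?thesis using nat[OF ny, of "nat (- j)"] j by (simp add: algebra_simps)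
  qed
qed

lemma submset_split:
  assumes "N \<subseteq># M' + Z" "\<forall>e\<in>#M'. h dvd int e" "\<forall>e\<in>#Z. \<not> h dvd int e"
  obtains N1 N2 where "N = N1 + N2" "N1 \<subseteq># M'" "N2 \<subseteq># Z"
proof
  show "N = {#e \<in># N. h dvd int e#} + {#e \<in># N. \<not> h dvd int e#}" by (rule multiset_partition)
  have 1: "filter_mset (\<lambda>e. h dvd int e) M' = M'" "filter_mset (\<lambda>e. h dvd int e) Z = {#}"
    "filter_mset (\<lambda>e. \<not> h dvd int e) M' = {#}" "filter_mset (\<lambda>e. \<not> h dvd int e) Z = Z"
    using assms by (auto simp: filter_mset_eq_conv)
  show "{#e \<in># N. h dvd int e#} \<subseteq># M'"
    using multiset_filter_mono[OF assms(1), of "\<lambda>e. h dvd int e"] 1 by simp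
  show "{#e \<in># N. \<not> h dvd int e#} \<subseteq># Z"
    using multiset_filter_mono[OF assms(1), of "\<lambda>e. \<not> h dvd int e"] 1 by simp
qed

lemma u_smaller:
  assumes N: "N \<subset># M" "N \<noteq> {#}" "u N \<noteq> 0" and c: "\<not> h dvd c" "k \<le> c" "c < n"
  shows "A c = A (c - weight N)"
proof -
  have pos: "\<forall>e\<in>#N. 0 < e \<and> h dvd int e" using N M by (meson mset_subset_eqD subset_mset.less_imp_le)
  have less: "weight N < k" using weight_submset_less[OF N(1)] M by auto
  then have "weight N \<in> K h" unfolding K_def using N pos c by auto
  then show ?thesis using inert[of "weight N"] less c unfolding inert_def by auto
qed

lemma no_dvd_part:
  assumes "\<forall>Y. Y \<subseteq># Z \<longrightarrow> Y \<noteq> {#} \<longrightarrow> \<not> h dvd weight Y"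
  shows "\<forall>e\<in>#Z. \<not> h dvd int e"
proof
  fix e assume "e \<in># Z"
  then have "{#e#} \<subseteq># Z" by simp
  then show "\<not> h dvd int e" using assms[rule_format, of "{#e#}"] by simp
qed

text \<open>In the expansion \<open>u_A\<close>, a term N inside N1 has u N = 0 or an inert size,
  and then its bracket vanishes; a term involving parts of Z has u N = 0 by induction.\<close>

lemma u_vanishes:
  assumes "N1 \<subset># M" "Z \<noteq> {#}" "0 \<notin># Z" "\<forall>Y. Y \<subseteq># Z \<longrightarrow> Y \<noteq> {#} \<longrightarrow> \<not> h dvd weight Y"
    "weight (N1 + Z) < n"
  shows "u (N1 + Z) = 0"
  using assms
proof (induction "size (N1 + Z)" arbitrary: N1 Z rule: less_induct)
  case less
  note Z = less.prems
  let ?c = "weight (N1 + Z)"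
  have N1: "\<forall>e\<in>#N1. 0 < e \<and> h dvd int e"
    using Z M by (meson mset_subset_eqD subset_mset.less_imp_le)
  have hN1: "h dvd weight N1" using N1 by (intro dvd_weight) auto
  have c: "\<not> h dvd ?c" using Z(4)[rule_format, of Z] Z(2) hN1 by (simp add: dvd_add_right_iff)
  have "u (N1 + Z) = (\<Sum>N\<in>{N. N \<subset># N1 + Z \<and> N \<noteq> {#}}.
        u N * FC (N1 + Z - N) * (A ?c - C (?c - weight N)))"
  proof (rule u_A)
    show "0 \<notin># N1 + Z" using N1 Z(3) by force
    show "A ?c = C ?c" using C_eq_A[OF c] by simp
  qed (use Z(2,5) in auto)
  also have "\<dots> = 0"
  proof (rule sum.neutral, rule ballI)
    fix N assume "N \<in> {N. N \<subset># N1 + Z \<and> N \<noteq> {#}}"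
    then have N: "N \<subset># N1 + Z" "N \<noteq> {#}" by auto
    obtain P Q where PQ: "N = P + Q" "P \<subseteq># N1" "Q \<subseteq># Z"
      using submset_split[of N N1 Z] N N1 no_dvd_part[OF Z(4)] by (auto dest: subset_mset.less_imp_le)
    have PM: "P \<subset># M" using PQ Z by auto
    show "u N * FC (N1 + Z - N) * (A ?c - C (?c - weight N)) = 0"
    proof (cases "Q = {#}")
      case True
      have dP: "h dvd weight P"
        using PQ N1 by (intro dvd_weight) (auto dest: mset_subset_eqD)
      have sub: "\<not> h dvd ?c - weight P" using c dP by (simp add: dvd_diff_left_iff)
      have "A ?c = A (?c - weight P)" if uP: "u P \<noteq> 0"
      proof -
        have pos: "\<forall>e\<in>#P. 0 < e \<and> h dvd int e" using N1 PQ by (meson mset_subset_eqD)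
        have less: "weight P < k" using weight_submset_less[OF PM] M by auto
        have "weight P < weight (N1 + Z)"
          using weight_submset_less[OF N(1)] Z N1 True PQ by auto
        moreover have "weight P \<in> K h" unfolding K_def
          using N PQ True pos uP calculation Z(5) by auto
        ultimately show ?thesis using inert[of "weight P"] less c Z(5)
          unfolding inert_def by auto
      qed
      then show ?thesis using PQ True C_eq_A[OF sub] by auto
    next
      case False
      have "u (P + Q) = 0"
      proof (rule less.hyps)
        show "size (P + Q) < size (N1 + Z)" using mset_subset_size[OF N(1)] PQ by simp
        show "0 \<notin># Q" using PQ Z by (auto dest: mset_subset_eqD)
        show "\<forall>Y. Y \<subseteq># Q \<longrightarrow> Y \<noteq> {#} \<longrightarrow> \<not> h dvd weight Y"
          using Z(4) PQ by (meson subset_mset.order_trans)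
        have "weight N < weight (N1 + Z)"
          using weight_submset_less[OF N(1)] Z N1 by auto
        then show "weight (P + Q) < n" using Z(5) PQ(1) by simp
      qed (use PM False in auto)
      then show ?thesis using PQ by simp
    qed
  qed
  finally show ?case .
qed

text \<open>Only N = M survives in \<open>u_A\<close>: the other N inside M have u N = 0 or an inert
  size, and those containing e besides a proper part of M fall under
  \<open>u_vanishes\<close>.\<close>

lemma u_one_more:
  assumes e: "0 < e" "\<not> h dvd int e" "k + int e < n"
  shows "u (M + {#e#}) = u M * (A (k + int e) - A (int e))"
proof -
  let ?c = "weight (M + {#e#})"
  have hk: "h dvd k" using dvd_weight[of M h] M by auto
  have c: "\<not> h dvd ?c" "?c = k + int e" using e hk M by (auto simp: dvd_add_left_iff)
  let ?t = "\<lambda>N. u N * FC (M + {#e#} - N) * (A ?c - C (?c - weight N))"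
  have "u (M + {#e#}) = (\<Sum>N\<in>{N. N \<subset># M + {#e#} \<and> N \<noteq> {#}}. ?t N)"
  proof (rule u_A)
    show "0 \<notin># M + {#e#}" using M(2) e by force
    show "weight (M + {#e#}) < n" using c(2) e by simp
    show "A ?c = C ?c" using C_eq_A[OF c(1)] by simp
  qed simp
  also have "\<dots> = (\<Sum>N\<in>{M}. ?t N)"
  proof (rule sum.mono_neutral_right)
    show "finite {N. N \<subset># M + {#e#} \<and> N \<noteq> {#}}"
      by (rule finite_subset[OF _ finite_submultisets[of "M + {#e#}"]]) (auto dest: subset_mset.less_imp_le)
    show "\<forall>N\<in>{N. N \<subset># M + {#e#} \<and> N \<noteq> {#}} - {M}. ?t N = 0"
    proof
      fix N assume "N \<in> {N. N \<subset># M + {#e#} \<and> N \<noteq> {#}} - {M}"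
      then have N: "N \<subset># M + {#e#}" "N \<noteq> {#}" "N \<noteq> M" by auto
      obtain P Q where PQ: "N = P + Q" "P \<subseteq># M" "Q \<subseteq># {#e#}"
        using submset_split[of N M "{#e#}"] N M e by (auto dest: subset_mset.less_imp_le)
      have Q: "Q = {#} \<or> Q = {#e#}" using submultisets_single[of e] PQ(3) by blast
      have PM: "P \<subset># M" using PQ N Q by (auto simp: subset_mset.less_le)
      show "?t N = 0"
      proof (cases "Q = {#}")
        case True
        have dP: "h dvd weight P"
          using PQ M by (intro dvd_weight) (auto dest: mset_subset_eqD)
        have "\<not> h dvd ?c - weight P" using c dP by (simp add: dvd_diff_left_iff)
        moreover have "A ?c = A (?c - weight P)" if "u P \<noteq> 0"
        proof (rule u_smaller[OF PM _ that c(1)])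
          show "P \<noteq> {#}" using N PQ True by simp
          show "k \<le> ?c" "?c < n" using c(2) e by simp_all
        qed
        ultimately show ?thesis using PQ True C_eq_A by auto
      next
        case False
        have "u (P + {#e#}) = 0"
        proof (rule u_vanishes[OF PM])
          show "\<forall>Y. Y \<subseteq># {#e#} \<longrightarrow> Y \<noteq> {#} \<longrightarrow> \<not> h dvd weight Y"
          proof (intro allI impI)
            fix Y :: "nat multiset" assume "Y \<subseteq># {#e#}" "Y \<noteq> {#}"
            then have "Y = {#e#}" using submultisets_single[of e] by blast
            then show "\<not> h dvd weight Y" using e by simp
          qed
          show "weight (P + {#e#}) < n"
            using weight_submset_less[OF PM] M(2,3) e(3) by force
        qed (use e in auto)
        then show ?thesis using PQ Q False by simp
      qed
    qed
  qed (use M(1) in auto)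
  also have "\<dots> = u M * (A (k + int e) - A (int e))"
    using c(2) M(3) C_eq_A[OF e(2)] FC_single[OF e(1)] e(3) weight_nonneg[of M] by (simp add: add.commute)
  finally show ?thesis .
qed

text \<open>Both \<open>u_A\<close> and \<open>u_B\<close> expand u at M extended by e and e'. In
  the difference only the terms for M, M with e and M with e' survive, and u M can be divided
  out.\<close>

lemma pair_relation:
  assumes e: "0 < e" "0 < e'" "e \<noteq> e'" "\<not> h dvd int e" "\<not> h dvd int e'" "\<not> h dvd int e + int e'"
    and less: "k + int e + int e' < n"
  defines "s \<equiv> \<lambda>x. A (x + k) - A x"
  shows "s (int e + int e') * (f (int e) + f (int e')) + s (int e) * (f (int e + int e') - f (int e')) +
    s (int e') * (f (int e + int e') - f (int e)) = 0"
proof -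
  let ?Z = "{#e, e'#}"
  let ?c = "weight (M + ?Z)"
  let ?S = "{N. N \<subset># M + ?Z \<and> N \<noteq> {#}}"
  have hk: "h dvd k" using dvd_weight[of M h] M by auto
  have c: "\<not> h dvd ?c" "?c = k + int e + int e'"
    using e hk M by (auto simp: dvd_add_right_iff add.assoc[symmetric] dvd_add_left_iff)
  have M0: "0 \<notin># M + ?Z" using M(2) e by force
  have subZ: "Y = {#} \<or> Y = {#e#} \<or> Y = {#e'#} \<or> Y = ?Z" if "Y \<subseteq># ?Z" for Y
    using submultisets_pair[of e e'] that by blast
  let ?t = "\<lambda>N. u N * (FC (M + ?Z - N) * (A ?c - C (?c - weight N)) -
      FB (M + ?Z - N) * (A (- ?c) - A (weight N - ?c)))"
  have "(\<Sum>N\<in>?S. u N * FC (M + ?Z - N) * (A ?c - C (?c - weight N))) =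
    (\<Sum>N\<in>?S. u N * FB (M + ?Z - N) * (A (- ?c) - A (weight N - ?c)))"
  proof -
    have *: "M + ?Z \<noteq> {#}" "weight (M + ?Z) < n" "A ?c = C ?c"
      using c(2) less C_eq_A[OF c(1)] by auto
    show ?thesis using u_A[OF *(1) M0 *(2,3)] u_B[OF *(1) M0 *(2,3)] by simp
  qed
  then have "0 = (\<Sum>N\<in>?S. ?t N)"
    by (simp only: sum_subtractf right_diff_distrib mult.assoc diff_self)
  also have "\<dots> = (\<Sum>N\<in>{M, M + {#e#}, M + {#e'#}}. ?t N)"
  proof (rule sum.mono_neutral_right)
    show "finite ?S"
      by (rule finite_subset[OF _ finite_submultisets[of "M + ?Z"]]) (auto dest: subset_mset.less_imp_le)
    show "{M, M + {#e#}, M + {#e'#}} \<subseteq> ?S"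
      using M(1) by (auto simp: subset_mset.less_le)
    show "\<forall>N\<in>?S - {M, M + {#e#}, M + {#e'#}}. ?t N = 0"
    proof
      fix N assume "N \<in> ?S - {M, M + {#e#}, M + {#e'#}}"
      then have N: "N \<subset># M + ?Z" "N \<noteq> {#}" "N \<noteq> M" "N \<noteq> M + {#e#}" "N \<noteq> M + {#e'#}" by auto
      obtain P Q where PQ: "N = P + Q" "P \<subseteq># M" "Q \<subseteq># ?Z"
        using submset_split[of N M ?Z] N M e by (auto dest: subset_mset.less_imp_le)
      have PM: "P \<subset># M" using PQ N subZ[OF PQ(3)] by (auto simp: subset_mset.less_le)
      show "?t N = 0"
      proof (cases "Q = {#}")
        case True
        have dP: "h dvd weight P"
          using PQ M by (intro dvd_weight) (auto dest: mset_subset_eqD)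
        have sub: "\<not> h dvd ?c - weight P" using c dP by (simp add: dvd_diff_left_iff)
        have "A ?c = A (?c - weight P)" if "u P \<noteq> 0"
        proof (rule u_smaller[OF PM _ that c(1)])
          show "P \<noteq> {#}" using N PQ True by simp
          show "k \<le> ?c" "?c < n" using c(2) less by simp_all
        qed
        \<comment> \<open>Periodicity of f carries the invariance of A under this shift from
          \<open>?c\<close> over to \<open>- ?c\<close>, so that the bracket from \<open>u_B\<close>
          vanishes too.\<close>
        moreover have "f ?c = f (?c - weight P)" using dP sub by (intro f_cong) auto
        moreover have "f ?c = A ?c - A (- ?c)" by (rule f_eq_A[OF c(1)])
        moreover have "f (?c - weight P) = A (?c - weight P) - A (- (?c - weight P))"
          by (rule f_eq_A[OF sub])
        ultimately show ?thesis using PQ True C_eq_A[OF sub] by (cases "u P = 0") simp_all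
      next
        case False
        have "u (P + Q) = 0"
        proof (rule u_vanishes[OF PM False])
          show "0 \<notin># Q" using PQ(3) e by (auto dest: mset_subset_eqD)
          show "\<forall>Y. Y \<subseteq># Q \<longrightarrow> Y \<noteq> {#} \<longrightarrow> \<not> h dvd weight Y"
          proof (intro allI impI)
            fix Y assume Y: "Y \<subseteq># Q" "Y \<noteq> {#}"
            then have "Y = {#e#} \<or> Y = {#e'#} \<or> Y = ?Z"
              using subZ[of Y] PQ(3) by (meson subset_mset.order_trans)
            then show "\<not> h dvd weight Y" using e by (auto simp: add.commute)
          qed
          have "weight N < ?c" using weight_submset_less[OF N(1) M0] .
          then show "weight (P + Q) < n" using PQ(1) c(2) less by simp
        qed
        then show ?thesis using PQ by simp
      qed
    qed
  qed
  also have "\<dots> = ?t M + ?t (M + {#e#}) + ?t (M + {#e'#})"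
    using e by simp
  also have "?t M = u M * (s (int e + int e') * (f (int e) + f (int e')))"
  proof -
    let ?y = "int e + int e'"
    have y: "?c - weight M = ?y" "weight M - ?c = - ?y" "?c = ?y + k" using c(2) M(3) by auto
    have "int e + int e' < n" using less M(3) weight_nonneg[of M] by linarith
    then have "FC ?Z = C (int e) + C (int e')" "FB ?Z = A (- int e) + A (- int e')"
      using e by (auto intro!: FC_pair FB_pair)
    moreover have "f (int e) = C (int e) - A (- int e)" "f (int e') = C (int e') - A (- int e')"
      using f_eq_C e by auto
    moreover have "A (- ?c) - A (- ?y) = s ?y"
    proof -
      have "f ?c = f ?y" using e y hk by (intro f_cong) auto
      moreover have "f ?y = A ?y - A (- ?y)" "f ?c = A ?c - A (- ?c)"
        using f_eq_A e c by auto
      moreover have "s ?y = A ?c - A ?y" unfolding s_def using y(3) by (simp add: add.assoc)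
      ultimately show ?thesis by linarith
    qed
    moreover have "A ?c - C ?y = s ?y" using y C_eq_A[OF e(6)] by (simp add: s_def add.assoc)
    moreover have "?t M = u M * (FC ?Z * (A ?c - C ?y) - FB ?Z * (A (- ?c) - A (- ?y)))"
      using y(1,2) by (simp only: add_diff_cancel_left')
    ultimately have "?t M = u M * ((C (int e) + C (int e')) * s ?y - (A (- int e) + A (- int e')) * s ?y)"
      and "C (int e) = f (int e) + A (- int e)" "C (int e') = f (int e') + A (- int e')"
      by (simp_all only: diff_add_cancel)
    moreover from this(2,3)
    have "(C (int e) + C (int e')) * s ?y - (A (- int e) + A (- int e')) * s ?y
        = s ?y * (f (int e) + f (int e'))" by (simp add: algebra_simps)
    ultimately show ?thesis by (simp only:)
  qed
  also have "?t (M + {#e#}) = u M * (s (int e) * (f (int e + int e') - f (int e')))"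
  proof -
    have "?c - weight (M + {#e#}) = int e'" "weight (M + {#e#}) - ?c = - int e'" by auto
    moreover have "M + ?Z - (M + {#e#}) = {#e'#}" by simp
    moreover have "u (M + {#e#}) = u M * s (int e)"
      using u_one_more[of e] e less by (simp add: s_def add.commute)
    moreover have "A ?c - A (- ?c) = f (int e + int e')"
    proof -
      have "f ?c = f (int e + int e')" using e c(2) hk by (intro f_cong) auto
      then show ?thesis using f_eq_A[OF c(1)] by simp
    qed
    moreover have "C (int e') - A (- int e') = f (int e')"
      using f_eq_C[OF e(5)] by simp
    moreover have "int e' < n" using less M(3) weight_nonneg[of M] by linarith
    ultimately show ?thesis using FC_single[OF e(2)] FB_single[OF e(2)] by (simp add: algebra_simps)
  qed
  also have "?t (M + {#e'#}) = u M * (s (int e') * (f (int e + int e') - f (int e)))"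
  proof -
    have "?c - weight (M + {#e'#}) = int e" "weight (M + {#e'#}) - ?c = - int e" by auto
    moreover have "M + ?Z - (M + {#e'#}) = {#e#}" by simp
    moreover have "u (M + {#e'#}) = u M * s (int e')"
      using u_one_more[of e'] e less by (simp add: s_def add.commute)
    moreover have "A ?c - A (- ?c) = f (int e + int e')"
    proof -
      have "f ?c = f (int e + int e')" using e c(2) hk by (intro f_cong) auto
      then show ?thesis using f_eq_A[OF c(1)] by simp
    qed
    moreover have "C (int e) - A (- int e) = f (int e)"
      using f_eq_C[OF e(4)] by simp
    moreover have "int e < n" using less M(3) weight_nonneg[of M] by linarith
    ultimately show ?thesis using FC_single[OF e(1)] FB_single[OF e(1)] by (simp add: algebra_simps)
  qed
  finally show ?thesis using M(4) by (simp flip: distrib_left)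
qed

section \<open>Transport of the differences A (x + k) - A x between residue classes\<close>

lemma hk: "h dvd k"
  using dvd_weight[of M h] M by auto

text \<open>The reflection of x to n - k - x preserves the range from 0 to n - k. As A x - A (- x) =
  f x is unchanged by adding k, it reverses the sign of the difference.\<close>

lemma k_reflect:
  assumes "\<not> h dvd x"
  shows "A (n - k - x + k) - A (n - k - x) = - (A (x + k) - A x)"
proof -
  have xk: "\<not> h dvd x + k" using assms hk by (simp add: dvd_add_left_iff)
  have "A (n - k - x + k) = A (- x)" "A (n - k - x) = A (- (x + k))"
    by (auto intro!: A_cong simp: algebra_simps)
  moreover have "f (x + k) = f x" using assms hk by (intro f_cong) auto
  moreover have "f x = A x - A (- x)" "f (x + k) = A (x + k) - A (- (x + k))"
    using f_eq_A[OF assms] f_eq_A[OF xk] by auto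
  ultimately show ?thesis by linarith
qed

text \<open>A nonzero f x determines A x, and f has the same value at x + k.\<close>

lemma f_eq_0_if_shift:
  assumes "\<not> h dvd x" "A (x + k) \<noteq> A x"
  shows "f x = 0"
proof (rule ccontr)
  assume "f x \<noteq> 0"
  have xk: "\<not> h dvd x + k" using assms hk by (simp add: dvd_add_left_iff)
  have "f (x + k) = f x" using assms hk by (intro f_cong) auto
  moreover have "f x = A x - A (- x)" "f (x + k) = A (x + k) - A (- (x + k))"
    using f_eq_A[OF assms(1)] f_eq_A[OF xk] by auto
  ultimately show False
    using \<open>f x \<noteq> 0\<close> assms(2) A_range[of x] A_range[of "- x"] A_range[of "x + k"] A_range[of "- (x + k)"]
    by auto
qed

lemma ndvd_add_if_shift:
  assumes "f i \<noteq> 0" "\<not> h dvd x" "A (x + k) \<noteq> A x"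
  shows "\<not> h dvd x + i"
proof
  assume "h dvd x + i"
  then have "h dvd - i - x" by (metis dvd_minus_iff minus_diff_eq diff_minus_eq_add add.commute)
  then have "f (- i) = f x" using assms(2) by (intro f_cong) auto
  then show False using f_eq_0_if_shift[OF assms(2,3)] assms(1) f_odd[of i] by simp
qed

text \<open>This is \<open>pair_relation\<close> for the parts y - x and x. As f is nonzero at y -
  x, the difference at y - x is zero, and f x is zero because the difference at x is not; two terms
  remain.\<close>

lemma transport_up:
  assumes i: "f i \<noteq> 0" "\<not> h dvd i" and x: "0 < x" "\<not> h dvd x" "A (x + k) \<noteq> A x"
    and y: "x < y" "y < n - k" "h dvd y - (x + i)"
  shows "\<not> h dvd x + i" "(A (y + k) - A y) * f i = (A (x + k) - A x) * (f i - f (x + i))"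
proof -
  have fx: "f x = 0" by (rule f_eq_0_if_shift[OF x(2,3)])
  show xi: "\<not> h dvd x + i" by (rule ndvd_add_if_shift[OF i(1) x(2,3)])
  have hy: "\<not> h dvd y" using xi y(3) dvd_diff[of h y "y - (x + i)"] by auto
  have "h dvd (y - x) - i" using y(3) by (simp add: algebra_simps)
  then have fe: "f (y - x) = f i" and he: "\<not> h dvd y - x"
    using i f_cong[of i "y - x"] dvd_diff[of h "y - x" "y - x - i"] by auto
  have fy: "f y = f (x + i)" using xi y(3) by (intro f_cong) auto
  have "int (nat (y - x)) = y - x" "int (nat x) = x" using x y by auto
  moreover have "nat (y - x) \<noteq> nat x" using x y fe fx i by (metis calculation)
  ultimately have "(A (y + k) - A y) * (f (y - x) + f x) +
      (A (y - x + k) - A (y - x)) * (f y - f x) + (A (x + k) - A x) * (f y - f (y - x)) = 0"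
    using pair_relation[of "nat (y - x)" "nat x"] x y he hy by simp
  moreover have "A (y - x + k) - A (y - x) = 0" using f_eq_0_if_shift[OF he] fe i by auto
  ultimately show "(A (y + k) - A y) * f i = (A (x + k) - A x) * (f i - f (x + i))"
    using fx fe fy by (simp add: algebra_simps)
qed

text \<open>By \<open>transport_up\<close> the difference at y is that at x times 1 - f (x + i) / f
  i; this factor is 1 or 2, and 2 would leave the range of differences. The case of y below x
  follows by reflection.\<close>

lemma transport:
  assumes i: "f i \<noteq> 0" "\<not> h dvd i" and x: "0 < x" "x < n - k" "\<not> h dvd x" "A (x + k) \<noteq> A x"
    and xi: "f (x + i) \<noteq> f i" and y: "0 < y" "y < n - k" "h dvd y - (x + i)"
  shows "A (y + k) - A y = A (x + k) - A x" "f (x + i) = 0"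
proof -
  have eq: "(A (y + k) - A y) * f i = (A (x + k) - A x) * (f i - f (x + i))"
  proof (cases "x < y")
    case True
    then show ?thesis using transport_up[of i x y] i x y by auto
  next
    case False
    have "x \<noteq> y" using y i by auto
    let ?x = "n - k - x" and ?y = "n - k - y"
    have hx: "\<not> h dvd ?x" using x hk hn
      by (metis dvd_diff dvd_diff_left_iff dvd_diff_commute)
    have sx: "A (?x + k) - A ?x = - (A (x + k) - A x)" by (rule k_reflect) fact
    have up: "\<not> h dvd ?x + - i"
      "(A (?y + k) - A ?y) * f (- i) = (A (?x + k) - A ?x) * (f (- i) - f (?x + - i))"
    proof -
      have *: "f (- i) \<noteq> 0" "\<not> h dvd - i" "0 < ?x" "A (?x + k) \<noteq> A ?x" "?x < ?y" "?y < n - k"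
        using i x y sx f_odd[of i] \<open>x \<noteq> y\<close> False by auto
      have "?y - (?x + - i) = - (y - (x + i))" by simp
      then have **: "h dvd ?y - (?x + - i)" using y(3) by (simp only: dvd_minus_iff)
      show "\<not> h dvd ?x + - i"
        "(A (?y + k) - A ?y) * f (- i) = (A (?x + k) - A ?x) * (f (- i) - f (?x + - i))"
        using transport_up[OF *(1,2,3) hx *(4,5,6) **] by auto
    qed
    have hxi: "\<not> h dvd x + i"
    proof
      assume "h dvd x + i"
      then have "h dvd n - k - (x + i)" using hk hn by auto
      then show False using up(1) by (simp add: algebra_simps)
    qed
    have "f (?x + - i) = f (- (x + i))"
    proof (rule f_cong)
      show "\<not> h dvd - (x + i)" using hxi dvd_minus_iff by blast
      have "?x + - i - - (x + i) = n - k" by simp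
      then show "h dvd ?x + - i - - (x + i)" using hk hn(1) by (simp only: dvd_diff)
    qed
    moreover have "\<not> h dvd y" using hxi y(3) dvd_diff[of h y "y - (x + i)"] by auto
    then have "A (?y + k) - A ?y = - (A (y + k) - A y)" by (rule k_reflect)
    ultimately have "- (A (y + k) - A y) * - f i = - (A (x + k) - A x) * (- f i - - f (x + i))"
      using up(2) sx f_odd[of i] f_odd[of "x + i"] by (simp only:)
    then show ?thesis by (simp add: algebra_simps)
  qed
  show "A (y + k) - A y = A (x + k) - A x" "f (x + i) = 0"
    using eq i x xi f_range[of i] f_range[of "x + i"] A_range[of x] A_range[of "x + k"]
      A_range[of y] A_range[of "y + k"] by auto
qed

text \<open>Transport twice: from x into the class of x + i, then with - i in place of i back to any
  z in the class of x.\<close>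

lemma constant_shift:
  assumes k: "k < n" and i: "f i \<noteq> 0" "\<not> h dvd i"
    and x: "0 < x" "x < n - k" "\<not> h dvd x" "A (x + k) \<noteq> A x" "f (x + i) \<noteq> f i"
    and z: "0 < z" "z < n - k" "h dvd z - x"
  shows "A (z + k) - A z = A (x + k) - A x"
proof -
  have fx: "f x = 0" by (rule f_eq_0_if_shift[OF x(3,4)])
  have hxi: "\<not> h dvd x + i" by (rule ndvd_add_if_shift[OF i(1) x(3,4)])
  \<comment> \<open>The least positive representative is below n - k, because h divides the positive
    number n - k.\<close>
  define y where "y = (x + i) mod h"
  have y: "0 < y" "y < h" "h dvd y - (x + i)" "\<not> h dvd y"
  proof -
    have "y \<noteq> 0" "0 \<le> y" using hxi hn(2) by (auto simp: y_def mod_eq_0_iff_dvd)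
    then show "0 < y" by simp
    show "y < h" using hn(2) by (simp add: y_def)
    show "h dvd y - (x + i)" unfolding y_def by (metis dvd_minus_mod dvd_diff_commute)
    show "\<not> h dvd y" using hxi by (simp add: y_def dvd_mod_iff)
  qed
  have "h dvd n - k" using hk hn by auto
  then have "h \<le> n - k" using k by (intro zdvd_imp_le) auto
  then have yk: "y < n - k" using y by simp
  have sy: "A (y + k) - A y = A (x + k) - A x" "f (x + i) = 0"
    using transport[OF i x y(1) yk y(3)] by auto
  have "f (y + - i) = f x"
    using x y(3) by (intro f_cong) (auto simp: algebra_simps)
  then have "f (y + - i) \<noteq> f (- i)" using fx i f_odd[of i] by auto
  moreover have "h dvd z - (y + - i)" using dvd_diff[OF z(3) y(3)] by (simp add: algebra_simps)
  ultimately have "A (z + k) - A z = A (y + k) - A y"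
    using transport(1)[of "- i" y z] i x y yk z sy f_odd[of i] by auto
  then show ?thesis using sy by simp
qed

end

text \<open>As \<open>c < n - h\<close>, every class modulo \<open>h\<close> has a representative strictly between \<open>c\<close> and \<open>n\<close>; so for an
  \<open>h\<close>-periodic function on \<open>\<int>/n\<close> the period \<open>c\<close> can be tested without wrapping around.\<close>

inductive good :: "int \<Rightarrow> bool" where
  base: "good (Gcd (insert n {x. g x \<noteq> 0}))"
| step: "good h \<Longrightarrow> \<not> h dvd c \<Longrightarrow> c < n - h \<Longrightarrow> c \<in> K (gcd h c) \<Longrightarrow> good (gcd h c)"

section \<open>Detection of periods\<close>

lemma good_props: "good h \<Longrightarrow> 0 < h \<and> h dvd n \<and> (\<forall>x. g x \<noteq> 0 \<longrightarrow> h dvd x)"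
proof (induction rule: good.induct)
  case base
  have "Gcd (insert n {x. g x \<noteq> 0}) dvd n" by (rule Gcd_dvd) simp
  then have "Gcd (insert n {x. g x \<noteq> 0}) \<noteq> 0" using n_pos by auto
  moreover have "0 \<le> Gcd (insert n {x. g x \<noteq> 0})" by simp
  moreover have "Gcd (insert n {x. g x \<noteq> 0}) dvd x" if "g x \<noteq> 0" for x
    by (rule Gcd_dvd) (use that in simp)
  ultimately show ?case using \<open>Gcd _ dvd n\<close> by (metis order_less_le)
next
  case (step h c)
  then show ?case by (auto intro: dvd_trans[of "gcd h c" h] simp: gcd_pos_int)
qed

text \<open>A function with values 0 and 1 cannot change twice in a row by the same nonzero
  amount.\<close>

lemma shift_twice:
  assumes "A (z + m) = A z + d" "A (z + m + m) = A (z + m) + d" "d \<noteq> 0"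
  shows False
  using assms A_range[of z] A_range[of "z + m"] A_range[of "z + m + m"] by auto

lemma class_representative:
  fixes h0 z0 :: int
  assumes "0 < h0" "\<not> h0 dvd z0"
  shows "0 < z0 mod h0" "z0 mod h0 < h0" "h0 dvd z0 mod h0 - z0"
proof -
  have "z0 mod h0 \<noteq> 0" "0 \<le> z0 mod h0"
    using assms(2) mod_0_imp_dvd pos_mod_sign[OF assms(1)] by blast+
  then show "0 < z0 mod h0" by simp
  show "z0 mod h0 < h0" using assms by simp
  show "h0 dvd z0 mod h0 - z0" by (metis dvd_minus_mod dvd_diff_commute)
qed

lemma subgroup_periods:
  "subgroup_int {d. h0 dvd d \<and> (\<forall>c. h0 dvd c - z0 \<longrightarrow> A (c + d) = A c)}"
  unfolding subgroup_int_def
proof (intro conjI ballI)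
  fix a b
  assume "a \<in> {d. h0 dvd d \<and> (\<forall>c. h0 dvd c - z0 \<longrightarrow> A (c + d) = A c)}"
    and "b \<in> {d. h0 dvd d \<and> (\<forall>c. h0 dvd c - z0 \<longrightarrow> A (c + d) = A c)}"
  then have a: "h0 dvd a" "\<And>c. h0 dvd c - z0 \<Longrightarrow> A (c + a) = A c"
    and b: "h0 dvd b" "\<And>c. h0 dvd c - z0 \<Longrightarrow> A (c + b) = A c" by auto
  have "A (c + (a - b)) = A c" if c: "h0 dvd c - z0" for c
  proof -
    have cb: "h0 dvd (c - b) - z0" using dvd_diff[OF c b(1)] by (simp add: algebra_simps)
    have "A (c - b + a) = A (c - b)" "A (c - b + b) = A (c - b)" using a(2)[OF cb] b(2)[OF cb] by auto
    then show ?thesis by (simp add: algebra_simps)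
  qed
  then show "a - b \<in> {d. h0 dvd d \<and> (\<forall>c. h0 dvd c - z0 \<longrightarrow> A (c + d) = A c)}"
    using a(1) b(1) by auto
qed simp

text \<open>The case \<open>m = n\<close>, where the constant difference is vacuous, says that the sizes in \<open>K h\<close>
  suffice to detect \<open>h\<close>-periodicity.\<close>

lemma good_detects:
  assumes "good h" and "h0 dvd h" and h0: "0 < h0" "\<not> h0 dvd z0" and m: "h0 dvd m" "0 < m" "m \<le> n"
    and d: "d \<noteq> 0" "\<And>z. 0 < z \<Longrightarrow> z < n - m \<Longrightarrow> h0 dvd z - z0 \<Longrightarrow> A (z + m) = A z + d"
    and K: "\<And>k c. k \<in> K h \<Longrightarrow> k < m \<Longrightarrow> h0 dvd c - z0 \<Longrightarrow> k < c \<Longrightarrow> c < n \<Longrightarrow> A c = A (c - k)"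
    and "h0 dvd c - z0"
  shows "A (c + h) = A c"
  using assms
proof (induction arbitrary: c rule: good.induct)
  case base
  let ?h = "Gcd (insert n {x. g x \<noteq> 0})"
  \<comment> \<open>The group of shifts that preserve A on the residue class of z0. It suffices to
    place n and the support of g in it.\<close>
  define P where "P = {d. h0 dvd d \<and> (\<forall>c. h0 dvd c - z0 \<longrightarrow> A (c + d) = A c)}"
  note K = base(9)
  have hn: "h0 dvd n" using base(1) by (meson Gcd_dvd dvd_trans insertI1)
  have hg: "h0 dvd x" if "g x \<noteq> 0" for x
    using base(1) that by (meson Gcd_dvd dvd_trans insertI2 mem_Collect_eq)
  have g0: "g 0 = 0" using g_odd[of 0] by simp
  have ndvd: "\<not> h0 dvd c" if "h0 dvd c - z0" for c
    using h0 that dvd_diff[of h0 c "c - z0"] by auto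
  define z1 where "z1 = z0 mod h0"
  have z1: "0 < z1" "z1 < h0" "h0 dvd z1 - z0" unfolding z1_def by (rule class_representative[OF h0])+
  have big: "h0 \<le> x" if "h0 dvd x" "0 < x" for x using that by (intro zdvd_imp_le)
  \<comment> \<open>Otherwise d would be added twice. If m \<le> a, it applies at z1 and at z1 + m.
    If a < m, shifts by a are available and bring z1 + m down below a, where d applies again because
    a + m \<le> n.\<close>
  have small: "n - a < m" if a: "0 < a" "2 * a < n" "g a \<noteq> 0" for a
  proof (rule ccontr)
    assume am: "\<not> n - a < m"
    have ha: "h0 dvd a" using hg a by simp
    have nm: "h0 \<le> n - m" using am a hn m by (intro big) auto
    have w: "A (z1 + m) = A z1 + d" using z1 nm by (intro d(2)) auto
    show False
    proof (cases "m \<le> a")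
      case True
      have "h0 \<le> n - (m + m)" using True a hn m by (intro big) auto
      moreover have "h0 dvd z1 + m - z0" using dvd_add[OF z1(3) m(1)] by (simp add: algebra_simps)
      ultimately have "A (z1 + m + m) = A (z1 + m) + d" using z1 m by (intro d(2)) auto
      then show False using shift_twice[OF w] d by simp
    next
      case False
      have aK: "a \<in> K ?h" using a by (intro g_in_K Gcd_dvd) auto
      have down: "A (v + int j * a) = A v" if "0 < v" "h0 dvd v - z0" "v + int j * a < n" for v j
        using that(3)
      proof (induction j)
        case (Suc j)
        let ?v = "v + int (Suc j) * a"
        have eq: "?v - a = v + int j * a" by (simp add: algebra_simps)
        have "h0 dvd (v - z0) + int (Suc j) * a" using that ha by (intro dvd_add) auto
        then have "A ?v = A (?v - a)"
          using aK False that Suc.prems a by (intro K) (auto simp: algebra_simps intro: add_pos_nonneg)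
        moreover have "v + int j * a < n" using Suc.prems a(1) eq by linarith
        ultimately show ?case using Suc.IH eq by metis
      qed simp
      let ?w = "z1 + m" and ?w' = "(z1 + m) mod a"
      have hw: "h0 dvd ?w - z0" using dvd_add[OF z1(3) m(1)] by (simp add: algebra_simps)
      have weq: "?w = ?w' + int (nat (?w div a)) * a"
        using a z1 m by (simp add: pos_imp_zdiv_nonneg_iff)
      have hw': "h0 dvd ?w' - z0"
      proof -
        have "?w' - z0 = (?w - z0) - (?w div a) * a" by (simp add: minus_div_mult_eq_mod[symmetric])
        then show ?thesis using hw ha by (simp only: dvd_diff dvd_mult)
      qed
      then have "\<not> h0 dvd ?w'" by (rule ndvd)
      then have "?w' \<noteq> 0" by auto
      then have w': "0 < ?w'" "?w' < a" using a(1) pos_mod_sign[of a ?w] pos_mod_bound[of a ?w] by linarith+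
      have "A ?w = A ?w'" using down[OF w'(1) hw', of "nat (?w div a)"] weq z1 nm by auto
      moreover have "A (?w' + m) = A ?w' + d" using w' hw' am by (intro d(2)) auto
      ultimately show False
        using w d(1) A_range[of z1] A_range[of ?w] A_range[of "?w' + m"] by auto
    qed
  qed
  \<comment> \<open>Both b and n - b lie in the support of g, and they differ by oddness;
    \<open>small\<close> for the lesser one bounds both by m.\<close>
  have inert: "A c = A (c - b)" if b: "0 < b" "b < n" "g b \<noteq> 0" and c: "h0 dvd c - z0" "b < c" "c < n" for b c
  proof -
    have "g (n - b) \<noteq> 0" using b g_cong_n[of "n - b" "- b"] g_odd[of b] by auto
    moreover have "2 * b \<noteq> n"
    proof
      assume "2 * b = n"
      then have "g b = g (- b)" by (intro g_cong_n) auto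
      then show False using b g_odd[of b] by simp
    qed
    ultimately have "b < m" using small[of b] small[of "n - b"] b by (cases "2 * b < n") auto
    moreover have "b \<in> K ?h" using b by (intro g_in_K Gcd_dvd) auto
    ultimately show ?thesis using K c by blast
  qed
  have "insert n {x. g x \<noteq> 0} \<subseteq> P"
  proof
    fix b assume "b \<in> insert n {x. g x \<noteq> 0}"
    then consider "b = n" | "g b \<noteq> 0" by auto
    then show "b \<in> P"
    proof cases
      case 1
      then show ?thesis using hn A_per by (auto simp: P_def)
    next
      case 2
      define b' where "b' = b mod n"
      have b': "n dvd b - b'" "0 \<le> b'" "b' < n" using n_pos by (auto simp: b'_def)
      then have gb: "g b' \<noteq> 0" using 2 g_cong_n[of b b'] by simp
      then have b0: "0 < b'" using b' g0 by (cases "b' = 0") auto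
      have gnb: "g (n - b') \<noteq> 0" using gb g_cong_n[of "n - b'" "- b'"] g_odd[of b'] by auto
      have "A (c + b) = A c" if c: "h0 dvd c - z0" for c
      proof -
        define c' where "c' = c mod n"
        have c': "n dvd c - c'" "0 \<le> c'" "c' < n" using n_pos by (auto simp: c'_def)
        have hc': "h0 dvd c' - z0"
          using dvd_diff[OF c dvd_trans[OF hn c'(1)]] by (simp add: algebra_simps)
        then have cpos: "0 < c'" using c' ndvd[OF hc'] by (cases "c' = 0") auto
        have hcb: "h0 dvd (c' + b') - z0" using dvd_add[OF hc' hg[OF gb]] by (simp add: algebra_simps)
        have "c' + b' \<noteq> n" using ndvd[OF hcb] hn by auto
        then consider "c' + b' < n" | "c' + b' > n" by linarith
        then have "A (c' + b') = A c'"
        proof cases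
          case 1
          then show ?thesis using inert[OF b0 b'(3) gb hcb] cpos by simp
        next
          case 2
          \<comment> \<open>When c' + b' passes n, the shift up by b' is replaced by the shift down
            by n - b'.\<close>
          have "A c' = A (c' - (n - b'))" using 2 b0 b' c' hc' gnb by (intro inert) auto
          also have "\<dots> = A (c' + b')" by (intro A_cong) simp
          finally show ?thesis by simp
        qed
        moreover have "A (c + b) = A (c' + b')"
          using dvd_add[OF c'(1) b'(1)] by (intro A_cong) (simp add: algebra_simps)
        ultimately show ?thesis using A_cong[OF c'(1)] by simp
      qed
      then show ?thesis using hg[OF 2] by (auto simp: P_def)
    qed
  qed
  then have "?h \<in> P" unfolding P_def by (intro Gcd_in_subgroup_int subgroup_periods)
  then show ?case using base(10) unfolding P_def by blast
next
  case (step h e)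
  let ?h = "gcd h e"
  have h: "0 < h" "h dvd n" using good_props[OF step.hyps(1)] by auto
  have h0h: "h0 dvd h" "h0 dvd e" using step.prems(1) by auto
  have ndvd: "\<not> h0 dvd c" if "h0 dvd c - z0" for c
    using h0 that dvd_diff[of h0 c "c - z0"] by auto
  have per: "A (c + h) = A c" if "h0 dvd c - z0" for c
  proof (rule step.IH)
    show "A c = A (c - k)" if "k \<in> K h" "k < m" "h0 dvd c - z0" "k < c" "c < n" for k c
      using that K_mono[of ?h h] by (intro step.prems(9)) auto
  qed (use step.prems(2-8) h0h that in auto)
  define P where "P = {d. h0 dvd d \<and> (\<forall>c. h0 dvd c - z0 \<longrightarrow> A (c + d) = A c)}"
  have P: "subgroup_int P" unfolding P_def by (rule subgroup_periods)
  have hP: "h \<in> P" using per h0h by (auto simp: P_def)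
  have cong: "A y = A x" if "h0 dvd x - z0" "h dvd y - x" for x y
  proof -
    have "y - x \<in> P" using subgroup_int_mult[OF P hP] that(2) by (metis dvd_def mult.commute)
    then have "A (x + (y - x)) = A x" using that(1) unfolding P_def by blast
    then show ?thesis by simp
  qed
  \<comment> \<open>Otherwise every class modulo h inside the class of z0 has a representative in
    the range of d, so that the difference d would hold throughout, against
    \<open>shift_twice\<close>.\<close>
  have "n - h < m"
  proof (rule ccontr)
    assume nh: "\<not> n - h < m"
    have all: "A (z + m) = A z + d" if z: "h0 dvd z - z0" for z
    proof -
      have "\<not> h dvd z" using ndvd[OF z] h0h by (meson dvd_trans)
      then have z': "0 < z mod h" "z mod h < h" "h dvd z mod h - z"
        using class_representative[of h z] h by auto
      have hz': "h0 dvd z mod h - z0"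
        using dvd_add[OF dvd_trans[OF h0h(1) z'(3)] z] by simp
      have "A (z mod h + m) = A (z mod h) + d" using z' hz' nh by (intro d(2)) auto
      moreover have "A (z mod h) = A z" using z' z by (intro cong)
      moreover have "A (z mod h + m) = A (z + m)"
        using z' dvd_add[OF z m(1)] by (intro cong) (auto simp: algebra_simps)
      ultimately show ?thesis by simp
    qed
    have "A (z0 + m) = A z0 + d" by (rule all) simp
    moreover have "A (z0 + m + m) = A (z0 + m) + d" by (rule all) (use m in simp)
    ultimately show False using shift_twice d(1) by blast
  qed
  then have em: "e < m" using step.hyps(3) by simp
  have e0: "0 < e" using step.hyps(4) K_pos by blast
  have "A (c + e) = A c" if c: "h0 dvd c - z0" for c
  proof -
    have ce: "h0 dvd (c + e) - z0" using dvd_add[OF c h0h(2)] by (simp add: algebra_simps)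
    have "\<not> h dvd c + e" using ndvd[OF ce] h0h by (meson dvd_trans)
    then have z: "0 < (c + e) mod h" "(c + e) mod h < h" "h dvd (c + e) mod h - (c + e)"
      using class_representative[of h "c + e"] h by auto
    \<comment> \<open>The representative of c + e modulo h that lies above n - h, hence above e:
      there the shift by e does not wrap around.\<close>
    define x where "x = (c + e) mod h + (n - h)"
    have hx: "h dvd x - (c + e)" using dvd_add[OF z(3) dvd_diff[OF h(2) dvd_refl]]
      by (simp add: x_def algebra_simps)
    have hx0: "h0 dvd x - z0" using dvd_add[OF dvd_trans[OF h0h(1) hx] ce] by simp
    have "A x = A (x - e)"
      using step.hyps z em hx0 by (intro step.prems(9)[of e]) (auto simp: x_def)
    moreover have "A x = A (c + e)" by (rule cong[OF ce hx])
    moreover have "A (x - e) = A c" using hx by (intro cong[OF c]) (simp add: algebra_simps)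
    ultimately show ?thesis by simp
  qed
  then have "e \<in> P" using h0h by (auto simp: P_def)
  then have "?h \<in> P" using gcd_in_subgroup_int[OF P hP] by blast
  then show ?case using step.prems(10) by (auto simp: P_def)
qed

section \<open>The descent to a common period, with \<open>stage\<close> as its invariant\<close>

definition stage :: "int \<Rightarrow> bool" where
  "stage h \<longleftrightarrow> good h \<and> (\<forall>x. \<not> h dvd x \<longrightarrow> f (x + h) = f x) \<and> (\<exists>y. \<not> h dvd y \<and> f y \<noteq> 0)"

text \<open>Let b be in the support of g and x outside the subgroup with f x nonzero. Then x + b is
  outside as well, so g vanishes there and f wins. Hence b is a period of f outside the subgroup,
  and so is the generator.\<close>

lemma stage_base:
  assumes y: "f y \<noteq> 0" "\<not> Gcd (insert n {x. g x \<noteq> 0}) dvd y"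
  shows "stage (Gcd (insert n {x. g x \<noteq> 0}))" (is "stage ?h")
  unfolding stage_def
proof (intro conjI allI impI)
  show "good ?h" by (rule good.base)
  show "\<exists>y. \<not> ?h dvd y \<and> f y \<noteq> 0" using y by blast
  have h: "?h dvd n" "\<And>x. g x \<noteq> 0 \<Longrightarrow> ?h dvd x" using good_props[OF good.base] by auto
  \<comment> \<open>Cutting f off to 0 on the subgroup turns periodicity outside it into periodicity
    everywhere.\<close>
  define F where "F x = (if ?h dvd x then 0 else f x)" for x
  have step: "f (x + b) = f x" if b: "g b \<noteq> 0" and x: "\<not> ?h dvd x" "f x \<noteq> 0" for b x
  proof -
    have "\<not> ?h dvd x + b" using x(1) dvd_add_left_iff[OF h(2)[OF b]] by blast
    then have "g (x + b) = 0" using h(2) by blast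
    then show ?thesis using winner[OF x(2) b] b by auto
  qed
  have "insert n {x. g x \<noteq> 0} \<subseteq> {d. \<forall>x. F (x + d) = F x}"
  proof
    fix b assume "b \<in> insert n {x. g x \<noteq> 0}"
    then consider "b = n" | "g b \<noteq> 0" by blast
    then show "b \<in> {d. \<forall>x. F (x + d) = F x}"
    proof cases
      case 1
      then show ?thesis using dvd_add_left_iff[OF h(1)] f_per by (simp only: F_def mem_Collect_eq) simp
    next
      case 2
      have "f (x + b) = f x" if x: "\<not> ?h dvd x" for x
      proof (cases "f x = 0")
        case True
        show ?thesis
        proof (rule ccontr)
          assume "f (x + b) \<noteq> f x"
          then have "f (x + b) \<noteq> 0" using True by simp
          moreover have "\<not> ?h dvd x + b" using x dvd_add_left_iff[OF h(2)[OF 2]] by blast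
          moreover have "g (- b) \<noteq> 0" using 2 g_odd[of b] by simp
          ultimately have "f (x + b + - b) = f (x + b)" by (intro step)
          then show False using True \<open>f (x + b) \<noteq> 0\<close> by simp
        qed
      qed (use step 2 x in blast)
      then show ?thesis using dvd_add_left_iff[OF h(2)[OF 2]] by (simp only: F_def mem_Collect_eq) simp
    qed
  qed
  then have "?h \<in> {d. \<forall>x. F (x + d) = F x}" by (intro Gcd_in_subgroup_int subgroup_int_periods)
  then have "F (x + ?h) = F x" for x by blast
  then show "f (x + ?h) = f x" if "\<not> ?h dvd x" for x
    using that dvd_add_left_iff[of ?h ?h x] unfolding F_def by (metis dvd_refl)
qed

text \<open>By \<open>good_detects\<close> some size in \<open>K h\<close> is not inert; let k be
  the least. The points y between 0 and n - k outside the multiples of h where A changes under the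
  shift by k turn out to be periods of the cut-off f. Adjoining a suitable k + y to h yields the
  smaller h'.\<close>

lemma stage_improve:
  assumes st: "stage h" and x: "\<not> h dvd x" "A (x + h) \<noteq> A x"
  shows "\<exists>h'. stage h' \<and> 0 < h' \<and> h' < h"
proof -
  have good: "good h" and fh: "\<And>x. \<not> h dvd x \<Longrightarrow> f (x + h) = f x"
    using st unfolding stage_def by blast+
  obtain y0 where y0: "\<not> h dvd y0" "f y0 \<noteq> 0" using st unfolding stage_def by blast
  have h: "0 < h" "h dvd n" and gh: "\<And>x. g x \<noteq> 0 \<Longrightarrow> h dvd x" using good_props[OF good] by auto
  define bad where "bad k \<longleftrightarrow> k \<in> K h \<and> \<not> inert h k" for k
  have "\<exists>k. bad k"
  proof (rule ccontr)
    assume no: "\<not> (\<exists>k. bad k)"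
    have ndvd: "\<not> h dvd c" if "h dvd c - x" for c using x(1) that dvd_diff[of h c "c - x"] by auto
    have "A (x + h) = A x"
    proof (rule good_detects[OF good, of h x n 1])
      show "A (z + n) = A z + 1" if "0 < z" "z < n - n" for z using that by simp
      show "A c = A (c - k)" if "k \<in> K h" "h dvd c - x" "k < c" "c < n" for k c
        using no ndvd[OF that(2)] that unfolding bad_def inert_def by blast
    qed (use h x n_pos in simp_all)
    then show False using x by simp
  qed
  then obtain k0 where "bad k0" by blast
  define k where "k = int (LEAST m. bad (int m))"
  have "\<exists>m. bad (int m)"
    using \<open>bad k0\<close> K_pos[of k0 h] by (intro exI[of _ "nat k0"]) (auto simp: bad_def)
  then have badk: "bad k" unfolding k_def by (rule LeastI_ex)
  have least: "inert h k'" if "k' \<in> K h" "k' < k" for k'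
  proof (rule ccontr)
    assume "\<not> inert h k'"
    then have "bad (int (nat k'))" using that K_pos[of k' h] by (auto simp: bad_def)
    then have "(LEAST m. bad (int m)) \<le> nat k'" by (rule Least_le)
    then have "k \<le> int (nat k')" unfolding k_def by (rule of_nat_mono)
    then show False using that K_pos[of k' h] by simp
  qed
  obtain M where M: "M \<noteq> {#}" "\<forall>e\<in>#M. 0 < e \<and> h dvd int e" "weight M = k" "u M \<noteq> 0" and k: "k < n"
    using badk unfolding bad_def K_def by blast
  have k0: "0 < k" using badk K_pos[of k h] by (auto simp: bad_def)
  note ctx = gh fh h(2,1) least M
  have hk: "h dvd k" by (rule hk[OF ctx])
  obtain c where c: "\<not> h dvd c" "k < c" "c < n" "A c \<noteq> A (c - k)"
    using badk unfolding bad_def inert_def by blast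
  \<comment> \<open>A constant difference on the class of z would, by \<open>good_detects\<close>
    with m = k, make A h-periodic there; as h divides k, A could not change at z.\<close>
  have notconst: False
    if z: "\<not> h dvd z" "A (z + k) \<noteq> A z" "0 < z" "z < n - k"
      and const: "\<And>y. 0 < y \<Longrightarrow> y < n - k \<Longrightarrow> h dvd y - z \<Longrightarrow> A (y + k) - A y = A (z + k) - A z" for z
  proof -
    have ndvd: "\<not> h dvd c" if "h dvd c - z" for c using z(1) that dvd_diff[of h c "c - z"] by auto
    have per: "A (c + h) = A c" if "h dvd c - z" for c
    proof (rule good_detects[OF good, of h z k "A (z + k) - A z"])
      show "A (y + k) = A y + (A (z + k) - A z)" if "0 < y" "y < n - k" "h dvd y - z" for y
        using const[OF that] by simp
      show "A c = A (c - k')" if "k' \<in> K h" "k' < k" "h dvd c - z" "k' < c" "c < n" for k' c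
        using least[OF that(1,2)] ndvd[OF that(3)] that unfolding inert_def by blast
    qed (use h z hk k0 k that in auto)
    have "A (z + int j * h) = A z" for j
    proof (induction j)
      case (Suc j)
      have "A (z + int j * h + h) = A (z + int j * h)" by (rule per) simp
      then show ?case using Suc by (simp add: algebra_simps)
    qed simp
    from this[of "nat (k div h)"] show False
      using z hk h(1) k0 by (simp add: pos_imp_zdiv_nonneg_iff)
  qed
  \<comment> \<open>Otherwise \<open>constant_shift\<close> would make the difference constant on
    the class of z.\<close>
  have stab: "f (z + i) = f i"
    if z: "\<not> h dvd z" "A (z + k) \<noteq> A z" "0 < z" "z < n - k" and i: "f i \<noteq> 0" "\<not> h dvd i" for z i
    using notconst[OF z] constant_shift[OF ctx k i z(3,4,1,2)] by blast
  define x0 where "x0 = c - k"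
  have x0: "\<not> h dvd x0" "A (x0 + k) \<noteq> A x0" "0 < x0" "x0 < n - k"
    using c hk by (auto simp: x0_def dvd_diff_left_iff)
  have x0': "\<not> h dvd n - k - x0" "A (n - k - x0 + k) \<noteq> A (n - k - x0)" "0 < n - k - x0" "n - k - x0 < n - k"
  proof -
    have "h dvd n - k" using h hk by simp
    then show "\<not> h dvd n - k - x0" using x0(1) dvd_diff_right_iff[of h "n - k" x0] by blast
    show "A (n - k - x0 + k) \<noteq> A (n - k - x0)" using k_reflect[OF ctx x0(1)] x0(2) by simp
  qed (use x0 in auto)
  \<comment> \<open>\<open>good.step\<close> demands k + y < n - h. If x0 is too large its
    reflection n - k - x0 serves, unless k = n - h; but then the class of x0 has one member in the
    range, and the difference is trivially constant. The reflection of y is kept for inverting the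
    shift.\<close>
  obtain y where y: "\<not> h dvd y" "A (y + k) \<noteq> A y" "0 < y" "y < n - k" and yn: "y + k < n - h"
    and opp: "\<not> h dvd n - k - y" "A (n - k - y + k) \<noteq> A (n - k - y)" "0 < n - k - y" "n - k - y < n - k"
  proof (cases "x0 + k < n - h")
    case True
    then show ?thesis using that[of x0] x0 x0' by blast
  next
    case False
    have "k \<noteq> n - h"
    proof
      assume kn: "k = n - h"
      have "y = x0" if y: "0 < y" "y < n - k" "h dvd y - x0" for y
      proof -
        have "\<bar>y - x0\<bar> < h" using y x0 kn by auto
        then show ?thesis using y(3) zdvd_imp_le[of h "\<bar>y - x0\<bar>"] by auto
      qed
      then show False using notconst[OF x0] by blast
    qed
    moreover have "h dvd n - k" using h hk by simp
    then have "h \<le> n - k" using k by (intro zdvd_imp_le) auto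
    ultimately have "h < n - k" by simp
    moreover have dvd: "h dvd n - k - h" using dvd_diff[OF \<open>h dvd n - k\<close> dvd_refl] .
    ultimately have "h \<le> n - k - h" by (intro zdvd_imp_le) auto
    moreover from dvd have "x0 \<noteq> n - k - h" using x0(1) by auto
    ultimately have "n - k - x0 + k < n - h" using False by auto
    moreover have "n - k - (n - k - x0) = x0" by simp
    ultimately show ?thesis using that[of "n - k - x0"] x0 x0' by metis
  qed
  define e where "e = k + y"
  have e: "\<not> h dvd e" "e < n - h" "0 < e" using y hk yn k0 by (auto simp: e_def dvd_add_right_iff)
  \<comment> \<open>Adding the part y to M multiplies the coefficient of u by the nonzero difference
    at y. As h divides k, all parts are divisible by gcd h e.\<close>
  have eK: "e \<in> K (gcd h e)"
  proof -
    have "gcd h e dvd y" using hk by (metis e_def dvd_add_right_iff dvd_trans gcd_dvd1 gcd_dvd2)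
    moreover have "u (M + {#nat y#}) = u M * (A (k + y) - A y)"
      using u_one_more[OF ctx, of "nat y"] y by simp
    then have "u (M + {#nat y#}) \<noteq> 0" using M(4) y(2) by (simp add: add.commute)
    moreover have "weight (M + {#nat y#}) = e" using y M(3) by (simp add: e_def)
    ultimately show ?thesis using e(2) h(1) y(3) M(2) unfolding K_def
      by (intro CollectI conjI exI[of _ "M + {#nat y#}"]) (auto intro: dvd_trans[OF gcd_dvd1])
  qed
  define h' where "h' = gcd h e"
  have good': "good h'" unfolding h'_def by (rule good.step[OF good e(1,2) eK])
  have h': "0 < h'" "h' dvd h" "h' < h"
  proof -
    show pos: "0 < h'" using good_props[OF good'] by blast
    show dvd: "h' dvd h" by (simp add: h'_def)
    have "h' \<noteq> h" using e(1) by (metis gcd_dvd2 h'_def)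
    moreover have "h' \<le> h" using dvd h(1) by (rule zdvd_imp_le)
    ultimately show "h' < h" by simp
  qed
  define F where "F x = (if h dvd x then 0 else f x)" for x
  have Fy: "F (z + w) = F z" if w: "\<not> h dvd w" "A (w + k) \<noteq> A w" "0 < w" "w < n - k" and Fz: "F z \<noteq> 0" for z w
  proof -
    have z: "\<not> h dvd z" "f z \<noteq> 0" using Fz by (auto simp: F_def split: if_splits)
    have fzw: "f (w + z) = f z" by (rule stab[OF w z(2,1)])
    have "\<not> h dvd w + z" by (rule ndvd_add_if_shift[OF ctx z(2) w(1,2)])
    then show ?thesis using fzw z by (simp add: F_def add.commute)
  qed
  have Fh: "F (z + d) = F z" if "h dvd d" for z d
  proof (cases "h dvd z")
    case False
    then have "f (z + d) = f z" using that by (intro f_cong[OF ctx]) auto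
    then show ?thesis using that by (simp add: F_def dvd_add_left_iff)
  qed (use that in \<open>simp add: F_def\<close>)
  have Fe: "F (z + e) = F z" for z
  proof (cases "F z = 0")
    case False
    have "F (z + y + k) = F (z + y)" by (rule Fh[OF hk])
    then show ?thesis using Fy[OF y False] by (simp add: e_def algebra_simps)
  next
    case True
    show ?thesis
    proof (rule ccontr)
      assume "F (z + e) \<noteq> F z"
      then have ne: "F (z + e) \<noteq> 0" using True by simp
      \<comment> \<open>The reflected point undoes the shift by e, since e + (n - k - y) =
        n.\<close>
      have "F (z + e + (n - k - y)) = F (z + e)" by (rule Fy[OF opp ne])
      moreover have "z + e + (n - k - y) = z + n" by (simp add: e_def)
      moreover have "F (z + n) = F z" by (rule Fh[OF h(2)])
      ultimately show False using ne True by simp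
    qed
  qed
  have "h' \<in> {d. \<forall>z. F (z + d) = F z}"
    unfolding h'_def using Fh Fe by (intro gcd_in_subgroup_int subgroup_int_periods) auto
  then have Fh': "F (z + h') = F z" for z by blast
  \<comment> \<open>F is h'-periodic and vanishes at 0; so h' does not swallow the part of the
    support of f outside the multiples of h.\<close>
  have F0: "F z = 0" if "h' dvd z" for z
  proof -
    have *: "F (w + int j * h') = F w" for w j
    proof (induction j)
      case (Suc j)
      then show ?case using Fh'[of "w + int j * h'"] by (simp add: algebra_simps)
    qed simp
    obtain j where j: "z = h' * j" using \<open>h' dvd z\<close> by (auto simp: dvd_def)
    have "F 0 = 0" by (simp add: F_def)
    then show ?thesis using *[of 0 "nat j"] *[of z "nat (- j)"] j
      by (cases "j \<ge> 0") (auto simp: algebra_simps)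
  qed
  have "stage h'"
    unfolding stage_def
  proof (intro conjI allI impI)
    fix z assume z: "\<not> h' dvd z"
    then have "\<not> h dvd z" "\<not> h dvd z + h'" using h'(2) by (metis dvd_trans dvd_add_left_iff dvd_refl)+
    then show "f (z + h') = f z" using Fh'[of z] by (simp add: F_def)
  next
    have "F y0 \<noteq> 0" using y0 by (simp add: F_def)
    then show "\<exists>y. \<not> h' dvd y \<and> f y \<noteq> 0" using F0[of y0] y0 by blast
  qed (rule good')
  then show ?thesis using h' by blast
qed

lemma stage_final:
  assumes "stage h"
  shows "\<exists>h'. stage h' \<and> (\<forall>x. \<not> h' dvd x \<longrightarrow> A (x + h') = A x)"
  using assms
proof (induction "nat h" arbitrary: h rule: less_induct)
  case less
  show ?case
  proof (cases "\<forall>x. \<not> h dvd x \<longrightarrow> A (x + h) = A x")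
    case False
    then obtain h' where "stage h'" "0 < h'" "h' < h" using stage_improve[OF less.prems] by blast
    then show ?thesis using less.hyps[of h'] by auto
  qed (use less.prems in blast)
qed

text \<open>The final h is not n, as it divides b while n does not, and it is not 1, as the support
  of f is not contained in its multiples.\<close>

theorem common_period:
  assumes y: "f y \<noteq> 0" "\<not> Gcd (insert n {x. g x \<noteq> 0}) dvd y" and b: "g b \<noteq> 0"
  shows "\<exists>h. 1 < h \<and> h < n \<and> h dvd n \<and> (\<forall>x. \<not> h dvd x \<longrightarrow> A (x + h) = A x \<and> A x = C x)"
proof -
  obtain h where h: "stage h" "\<forall>x. \<not> h dvd x \<longrightarrow> A (x + h) = A x"
    using stage_final[OF stage_base[OF y]] by blast
  have good: "0 < h" "h dvd n" "\<And>x. g x \<noteq> 0 \<Longrightarrow> h dvd x"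
    using good_props h(1) unfolding stage_def by blast+
  have "\<not> n dvd b" using b g_odd[of 0] g_cong_n[of b 0] by auto
  then have "h \<noteq> n" using good(3)[OF b] by blast
  moreover have "h \<le> n" using good(2) n_pos by (rule zdvd_imp_le)
  moreover have "h \<noteq> 1" using h(1) unfolding stage_def by auto
  moreover have "A x = C x" if "\<not> h dvd x" for x using good(3)[of x] that by (auto simp: g_def)
  ultimately show ?thesis using good(1,2) h(2) by (intro exI[of _ h]) auto
qed

end

section \<open>Chain series\<close>

text \<open>Power series in commuting variables \<open>x\<^sub>1, x\<^sub>2, \<dots>\<close>, truncated to polynomials; the
  monomial of a multiset of parts is the multiset itself.\<close>

type_synonym series = "nat multiset \<Rightarrow>\<^sub>0 int"

abbreviation cf :: "series \<Rightarrow> nat multiset \<Rightarrow> int" where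
  "cf \<equiv> Poly_Mapping.lookup"

lemma lookup_times_mset:
  fixes p q :: series
  shows "cf (p * q) M = (\<Sum>N | N \<subseteq># M. cf p N * cf q (M - N))"
proof -
  have inner: "(\<Sum>r. cf q r when M = N + r) = (cf q (M - N) when N \<subseteq># M)" for N
  proof (cases "N \<subseteq># M")
    case True
    then have "M = N + r \<longleftrightarrow> r = M - N" for r by auto
    then show ?thesis using True by simp
  next
    case False
    then have "M \<noteq> N + r" for r by auto
    then show ?thesis using False by simp
  qed
  have "cf (p * q) M = (\<Sum>N. cf p N * (cf q (M - N) when N \<subseteq># M))"
    by (simp only: lookup_mult inner)
  also have "\<dots> = (\<Sum>N | N \<subseteq># M. cf p N * (cf q (M - N) when N \<subseteq># M))"
    by (rule Sum_any.expand_superset) auto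
  finally show ?thesis by simp
qed

text \<open>The type of exponents is left general: multisets of parts here, exponent vectors of
  colours in the last section.\<close>

definition gen :: "('a \<Rightarrow> 'm::comm_monoid_add) \<Rightarrow> 'a set \<Rightarrow> ('m \<Rightarrow>\<^sub>0 int)" where
  "gen \<mu> X = (\<Sum>a\<in>X. Poly_Mapping.single (\<mu> a) 1)"

lemma lookup_gen: "finite X \<Longrightarrow> Poly_Mapping.lookup (gen \<mu> X) M = int (card {a \<in> X. \<mu> a = M})"
proof -
  assume X: "finite X"
  have "Poly_Mapping.lookup (gen \<mu> X) M = (\<Sum>a\<in>X. if \<mu> a = M then 1 else 0)"
    by (auto simp: gen_def lookup_sum lookup_single when_def intro!: sum.cong)
  also have "\<dots> = (\<Sum>a\<in>{a \<in> X. \<mu> a = M}. 1)"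
    using X by (rule sum.inter_filter[symmetric])
  finally show ?thesis by simp
qed

lemma gen_times:
  "gen \<mu> X * gen \<nu> Y = gen (\<lambda>(a, b). \<mu> a + \<nu> b) (X \<times> Y)"
  by (simp add: gen_def sum_product mult_single sum.cartesian_product case_prod_unfold)

definition epsums :: "nat list \<Rightarrow> nat set" where
  "epsums L = (if L = [] then {} else insert (sum_list L) (psums L))"

definition chain_lists :: "nat set \<Rightarrow> nat list set" where
  "chain_lists S = {L. is_composition L \<and> epsums L \<subseteq> S}"

lemma Nil_in_chains [simp]: "[] \<in> chain_lists S"
  by (simp add: chain_lists_def epsums_def)

lemma snoc_in_chains: "L @ [k] \<in> chain_lists S \<longleftrightarrow> 0 < k \<and> L \<in> chain_lists S \<and> sum_list L + k \<in> S"
  by (cases "L = []") (auto simp: chain_lists_def epsums_def psums_append)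

lemma finite_chains [simp]:
  assumes "finite S"
  shows "finite (chain_lists S)"
proof (rule finite_subset)
  show "chain_lists S \<subseteq> (\<Union>n\<in>insert 0 S. {L. is_composition L \<and> sum_list L = n})"
    by (auto simp: chain_lists_def epsums_def split: if_splits)
  show "finite (\<Union>n\<in>insert 0 S. {L. is_composition L \<and> sum_list L = n})"
    using assms finite_comps by blast
qed

text \<open>The polynomial of S called P in the overview; the empty list contributes the constant
  term 1.\<close>

definition chain_series :: "nat set \<Rightarrow> series" where
  "chain_series S = gen mset (chain_lists S)"

text \<open>The sum of all variables, cut off at n without effect on degrees up to n.\<close>

definition var_series :: "nat \<Rightarrow> series" where
  "var_series n = gen (\<lambda>k. {#k#}) {1..n}"

lemma lookup_chain_series_empty: "finite S \<Longrightarrow> cf (chain_series S) {#} = 1"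
proof -
  assume S: "finite S"
  have "{L \<in> chain_lists S. mset L = {#}} = {[]}" by auto
  then show ?thesis using S by (simp add: chain_series_def lookup_gen del: mset_zero_iff)
qed

lemma lookup_chain_series_zero: "finite S \<Longrightarrow> 0 \<in># M \<Longrightarrow> cf (chain_series S) M = 0"
proof -
  assume S: "finite S" and M: "0 \<in># M"
  have "{L \<in> chain_lists S. mset L = M} = {}"
    using M by (auto simp: chain_lists_def is_composition_def)
  then show ?thesis using S by (simp add: chain_series_def lookup_gen)
qed

text \<open>A variable is removed from M in as many ways as M has distinct parts, whence the two
  cases of \<open>F_pair\<close>.\<close>

lemma lookup_var_series_times:
  fixes p :: series
  assumes "0 \<notin># M" "sum_mset M \<le> n"
  shows "cf (var_series n * p) M = (\<Sum>k\<in>set_mset M. cf p (M - {#k#}))"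
proof -
  have var: "cf (var_series n) N = (if \<exists>k\<in>{1..n}. N = {#k#} then 1 else 0)" for N
  proof -
    have "{a \<in> {1..n}. {#a#} = N} = {k}" if "k \<in> {1..n}" "N = {#k#}" for k using that by auto
    moreover have "{a \<in> {1..n}. {#a#} = N} = {}" if "\<not> (\<exists>k\<in>{1..n}. N = {#k#})" using that by auto
    ultimately show ?thesis by (auto simp: var_series_def lookup_gen)
  qed
  have le: "k \<le> n" if "k \<in># M" for k
  proof -
    have "sum_mset (add_mset k (M - {#k#})) = k + sum_mset (M - {#k#})" by simp
    then have "sum_mset M = k + sum_mset (M - {#k#})" using that by simp
    then show ?thesis using assms by simp
  qed
  have "cf (var_series n * p) M = (\<Sum>N | N \<subseteq># M. cf (var_series n) N * cf p (M - N))"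
    by (rule lookup_times_mset)
  also have "\<dots> = (\<Sum>N\<in>(\<lambda>k. {#k#}) ` set_mset M. cf (var_series n) N * cf p (M - N))"
    by (rule sum.mono_neutral_right) (auto simp: var)
  also have "\<dots> = (\<Sum>k\<in>set_mset M. cf p (M - {#k#}))"
  proof (subst sum.reindex)
    show "inj_on (\<lambda>k. {#k#}) (set_mset M)" by (auto simp: inj_on_def)
    have "cf (var_series n) {#k#} = 1" if "k \<in># M" for k
      using that assms(1) le[OF that] by (auto simp: var Suc_le_eq intro!: gr0I)
    then show "sum ((\<lambda>N. cf (var_series n) N * cf p (M - N)) \<circ> (\<lambda>k. {#k#})) (set_mset M) =
      (\<Sum>k\<in>set_mset M. cf p (M - {#k#}))" by simp
  qed
  finally show ?thesis .
qed

text \<open>Remove the last part of a list: its last partial sum is the size of M, and what remains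
  is an arbitrary list with partial sums in S.\<close>

lemma lookup_chain_series_rec:
  assumes S: "finite S" and M: "M \<noteq> {#}" "sum_mset M \<le> n"
  shows "cf (chain_series S) M =
    of_bool (sum_mset M \<in> S) * cf (var_series n * chain_series S) M"
proof -
  have R: "cf (var_series n * chain_series S) M =
      int (card {(k, L). k \<in> {1..n} \<and> L \<in> chain_lists S \<and> add_mset k (mset L) = M})"
    using S by (simp add: var_series_def chain_series_def gen_times lookup_gen case_prod_unfold
        mem_Times_iff conj_assoc)
  have sum: "sum_list L = sum_mset (mset L)" for L :: "nat list" by (simp add: sum_mset_sum_list)
  show ?thesis
  proof (cases "sum_mset M \<in> S")
    case True
    have "bij_betw (\<lambda>(k, L). L @ [k]) {(k, L). k \<in> {1..n} \<and> L \<in> chain_lists S \<and> add_mset k (mset L) = M}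
      {L \<in> chain_lists S. mset L = M}"
      unfolding bij_betw_def
    proof
      show "inj_on (\<lambda>(k, L). L @ [k]) {(k, L). k \<in> {1..n} \<and> L \<in> chain_lists S \<and> add_mset k (mset L) = M}"
        by (auto simp: inj_on_def)
      show "(\<lambda>(k, L). L @ [k]) ` {(k, L). k \<in> {1..n} \<and> L \<in> chain_lists S \<and> add_mset k (mset L) = M} =
        {L \<in> chain_lists S. mset L = M}" (is "?l = ?r")
      proof
        show "?l \<subseteq> ?r" using True by (auto simp: snoc_in_chains sum add.commute)
        show "?r \<subseteq> ?l"
        proof
          fix L assume L: "L \<in> ?r"
          then have "L \<noteq> []" using M by auto
          then obtain L' k where L': "L = L' @ [k]" by (meson rev_exhaust)
          have "0 < k" "L' \<in> chain_lists S" using L L' by (auto simp: snoc_in_chains)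
          moreover have "k \<le> n" using L L' M(2) by (auto simp: sum)
          ultimately show "L \<in> ?l" using L L' by (intro image_eqI[of _ _ "(k, L')"]) auto
        qed
      qed
    qed
    then show ?thesis using True S R by (simp add: chain_series_def lookup_gen bij_betw_same_card)
  next
    case False
    have "{L \<in> chain_lists S. mset L = M} = {}"
      using M(1) False by (auto simp: chain_lists_def epsums_def sum)
    then have "cf (chain_series S) M = 0" using S by (simp add: chain_series_def lookup_gen del: Collect_empty_eq)
    then show ?thesis using False by simp
  qed
qed

section \<open>Coarsenings cut at a part\<close>

definition coarsenings :: "nat \<Rightarrow> nat set \<Rightarrow> nat list set" where
  "coarsenings n S = {L. is_composition L \<and> L \<noteq> [] \<and> sum_list L = n \<and> psums L \<subseteq> S}"

lemma coarse_eq_coarsenings: "coarse \<alpha> = coarsenings (sum_list \<alpha>) (psums \<alpha>)"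
  by (simp add: coarse_def coarsenings_def)

lemma finite_coarsenings [simp]: "finite (coarsenings n S)"
  by (rule finite_subset[OF _ finite_comps[of n]]) (auto simp: coarsenings_def)

text \<open>The list is cut at k and read from both ends; cuts to the right of k are measured from
  the end.\<close>

lemma psums_join:
  assumes "is_composition L'"
  shows "psums (L @ k # rev L') =
    epsums L \<union> (\<lambda>x. sum_list L + k + sum_list L' - x) ` epsums L'"
proof -
  have *: "psums (k # rev L') = (\<lambda>x. k + sum_list L' - x) ` epsums L'"
  proof (cases "L' = []")
    case False
    have "psums ([k] @ rev L') = insert k ((+) k ` (\<lambda>x. sum_list L' - x) ` psums L')"
      using False assms by (subst psums_append) (auto simp: psums_rev)
    also have "(+) k ` (\<lambda>x. sum_list L' - x) ` psums L' = (\<lambda>x. k + sum_list L' - x) ` psums L'"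
      unfolding image_image using psums_bounds[OF assms] by (intro image_cong) auto
    finally show ?thesis using False by (simp add: epsums_def)
  qed (simp add: epsums_def)
  show ?thesis
  proof (cases "L = []")
    case False
    have "(+) (sum_list L) ` (\<lambda>x. k + sum_list L' - x) ` epsums L' =
        (\<lambda>x. sum_list L + k + sum_list L' - x) ` epsums L'"
      unfolding image_image using psums_bounds[OF assms]
      by (intro image_cong) (auto simp: epsums_def split: if_splits)
    then show ?thesis using False * by (simp add: psums_append epsums_def)
  qed (simp add: * epsums_def)
qed

lemma join_in_coarsenings:
  assumes S: "S \<subseteq> {0<..<n}" and n: "sum_list L + k + sum_list L' = n" and "0 < k"
  shows "L @ k # rev L' \<in> coarsenings n S \<longleftrightarrow>
    L \<in> chain_lists S \<and> L' \<in> chain_lists ((\<lambda>x. n - x) ` S)"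
proof (cases "is_composition L'")
  case True
  have "epsums L' \<subseteq> {..n}"
    using psums_bounds[OF True] n by (auto simp: epsums_def)
  then have "(\<lambda>x. n - x) ` epsums L' \<subseteq> S \<longleftrightarrow> epsums L' \<subseteq> (\<lambda>x. n - x) ` S"
  proof (intro iffI subsetI)
    fix x assume *: "(\<lambda>x. n - x) ` epsums L' \<subseteq> S" "x \<in> epsums L'" "epsums L' \<subseteq> {..n}"
    then have "n - x \<in> S" "x = n - (n - x)" by auto
    then show "x \<in> (\<lambda>x. n - x) ` S" by blast
  next
    fix x assume *: "epsums L' \<subseteq> (\<lambda>x. n - x) ` S" "x \<in> (\<lambda>x. n - x) ` epsums L'"
    then obtain s where "s \<in> S" "x = n - (n - s)" by blast
    then show "x \<in> S" using S by auto
  qed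
  then show ?thesis
    using True n \<open>0 < k\<close> psums_join[OF True, of L k] unfolding coarsenings_def chain_lists_def by auto
qed (auto simp: coarsenings_def chain_lists_def)

lemma card_splits: "finite {(L1, L2). L = L1 @ k # L2} \<and> card {(L1, L2). L = L1 @ k # L2} = count_list L k"
proof (induction L)
  case (Cons a L)
  have "{(L1, L2). a # L = L1 @ k # L2} =
      (if a = k then {([], L)} else {}) \<union> (\<lambda>(L1, L2). (a # L1, L2)) ` {(L1, L2). L = L1 @ k # L2}"
    by (auto simp: Cons_eq_append_conv)
  moreover have "card ((\<lambda>(L1, L2). (a # L1, L2)) ` {(L1, L2). L = L1 @ k # L2}) = count_list L k"
    using Cons by (subst card_image) (auto simp: inj_on_def)
  ultimately show ?case using Cons by (auto simp: card_insert_if)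
qed simp

text \<open>The derivative of the generating polynomial of the coarsenings with respect to \<open>x\<^sub>k\<close>.\<close>

lemma chain_series_product:
  assumes S: "S \<subseteq> {0<..<n}" and M: "sum_mset M < n"
  defines "k \<equiv> n - sum_mset M"
  shows "cf (chain_series S * chain_series ((\<lambda>x. n - x) ` S)) M =
    int (count (add_mset k M) k * card {L \<in> coarsenings n S. mset L = add_mset k M})"
proof -
  let ?S' = "(\<lambda>x. n - x) ` S"
  let ?X = "{L \<in> coarsenings n S. mset L = add_mset k M}"
  let ?P = "{p \<in> chain_lists S \<times> chain_lists ?S'. mset (fst p) + mset (snd p) = M}"
  let ?Q = "{(L1, L2). L1 @ k # L2 \<in> ?X}"
  have fin: "finite S" using S finite_subset by blast
  have k: "0 < k" using M by (simp add: k_def)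
  have sum: "sum_list L = sum_mset (mset L)" for L :: "nat list" by (simp add: sum_mset_sum_list)
  have "cf (chain_series S * chain_series ?S') M = int (card ?P)"
    using fin by (simp add: chain_series_def gen_times lookup_gen case_prod_unfold)
  also have "card ?P = card ?Q"
  proof (rule bij_betw_same_card)
    have iff: "(L1, L2) \<in> ?P \<longleftrightarrow> (L1, rev L2) \<in> ?Q" for L1 L2
    proof (cases "mset L1 + mset L2 = M")
      case True
      then have "sum_list L1 + k + sum_list L2 = n" using M by (auto simp: sum k_def)
      then show ?thesis using join_in_coarsenings[OF S _ k] True by auto
    qed auto
    show "bij_betw (\<lambda>(L1, L2). (L1, rev L2)) ?P ?Q"
      unfolding bij_betw_def
    proof
      show "inj_on (\<lambda>(L1, L2). (L1, rev L2)) ?P" by (auto simp: inj_on_def)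
      show "(\<lambda>(L1, L2). (L1, rev L2)) ` ?P = ?Q"
      proof (intro set_eqI)
        fix q :: "nat list \<times> nat list"
        obtain L1 L2 where q: "q = (L1, L2)" by fastforce
        have "q \<in> (\<lambda>(L1, L2). (L1, rev L2)) ` ?P \<longleftrightarrow> (L1, rev L2) \<in> ?P"
          unfolding q by (force simp: image_iff)
        also have "\<dots> \<longleftrightarrow> q \<in> ?Q" using iff[of L1 "rev L2"] unfolding q by simp
        finally show "q \<in> (\<lambda>(L1, L2). (L1, rev L2)) ` ?P \<longleftrightarrow> q \<in> ?Q" .
      qed
    qed
  qed
  \<comment> \<open>Each coarsening is counted once for every occurrence of k at which it can be
    cut; the degree of M forces k.\<close>
  also have "?Q = (\<Union>L\<in>?X. {(L1, L2). L = L1 @ k # L2})" by auto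
  also have "card \<dots> = (\<Sum>L\<in>?X. card {(L1, L2). L = L1 @ k # L2})"
  proof (rule card_UN_disjoint)
    show "\<forall>L\<in>?X. finite {(L1, L2). L = L1 @ k # L2}" by (intro ballI card_splits[THEN conjunct1])
  qed auto
  also have "\<dots> = (\<Sum>L\<in>?X. count_list L k)"
    by (rule sum.cong[OF refl]) (rule card_splits[THEN conjunct2])
  also have "\<dots> = (\<Sum>L\<in>?X. count (add_mset k M) k)"
    by (rule sum.cong[OF refl]) (metis (mono_tags, lifting) count_mset mem_Collect_eq)
  finally show ?thesis by simp
qed

section \<open>The ratio of two chain series with equal products\<close>

text \<open>Applied to differences, this expresses congruence modulo terms of degree at least
  j.\<close>

definition order_ge :: "nat \<Rightarrow> series \<Rightarrow> bool" where
  "order_ge j p \<longleftrightarrow> (\<forall>M. sum_mset M < j \<longrightarrow> cf p M = 0)"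

lemma order_ge_times:
  assumes "order_ge i p" "order_ge j q"
  shows "order_ge (i + j) (p * q)"
  unfolding order_ge_def
proof (intro allI impI)
  fix M :: "nat multiset" assume M: "sum_mset M < i + j"
  have "cf p N * cf q (M - N) = 0" if "N \<subseteq># M" for N
  proof -
    have "sum_mset M = sum_mset N + sum_mset (M - N)"
      using that by (metis subset_mset.add_diff_inverse sum_mset.union)
    then have "sum_mset N < i \<or> sum_mset (M - N) < j" using M by linarith
    then show ?thesis using assms by (auto simp: order_ge_def)
  qed
  then show "cf (p * q) M = 0" by (auto simp: lookup_times_mset intro: sum.neutral)
qed

lemma order_ge_0: "order_ge 0 p"
  by (simp add: order_ge_def)

lemma order_ge_power: "order_ge 1 p \<Longrightarrow> order_ge j (p ^ j)"
proof (induction j)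
  case (Suc j)
  then show ?case using order_ge_times[of 1 p j "p ^ j"] by simp
qed (simp add: order_ge_0)

lemma order_ge_mult_left: "order_ge j q \<Longrightarrow> order_ge j (p * q)"
  using order_ge_times[OF order_ge_0, of j q p] by simp

lemma order_ge_diffD: "order_ge j (p - q) \<Longrightarrow> sum_mset M < j \<Longrightarrow> cf p M = cf q M"
  by (simp add: order_ge_def lookup_minus)

section \<open>Indicator functions on the integers modulo n\<close>

definition ind :: "nat \<Rightarrow> nat set \<Rightarrow> int \<Rightarrow> int" where
  "ind n S x = of_bool (nat (x mod int n) \<in> S)"

lemma ind_nat: "c < n \<Longrightarrow> ind n S (int c) = of_bool (c \<in> S)"
  by (simp add: ind_def)

lemma ind_minus:
  assumes "S \<subseteq> {0<..<n}" "0 < c" "c < n"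
  shows "ind n S (- int c) = of_bool (c \<in> (\<lambda>x. n - x) ` S)"
proof -
  have "(- int c) mod int n = int (n - c)"
    using assms by (simp add: zmod_zminus1_eq_if of_nat_diff)
  moreover have "n - c \<in> S \<longleftrightarrow> c \<in> (\<lambda>x. n - x) ` S"
  proof
    assume "n - c \<in> S"
    then show "c \<in> (\<lambda>x. n - x) ` S" using assms by (intro image_eqI[of _ _ "n - c"]) auto
  next
    assume "c \<in> (\<lambda>x. n - x) ` S"
    then show "n - c \<in> S" using assms by auto
  qed
  ultimately show ?thesis by (simp add: ind_def)
qed

lemma ind_reflect:
  assumes "R \<subseteq> {0<..<n}" "0 < n"
  shows "ind n R (- x) = ind n ((\<lambda>x. n - x) ` R) x"
proof -
  define c where "c = nat (x mod int n)"
  have c: "c < n" "x mod int n = int c" using assms(2) by (auto simp: c_def nat_less_iff)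
  have eq: "ind n R (- x) = ind n R (- int c)" "ind n Q x = of_bool (c \<in> Q)" for Q
    unfolding ind_def c(2)[symmetric] by (simp_all add: mod_minus_eq c_def)
  show ?thesis
  proof (cases "c = 0")
    case True
    then show ?thesis using assms unfolding eq by (auto simp: ind_def)
  qed (use c assms in \<open>simp add: eq ind_minus\<close>)
qed

lemma ind_period: "ind n S (x + int n) = ind n S x"
  by (simp add: ind_def)

text \<open>The letters a, b, c, d stand for the indicators of S, n - S, T, n - T at two points
  (plain and primed) and their sum (doubly primed). In each of the eight cases the product is 0 or,
  up to sign, the left side of the relation.\<close>

lemma additive_algebra:
  fixes a b c d a' b' c' d' a'' b'' c'' d'' :: int
  assumes "a = c \<and> b = d \<or> a = d \<and> b = c" "a' = c' \<and> b' = d' \<or> a' = d' \<and> b' = c'"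
    "a'' = c'' \<and> b'' = d'' \<or> a'' = d'' \<and> b'' = c''"
    and rel: "a'' * (a + a') + a * b' + a' * b + b'' * (b + b') - (c'' * (c + c') + c * d' + c' * d + d'' * (d + d')) = 0"
  shows "(a'' - d'' - (a - d + (a' - d'))) * (a'' - c'' - (a - c + (a' - c'))) = 0"
proof -
  let ?l = "(a'' - d'' - (a - d + (a' - d'))) * (a'' - c'' - (a - c + (a' - c')))"
  let ?r = "a'' * (a + a') + a * b' + a' * b + b'' * (b + b') - (c'' * (c + c') + c * d' + c' * d + d'' * (d + d'))"
  have "?l = 0 \<or> ?l = ?r \<or> ?l = - ?r"
    using assms(1-3) by (elim disjE conjE) (simp_all add: algebra_simps)
  then show ?thesis using rel by presburger
qed

lemma of_bool_balanced:
  assumes "of_bool p + of_bool q = (of_bool r + of_bool s :: int)"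
  shows "(of_bool p :: int) = of_bool r \<and> (of_bool q :: int) = of_bool s \<or>
    (of_bool p :: int) = of_bool s \<and> (of_bool q :: int) = of_bool r"
  using assms by (cases p; cases q; cases r; cases s) simp_all

locale equal_products =
  fixes n :: nat and S T :: "nat set"
  assumes S: "S \<subseteq> {0<..<n}" and T: "T \<subseteq> {0<..<n}" and n: "0 < n"
    and products: "\<And>M. sum_mset M < n \<Longrightarrow>
      cf (chain_series S * chain_series ((\<lambda>x. n - x) ` S)) M =
      cf (chain_series T * chain_series ((\<lambda>x. n - x) ` T)) M"
begin

abbreviation "S' \<equiv> (\<lambda>x. n - x) ` S"
abbreviation "T' \<equiv> (\<lambda>x. n - x) ` T"

lemma finite_sets [simp]: "finite S" "finite T" "finite S'" "finite T'"
  using S T finite_subset by blast+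

definition F :: "nat set \<Rightarrow> series" where
  "F R = var_series n * chain_series R"

text \<open>The truncated geometric series for the inverse of \<open>chain_series T\<close>; so
  \<open>u\<close> is the ratio up to terms of degree at least n.\<close>

definition v :: series where
  "v = (\<Sum>j<n. (1 - chain_series T) ^ j)"

definition u :: series where
  "u = chain_series S * v"

lemma cf_chain_single: "finite R \<Longrightarrow> 0 < e \<Longrightarrow> e < n \<Longrightarrow> cf (chain_series R) {#e#} = of_bool (e \<in> R)"
  using lookup_chain_series_rec[of R "{#e#}" n] lookup_var_series_times[of "{#e#}" n "chain_series R"]
  by (simp add: lookup_chain_series_empty)

lemma F_single: "finite R \<Longrightarrow> 0 < e \<Longrightarrow> e < n \<Longrightarrow> cf (F R) {#e#} = 1"
  using lookup_var_series_times[of "{#e#}" n "chain_series R"]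
  by (simp add: F_def lookup_chain_series_empty)

lemma F_pair:
  assumes "finite R" "0 < e" "0 < e'" "e + e' < n"
  shows "cf (F R) {#e, e'#} = (if e = e' then of_bool (e \<in> R) else of_bool (e \<in> R) + of_bool (e' \<in> R))"
  using lookup_var_series_times[of "{#e, e'#}" n "chain_series R"] assms
  by (auto simp: F_def cf_chain_single add_mset_commute)

lemma F_empty: "cf (F R) {#} = 0"
  using lookup_var_series_times[of "{#}" n "chain_series R"] by (simp add: F_def)

lemma cf_chain_pair:
  assumes "finite R" "0 < e" "0 < e'" "e + e' < n"
  shows "cf (chain_series R) {#e, e'#} = of_bool (e + e' \<in> R) *
    (if e = e' then of_bool (e \<in> R) else of_bool (e \<in> R) + of_bool (e' \<in> R))"
  using lookup_chain_series_rec[of R "{#e, e'#}" n] F_pair[OF assms] assms by (simp add: F_def)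

lemma order_v: "order_ge n (chain_series T * v - 1)"
proof -
  have "order_ge 1 (1 - chain_series T)"
    unfolding order_ge_def
  proof (intro allI impI)
    fix M :: "nat multiset" assume "sum_mset M < 1"
    \<comment> \<open>Multisets of zeros also have size 0, but no chain has such parts.\<close>
    then have M: "M = {#} \<or> 0 \<in># M" by (cases M) auto
    then show "cf (1 - chain_series T) M = 0"
      by (auto simp: lookup_minus lookup_one lookup_chain_series_empty lookup_chain_series_zero when_def)
  qed
  moreover have "1 - (1 - chain_series T) ^ n = (1 - (1 - chain_series T)) * v"
    unfolding v_def by (rule one_diff_power_eq)
  then have "chain_series T * v - 1 = - 1 * (1 - chain_series T) ^ n" by (simp add: algebra_simps)
  ultimately show ?thesis using order_ge_mult_left[OF order_ge_power] by metis
qed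

lemma order_u_T: "order_ge n (u * chain_series T - chain_series S)"
proof -
  have "u * chain_series T - chain_series S = chain_series S * (chain_series T * v - 1)"
    by (simp add: u_def algebra_simps)
  then show ?thesis using order_ge_mult_left[OF order_v] by metis
qed

lemma order_u_S': "order_ge n (u * chain_series S' - chain_series T')"
proof -
  have "order_ge n (chain_series S * chain_series S' - chain_series T * chain_series T')"
    using products by (simp add: order_ge_def lookup_minus)
  then have "order_ge n (v * (chain_series S * chain_series S' - chain_series T * chain_series T'))"
    by (rule order_ge_mult_left)
  moreover have "order_ge n (chain_series T' * (chain_series T * v - 1))"
    by (rule order_ge_mult_left[OF order_v])
  moreover have "u * chain_series S' - chain_series T' =
    v * (chain_series S * chain_series S' - chain_series T * chain_series T') +
    chain_series T' * (chain_series T * v - 1)" by (simp add: u_def algebra_simps)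
  ultimately show ?thesis by (simp add: order_ge_def lookup_add)
qed

lemma u_empty: "cf u {#} = 1"
  using order_ge_diffD[OF order_u_T, of "{#}"] n
  by (simp add: lookup_times_mset lookup_chain_series_empty)

text \<open>Both \<open>P\<^sub>R\<close> and \<open>u P\<^sub>R = P\<^sub>Q\<close> satisfy the recursion \<open>lookup_chain_series_rec\<close>; the terms for \<open>N = {#}\<close>
  cancel because \<open>R\<close> and \<open>Q\<close> agree at the size of \<open>M\<close>.\<close>

lemma u_expand:
  assumes R: "finite R" "finite Q" and u: "order_ge n (u * chain_series R - chain_series Q)"
    and M: "M \<noteq> {#}" "sum_mset M < n" and same: "sum_mset M \<in> Q \<longleftrightarrow> sum_mset M \<in> R"
  shows "cf u M = (\<Sum>N | N \<subset># M \<and> N \<noteq> {#}. cf u N * cf (F R) (M - N) *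
    (of_bool (sum_mset M \<in> R) - of_bool (sum_mset M - sum_mset N \<in> R)))"
proof -
  let ?c = "sum_mset M"
  let ?I = "{N. N \<subset># M \<and> N \<noteq> {#}}"
  have split: "(\<Sum>N | N \<subseteq># M. h N) = h {#} + h M + (\<Sum>N\<in>?I. h N)" for h :: "nat multiset \<Rightarrow> int"
  proof -
    have eq: "{N. N \<subseteq># M} = insert {#} (insert M ?I)"
      by (auto simp: subset_mset.less_le)
    have "finite ?I" by (rule finite_subset[OF _ finite_submultisets[of M]]) auto
    then show ?thesis unfolding eq using M(1) by (simp add: add.assoc)
  qed
  have "order_ge n (var_series n * (u * chain_series R - chain_series Q))"
    by (rule order_ge_mult_left[OF u])
  then have "order_ge n (u * F R - F Q)" by (simp add: F_def algebra_simps)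
  then have FQ: "cf (F Q) M = cf (u * F R) M" using M by (metis order_ge_diffD)
  have rec: "cf (chain_series R') N = of_bool (sum_mset N \<in> R') * cf (F R') N"
    if "finite R'" "N \<noteq> {#}" "sum_mset N \<le> n" for R' N
    using lookup_chain_series_rec[OF that] by (simp add: F_def)
  have sub: "sum_mset (M - N) = ?c - sum_mset N" "M - N \<noteq> {#}" if "N \<in> ?I" for N
  proof -
    have "M = N + (M - N)" using that by (auto simp: subset_mset.less_le)
    then have "?c = sum_mset N + sum_mset (M - N)" by (metis sum_mset.union)
    then show "sum_mset (M - N) = ?c - sum_mset N" by simp
    show "M - N \<noteq> {#}" using that by (auto simp: subset_mset.less_le Diff_eq_empty_iff_mset)
  qed
  have "cf (u * chain_series R) M = cf (chain_series Q) M"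
    using order_ge_diffD[OF u M(2)] .
  also have "\<dots> = of_bool (?c \<in> R) * cf (u * F R) M"
    using rec[OF R(2) M(1)] M(2) same FQ by simp
  also have "cf (u * F R) M = cf (F R) M + (\<Sum>N\<in>?I. cf u N * cf (F R) (M - N))"
    unfolding lookup_times_mset split by (simp add: u_empty F_empty)
  also have "cf (u * chain_series R) M = of_bool (?c \<in> R) * cf (F R) M + cf u M +
      (\<Sum>N\<in>?I. cf u N * (of_bool (?c - sum_mset N \<in> R) * cf (F R) (M - N)))"
  proof -
    have "(\<Sum>N\<in>?I. cf u N * cf (chain_series R) (M - N)) =
        (\<Sum>N\<in>?I. cf u N * (of_bool (?c - sum_mset N \<in> R) * cf (F R) (M - N)))"
      using M(2) sub rec[OF R(1)] by (intro sum.cong) auto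
    then show ?thesis unfolding lookup_times_mset split
      using rec[OF R(1) M(1)] M(2) R by (simp add: u_empty lookup_chain_series_empty)
  qed
  finally have "cf u M = of_bool (?c \<in> R) * (\<Sum>N\<in>?I. cf u N * cf (F R) (M - N)) -
      (\<Sum>N\<in>?I. cf u N * (of_bool (?c - sum_mset N \<in> R) * cf (F R) (M - N)))"
    by (simp add: algebra_simps)
  also have "\<dots> = (\<Sum>N\<in>?I. cf u N * cf (F R) (M - N) *
      (of_bool (?c \<in> R) - of_bool (?c - sum_mset N \<in> R)))"
    by (simp only: sum_distrib_left sum_subtractf[symmetric] algebra_simps)
  finally show ?thesis .
qed

text \<open>Compare the coefficients of the one-part monomial c in the two products.\<close>

lemma bal:
  assumes "0 < c" "c < n"
  shows "of_bool (c \<in> S) + of_bool (c \<in> S') = (of_bool (c \<in> T) + of_bool (c \<in> T') :: int)"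
  using products[of "{#c#}"] assms
  by (simp add: lookup_times_mset submultisets_single cf_chain_single lookup_chain_series_empty)

lemma balanced: "ind n S x + ind n S (- x) = ind n T x + ind n T (- x)"
proof -
  define c where "c = nat (x mod int n)"
  have c: "c < n" using n by (auto simp: c_def nat_less_iff)
  have "0 \<notin> S" "0 \<notin> T" "0 \<notin> S'" "0 \<notin> T'" using S T by auto
  then show ?thesis
    unfolding ind_reflect[OF S n] ind_reflect[OF T n] unfolding ind_def c_def[symmetric]
    using bal[of c] c by (cases "c = 0") auto
qed

text \<open>Compare the coefficients of the two-part monomial with parts x and y; equal parts have
  fewer submultisets and are treated separately. \<open>additive_algebra\<close> turns the
  comparison into a vanishing product.\<close>

lemma additive:
  assumes "0 < x" "0 < y" "x + y < n"
  defines "f \<equiv> \<lambda>c. of_bool (c \<in> S) - of_bool (c \<in> T') :: int" and "g \<equiv> \<lambda>c. of_bool (c \<in> S) - of_bool (c \<in> T) :: int"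
  shows "f (x + y) = f x + f y \<or> g (x + y) = g x + g y"
proof -
  let ?b = "\<lambda>c R. of_bool (c \<in> R) :: int"
  have rel: "?b (x + y) S * (?b x S + ?b y S) + ?b x S * ?b y S' + ?b y S * ?b x S' +
      ?b (x + y) S' * (?b x S' + ?b y S') =
    ?b (x + y) T * (?b x T + ?b y T) + ?b x T * ?b y T' + ?b y T * ?b x T' +
      ?b (x + y) T' * (?b x T' + ?b y T')"
  proof (cases "x = y")
    case True
    have "{N. N \<subseteq># {#y, y#}} = {{#}, {#y#}, {#y, y#}}" using submultisets_pair[of y y] by simp
    then show ?thesis using True products[of "{#x, y#}"] assms
      by (simp add: lookup_times_mset cf_chain_pair cf_chain_single lookup_chain_series_empty)
  next
    case False
    have "{#x, y#} - {#y#} = {#x#}" by (simp add: add_mset_commute)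
    then show ?thesis using False products[of "{#x, y#}"] assms
      by (simp add: lookup_times_mset submultisets_pair cf_chain_pair cf_chain_single
          lookup_chain_series_empty add_mset_eq_single)
  qed
  have H: "?b c S = ?b c T \<and> ?b c S' = ?b c T' \<or> ?b c S = ?b c T' \<and> ?b c S' = ?b c T"
    if "0 < c" "c < n" for c
    by (rule of_bool_balanced[OF bal[OF that]])
  have "x < n" "y < n" "0 < x + y" using assms(1-3) by auto
  then have "(f (x + y) - (f x + f y)) * (g (x + y) - (g x + g y)) = 0"
    unfolding f_def g_def
    by (intro additive_algebra[OF H[OF assms(1)] H[OF assms(2)] H[OF _ assms(3)]
          iffD2[OF right_minus_eq rel]])
  then show ?thesis by simp
qed

text \<open>The first recursion is \<open>u_expand\<close> for the ratio of the series of S and T,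
  the second for that of T' and S'. Negative arguments of the indicators encode the reflected
  sets.\<close>

lemma ratio: "chain_ratio (int n) (ind n S) (ind n T) (cf u) (cf (F T)) (cf (F S'))"
proof
  show "0 < int n" using n by simp
  show "ind n S (x + int n) = ind n S x" "ind n T (x + int n) = ind n T x" for x
    by (rule ind_period)+
  show "ind n S x \<in> {0, 1}" "ind n T x \<in> {0, 1}" for x by (auto simp: ind_def)
  show "ind n S x + ind n S (- x) = ind n T x + ind n T (- x)" for x by (rule balanced)
  show "cf u {#e#} = ind n S (int e) - ind n T (int e)" if "0 < e" "int e < int n" for e
    using order_ge_diffD[OF order_u_T, of "{#e#}"] that
    by (simp add: lookup_times_mset submultisets_single cf_chain_single lookup_chain_series_empty
        u_empty ind_nat)
  show "cf (F T) {#e#} = 1" "cf (F S') {#e#} = 1" if "0 < e" "int e < int n" for e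
    using that by (auto intro: F_single)
  show "cf (F T) {#e, e'#} = ind n T (int e) + ind n T (int e')"
    if "0 < e" "0 < e'" "e \<noteq> e'" "int e + int e' < int n" for e e'
    using that by (simp add: F_pair ind_nat)
  show "cf (F S') {#e, e'#} = ind n S (- int e) + ind n S (- int e')"
    if "0 < e" "0 < e'" "e \<noteq> e'" "int e + int e' < int n" for e e'
    using that by (simp add: F_pair ind_minus[OF S])
  show "ind n S (x + y) - ind n T (- (x + y)) = ind n S x - ind n T (- x) + (ind n S y - ind n T (- y)) \<or>
    ind n S (x + y) - ind n T (x + y) = ind n S x - ind n T x + (ind n S y - ind n T y)"
    if "0 < x" "0 < y" "x + y < int n" for x y
  proof -
    define a b where "a = nat x" and "b = nat y"
    then have ab: "x = int a" "y = int b" using that by auto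
    have pos: "0 < a" "0 < b" "a + b < n" "0 < a + b" "a < n" "b < n" using that ab by auto
    have sum: "x + y = int (a + b)" using ab by simp
    have "ind n S (x + y) = of_bool (a + b \<in> S)" "ind n T (x + y) = of_bool (a + b \<in> T)"
      "ind n T (- (x + y)) = of_bool (a + b \<in> T')"
      unfolding sum by (rule ind_nat[OF pos(3)] ind_minus[OF T pos(4,3)])+
    moreover have "ind n S x = of_bool (a \<in> S)" "ind n T x = of_bool (a \<in> T)"
      "ind n T (- x) = of_bool (a \<in> T')"
      unfolding ab(1) by (rule ind_nat[OF pos(5)] ind_minus[OF T pos(1,5)])+
    moreover have "ind n S y = of_bool (b \<in> S)" "ind n T y = of_bool (b \<in> T)"
      "ind n T (- y) = of_bool (b \<in> T')"
      unfolding ab(2) by (rule ind_nat[OF pos(6)] ind_minus[OF T pos(2,6)])+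
    ultimately show ?thesis using additive[OF pos(1-3)] by (simp only:)
  qed
  fix M :: "nat multiset"
  assume M: "M \<noteq> {#}" "0 \<notin># M" "weight M < int n"
    and same: "ind n S (weight M) = ind n T (weight M)"
  have c: "0 < sum_mset M" "sum_mset M < n"
    using weight_pos[OF M(1,2)] M(3) by (auto simp: weight_def simp del: of_nat_sum_mset)
  have same': "sum_mset M \<in> S \<longleftrightarrow> sum_mset M \<in> T"
    using same c by (simp add: weight_def ind_nat of_bool_def split: if_splits del: of_nat_sum_mset)
  have N: "sum_mset N < sum_mset M" "weight M - weight N = int (sum_mset M - sum_mset N)"
    if "N \<in> {N. N \<subset># M \<and> N \<noteq> {#}}" for N
    using weight_submset_less[of N M] that M(2) by (auto simp: weight_def simp del: of_nat_sum_mset)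
  show "cf u M = (\<Sum>N | N \<subset># M \<and> N \<noteq> {#}. cf u N * cf (F T) (M - N) *
      (ind n S (weight M) - ind n T (weight M - weight N)))"
    unfolding u_expand[OF finite_sets(2,1) order_u_T M(1) c(2) same']
  proof (rule sum.cong[OF refl])
    fix N assume N': "N \<in> {N. N \<subset># M \<and> N \<noteq> {#}}"
    have "ind n S (weight M) = of_bool (sum_mset M \<in> T)"
      unfolding same unfolding weight_def by (rule ind_nat[OF c(2)])
    moreover have "ind n T (weight M - weight N) = of_bool (sum_mset M - sum_mset N \<in> T)"
      unfolding N(2)[OF N'] using c by (intro ind_nat) simp
    ultimately show "cf u N * cf (F T) (M - N) *
        (of_bool (sum_mset M \<in> T) - of_bool (sum_mset M - sum_mset N \<in> T)) =
      cf u N * cf (F T) (M - N) * (ind n S (weight M) - ind n T (weight M - weight N))" by simp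
  qed
  have same'': "sum_mset M \<in> T' \<longleftrightarrow> sum_mset M \<in> S'"
    using bal[OF c] same' by (simp add: of_bool_def split: if_splits)
  show "cf u M = (\<Sum>N | N \<subset># M \<and> N \<noteq> {#}. cf u N * cf (F S') (M - N) *
      (ind n S (- weight M) - ind n S (weight N - weight M)))"
    unfolding u_expand[OF finite_sets(3,4) order_u_S' M(1) c(2) same'']
  proof (rule sum.cong[OF refl])
    fix N assume N': "N \<in> {N. N \<subset># M \<and> N \<noteq> {#}}"
    have "ind n S (- weight M) = of_bool (sum_mset M \<in> S')"
      unfolding weight_def by (rule ind_minus[OF S c])
    moreover have "weight N - weight M = - int (sum_mset M - sum_mset N)" using N(2)[OF N'] by simp
    then have "ind n S (weight N - weight M) = of_bool (sum_mset M - sum_mset N \<in> S')"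
      using c N(1)[OF N'] by (simp only:) (rule ind_minus[OF S], auto)
    ultimately show "cf u N * cf (F S') (M - N) *
        (of_bool (sum_mset M \<in> S') - of_bool (sum_mset M - sum_mset N \<in> S')) =
      cf u N * cf (F S') (M - N) * (ind n S (- weight M) - ind n S (weight N - weight M))" by simp
  qed
qed

lemma reflect_reflect: "R \<subseteq> {0<..<n} \<Longrightarrow> (\<lambda>x. n - x) ` (\<lambda>x. n - x) ` R = R"
proof -
  assume R: "R \<subseteq> {0<..<n}"
  have "(\<lambda>x. n - (n - x)) ` R = (\<lambda>x. x) ` R" using R by (intro image_cong) auto
  then show ?thesis by (simp add: image_image)
qed

text \<open>Replacing T by its reflection interchanges the roles of f and g.\<close>

lemma swap: "equal_products n S T'"
proof
  show "T' \<subseteq> {0<..<n}" using T by auto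
  show "cf (chain_series S * chain_series S') M =
      cf (chain_series T' * chain_series ((\<lambda>x. n - x) ` T')) M" if "sum_mset M < n" for M
    using products[OF that] reflect_reflect[OF T] by (simp add: mult.commute)
qed (use S n in auto)

definition f :: "int \<Rightarrow> int" where "f x = ind n S x - ind n T (- x)"
definition g :: "int \<Rightarrow> int" where "g x = ind n S x - ind n T x"

lemma eq_if_ind_eq:
  assumes "R \<subseteq> {0<..<n}" "\<And>x. ind n S x = ind n R x"
  shows "S = R"
proof (intro set_eqI)
  fix c
  show "c \<in> S \<longleftrightarrow> c \<in> R"
  proof (cases "c < n")
    case True
    then show ?thesis using assms(2)[of "int c"] by (simp add: ind_nat of_bool_def split: if_splits)
  qed (use S assms(1) in auto)
qed

lemma period_step:
  assumes y: "f y \<noteq> 0" "\<And>x. g x \<noteq> 0 \<Longrightarrow> f (y + x) \<noteq> 0" and b: "g b \<noteq> 0"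
  shows "\<exists>h. 1 < h \<and> h < int n \<and> h dvd int n \<and>
    (\<forall>x. \<not> h dvd x \<longrightarrow> ind n S (x + h) = ind n S x \<and> ind n S x = ind n T x)"
proof -
  interpret r: chain_ratio "int n" "ind n S" "ind n T" "cf u" "cf (F T)" "cf (F S')" by (rule ratio)
  have fg: "f = r.f" "g = r.g" by (auto simp: fun_eq_iff f_def g_def r.f_def r.g_def)
  have "\<not> Gcd (insert (int n) {x. r.g x \<noteq> 0}) dvd y"
    using y unfolding fg by (intro r.top_outside_subgroup)
  then show ?thesis using r.common_period[of y b] y b unfolding fg by blast
qed

end

text \<open>\<open>top_exists\<close> yields a dominating point for f or for g. In the second case
  the argument is run with the reflection of T.\<close>

theorem equal_products_period:
  assumes eq: "equal_products n S T" and ne: "S \<noteq> T" "S \<noteq> (\<lambda>x. n - x) ` T"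
  shows "\<exists>h R. R \<in> {T, (\<lambda>x. n - x) ` T} \<and> 1 < h \<and> h < int n \<and> h dvd int n \<and>
    (\<forall>x. \<not> h dvd x \<longrightarrow> ind n S (x + h) = ind n S x \<and> ind n S x = ind n R x)"
proof -
  interpret e: equal_products n S T by (rule eq)
  interpret e': equal_products n S e.T' by (rule e.swap)
  have fg: "e'.f = e.g" "e'.g = e.f"
    using e.reflect_reflect[OF e.T]
    by (auto simp: fun_eq_iff e.f_def e.g_def e'.f_def e'.g_def ind_reflect[OF e.T e.n] ind_reflect[OF e'.T e.n])
  have "\<exists>y. e.g y \<noteq> 0"
    using e.eq_if_ind_eq[OF e.T] ne(1) by (auto simp: e.g_def)
  then obtain b where b: "e.g b \<noteq> 0" by blast
  have "\<exists>y. e.f y \<noteq> 0"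
    using e.eq_if_ind_eq[OF e'.T] ne(2) by (auto simp: e.f_def ind_reflect[OF e.T e.n])
  then obtain b' where b': "e.f b' \<noteq> 0" by blast
  interpret r: chain_ratio "int n" "ind n S" "ind n T" "cf e.u" "cf (e.F T)" "cf (e.F e.S')"
    by (rule e.ratio)
  have rfg: "e.f = r.f" "e.g = r.g" by (auto simp: fun_eq_iff e.f_def e.g_def r.f_def r.g_def)
  from r.top_exists b' consider
      y where "e.f y \<noteq> 0" "\<And>x. e.g x \<noteq> 0 \<Longrightarrow> e.f (y + x) \<noteq> 0"
    | x where "e.g x \<noteq> 0" "\<And>y. e.f y \<noteq> 0 \<Longrightarrow> e.g (x + y) \<noteq> 0"
    unfolding rfg by blast
  then show ?thesis
  proof cases
    case 1
    from e.period_step[OF 1 b] show ?thesis by blast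
  next
    case 2
    from e'.period_step[of x b'] 2 b' show ?thesis unfolding fg by blast
  qed
qed

section \<open>Equal coarsening types\<close>

text \<open>At the variables themselves the coefficients are the multiplicities of the types; so the
  values of the polynomial determine the types.\<close>

lemma coarse_poly_generic:
  "cf (coarse_poly (\<lambda>k. Poly_Mapping.single {#k#} 1) \<alpha>) N = int (count (coarse_types \<alpha>) N)"
proof -
  have "prod_list (map (\<lambda>k. Poly_Mapping.single {#k#} (1::int)) L) = Poly_Mapping.single (mset L) 1" for L :: "nat list"
    by (induction L) (simp_all add: mult_single)
  then have "coarse_poly (\<lambda>k. Poly_Mapping.single {#k#} 1) \<alpha> = gen mset (coarse \<alpha>)"
    by (simp add: coarse_poly_def gen_def)
  then show ?thesis by (simp add: lookup_gen count_coarse_types)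
qed

lemma coarse_types_eqI:
  assumes "\<And>x :: nat \<Rightarrow> series. coarse_poly x \<alpha> = coarse_poly x \<beta>"
  shows "coarse_types \<alpha> = coarse_types \<beta>"
  by (rule multiset_eqI) (metis assms coarse_poly_generic of_nat_eq_iff)

text \<open>By \<open>coarse_poly_comp_circ\<close>, a product involves all near powers of its
  second factor; so equality of types is demanded for them all. The index 0 gives the composition
  itself again (\<open>near_pow_0\<close>).\<close>

definition strong_equiv :: "nat list \<Rightarrow> nat list \<Rightarrow> bool" where
  "strong_equiv \<alpha> \<beta> \<longleftrightarrow> is_composition \<alpha> \<and> \<alpha> \<noteq> [] \<and> is_composition \<beta> \<and> \<beta> \<noteq> [] \<and>
    (\<forall>i. coarse_types (near_pow \<alpha> i) = coarse_types (near_pow \<beta> i))"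

lemma near_pow_0: "near_pow \<alpha> 0 = \<alpha>"
  by (simp add: near_pow_def)

lemma strong_equiv_refl: "is_composition \<alpha> \<Longrightarrow> \<alpha> \<noteq> [] \<Longrightarrow> strong_equiv \<alpha> \<alpha>"
  by (simp add: strong_equiv_def)

lemma strong_equiv_rev:
  assumes "is_composition \<alpha>" "\<alpha> \<noteq> []"
  shows "strong_equiv \<alpha> (rev \<alpha>)"
proof -
  have "coarse_types (near_pow (rev \<alpha>) i) = coarse_types (near_pow \<alpha> i)" for i
  proof (cases "i = 0")
    case False
    then show ?thesis using assms by (simp add: coarse_types_rev near_pow_comp flip: rev_near_pow)
  qed (use assms in \<open>simp add: near_pow_0 coarse_types_rev\<close>)
  then show ?thesis using assms by (simp add: strong_equiv_def)
qed

text \<open>A near power of a product is a near power of the first factor composed with the second,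
  so substitution reduces the claim to both assumptions.\<close>

lemma strong_equiv_comp_circ:
  assumes "strong_equiv \<alpha> \<alpha>'" "strong_equiv \<beta> \<beta>'"
  shows "strong_equiv (comp_circ \<alpha> \<beta>) (comp_circ \<alpha>' \<beta>')"
proof -
  have c: "is_composition \<alpha>" "\<alpha> \<noteq> []" "is_composition \<alpha>'" "\<alpha>' \<noteq> []"
    "is_composition \<beta>" "\<beta> \<noteq> []" "is_composition \<beta>'" "\<beta>' \<noteq> []"
    using assms by (auto simp: strong_equiv_def)
  have pos: "coarse_types (near_pow (comp_circ \<alpha> \<beta>) i) = coarse_types (near_pow (comp_circ \<alpha>' \<beta>') i)"
    if i: "0 < i" for i
  proof (rule coarse_types_eqI)
    fix x :: "nat \<Rightarrow> series"
    have "coarse_poly x (near_pow (comp_circ \<alpha> \<beta>) i) =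
        coarse_poly (\<lambda>k. coarse_poly x (near_pow \<beta> k)) (near_pow \<alpha> i)"
      using c i near_pow_comp[OF i] by (simp add: coarse_poly_comp_circ flip: comp_circ_near_pow)
    also have "\<dots> = coarse_poly (\<lambda>k. coarse_poly x (near_pow \<beta>' k)) (near_pow \<alpha>' i)"
    proof -
      have "coarse_poly x (near_pow \<beta> k) = coarse_poly x (near_pow \<beta>' k)" for k
        using assms(2) by (intro coarse_poly_cong) (auto simp: strong_equiv_def)
      then show ?thesis using assms(1) by (auto simp: strong_equiv_def intro: coarse_poly_cong)
    qed
    also have "\<dots> = coarse_poly x (near_pow (comp_circ \<alpha>' \<beta>') i)"
      using c i near_pow_comp[OF i] by (simp add: coarse_poly_comp_circ flip: comp_circ_near_pow)
    finally show "coarse_poly x (near_pow (comp_circ \<alpha> \<beta>) i) = \<dots>" .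
  qed
  have "coarse_types (near_pow (comp_circ \<alpha> \<beta>) i) = coarse_types (near_pow (comp_circ \<alpha>' \<beta>') i)" for i
    using pos[of 1] pos[of i] by (cases "i = 0") (auto simp: near_pow_0)
  then show ?thesis using c by (simp add: strong_equiv_def comp_circ_comp)
qed

lemma coarse_types_eq_if_comp_equiv:
  assumes "comp_equiv \<alpha> \<beta>"
  shows "coarse_types \<alpha> = coarse_types \<beta>"
proof -
  obtain as bs where as: "as \<noteq> []" "length bs = length as" "\<forall>a\<in>set as. is_composition a \<and> a \<noteq> []"
    and eq: "\<alpha> = comp_circ_list as" "\<beta> = comp_circ_list bs"
    and rev: "\<forall>i<length as. bs ! i = as ! i \<or> bs ! i = rev (as ! i)"
    using assms unfolding comp_equiv_def by blast
  have all: "list_all2 strong_equiv as bs"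
    unfolding list_all2_conv_all_nth using as rev strong_equiv_refl strong_equiv_rev by (metis nth_mem)
  have fold: "strong_equiv (foldl comp_circ a xs) (foldl comp_circ b ys)"
    if "list_all2 strong_equiv xs ys" "strong_equiv a b" for a b xs ys
    using that by (induction arbitrary: a b rule: list_all2_induct) (auto intro: strong_equiv_comp_circ)
  obtain a xs where a: "as = a # xs" using as(1) by (cases as) auto
  then obtain b ys where b: "bs = b # ys" using as(2) by (cases bs) auto
  have "strong_equiv \<alpha> \<beta>" using all fold[of xs ys a b] by (simp add: eq comp_circ_list_def a b)
  then show ?thesis using near_pow_0 by (metis strong_equiv_def)
qed

section \<open>Recognising a composition product\<close>

lemma psums_near_concat:
  assumes "\<alpha> \<noteq> []" "\<beta> \<noteq> []"
  shows "psums (near_concat \<alpha> \<beta>) = psums \<alpha> \<union> (+) (sum_list \<alpha>) ` psums \<beta>"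
proof -
  obtain \<alpha>' a where a: "\<alpha> = \<alpha>' @ [a]" using assms by (meson rev_exhaust)
  obtain b \<beta>' where b: "\<beta> = b # \<beta>'" using assms by (cases \<beta>) auto
  have 1: "psums (c # \<beta>') = (if \<beta>' = [] then {} else insert c ((+) c ` psums \<beta>'))" for c
    by (cases \<beta>') auto
  have 2: "psums (\<alpha>' @ l) = (if \<alpha>' = [] then psums l else psums \<alpha>' \<union> insert (sum_list \<alpha>') ((+) (sum_list \<alpha>') ` psums l))"
    if "l \<noteq> []" for l
    using that by (simp add: psums_append)
  have "near_concat \<alpha> \<beta> = \<alpha>' @ ((a + b) # \<beta>')" by (simp add: near_concat_def a b)
  then show ?thesis unfolding a b
    by (auto simp: 1 2 image_image image_Un add.assoc)
qed

lemma psums_near_pow: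
  assumes "0 < i" "\<delta> \<noteq> []"
  shows "psums (near_pow \<delta> i) = (\<Union>j<i. (\<lambda>y. j * sum_list \<delta> + y) ` psums \<delta>)"
  using assms
proof (induction i rule: nat_induct_non_zero)
  case (Suc i)
  have "psums (near_pow \<delta> (i + 1)) = psums (near_concat (near_pow \<delta> i) (near_pow \<delta> 1))"
    using Suc by (subst near_pow_add) auto
  then show ?case using Suc
    by (simp add: psums_near_concat sum_list_near_pow lessThan_Suc Un_commute)
qed (simp add: lessThan_Suc)

text \<open>The cuts at multiples of the size of \<delta> come from \<alpha>; between them every
  interval carries a copy of the cuts of \<delta>.\<close>

lemma psums_comp_circ:
  assumes "is_composition \<alpha>" "\<delta> \<noteq> []"
  shows "psums (comp_circ \<alpha> \<delta>) =
    (*) (sum_list \<delta>) ` psums \<alpha> \<union> (\<Union>j<sum_list \<alpha>. (\<lambda>y. j * sum_list \<delta> + y) ` psums \<delta>)"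
  using assms
proof (induction \<alpha> rule: psums.induct)
  case (3 a b l)
  let ?m = "sum_list \<delta>"
  have ab: "0 < a" using 3 by simp
  have "psums (comp_circ (a # b # l) \<delta>) = psums (near_pow \<delta> a @ comp_circ (b # l) \<delta>)" by simp
  also have "\<dots> = psums (near_pow \<delta> a) \<union>
      insert (a * ?m) ((+) (a * ?m) ` psums (comp_circ (b # l) \<delta>))"
    using 3 ab by (subst psums_append) (auto simp: sum_list_near_pow)
  also have "psums (comp_circ (b # l) \<delta>) =
      (*) ?m ` psums (b # l) \<union> (\<Union>j<sum_list (b # l). (\<lambda>y. j * ?m + y) ` psums \<delta>)"
    using 3 by simp
  also have "(+) (a * ?m) ` ((*) ?m ` psums (b # l) \<union> (\<Union>j<sum_list (b # l). (\<lambda>y. j * ?m + y) ` psums \<delta>)) =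
      (*) ?m ` (+) a ` psums (b # l) \<union> (\<Union>j\<in>(+) a ` {..<sum_list (b # l)}. (\<lambda>y. j * ?m + y) ` psums \<delta>)"
    by (simp add: image_Un image_UN image_image algebra_simps)
  also have "psums (near_pow \<delta> a) = (\<Union>j<a. (\<lambda>y. j * ?m + y) ` psums \<delta>)"
    using 3 ab by (simp add: psums_near_pow)
  also have "(\<Union>j<a. (\<lambda>y. j * ?m + y) ` psums \<delta>) \<union> insert (a * ?m) ((*) ?m ` (+) a ` psums (b # l) \<union>
      (\<Union>j\<in>(+) a ` {..<sum_list (b # l)}. (\<lambda>y. j * ?m + y) ` psums \<delta>)) =
    (*) ?m ` psums (a # b # l) \<union>
      (\<Union>j\<in>{..<a} \<union> (+) a ` {..<sum_list (b # l)}. (\<lambda>y. j * ?m + y) ` psums \<delta>)"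
    by (auto simp: mult.commute)
  also have "{..<a} \<union> (+) a ` {..<sum_list (b # l)} = {..<sum_list (a # b # l)}"
  proof (intro set_eqI)
    fix j
    have "j \<in> (+) a ` {..<sum_list (b # l)} \<longleftrightarrow> a \<le> j \<and> j < a + sum_list (b # l)"
      by (auto intro!: image_eqI[of _ _ "j - a"])
    then show "j \<in> {..<a} \<union> (+) a ` {..<sum_list (b # l)} \<longleftrightarrow> j \<in> {..<sum_list (a # b # l)}"
      by auto
  qed
  finally show ?case .
qed (auto simp: psums_near_pow)

text \<open>The outer factor \<gamma> has as cuts those of \<alpha> at multiples of m, divided by m;
  \<open>psums_comp_circ\<close> then gives back all cuts of \<alpha>.\<close>

lemma comp_circ_recognise:
  assumes \<alpha>: "is_composition \<alpha>" "\<alpha> \<noteq> []" "sum_list \<alpha> = q * m"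
    and per: "\<And>x. \<not> m dvd x \<Longrightarrow> x < q * m \<Longrightarrow> x \<in> psums \<alpha> \<longleftrightarrow> x mod m \<in> psums \<delta>"
    and \<delta>: "is_composition \<delta>" "\<delta> \<noteq> []" "sum_list \<delta> = m"
  obtains \<gamma> where "is_composition \<gamma>" "\<gamma> \<noteq> []" "sum_list \<gamma> = q" "\<alpha> = comp_circ \<gamma> \<delta>"
proof -
  have pos: "0 < q" "0 < m" using sum_list_pos[OF \<alpha>(1,2)] \<alpha>(3) by (auto intro!: gr0I)
  have b\<alpha>: "psums \<alpha> \<subseteq> {0<..<q * m}" using psums_bounds[OF \<alpha>(1)] \<alpha>(3) by simp
  have b\<delta>: "psums \<delta> \<subseteq> {0<..<m}" using psums_bounds[OF \<delta>(1)] \<delta>(3) by simp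
  have sub: "{x. 0 < x \<and> x < q \<and> m * x \<in> psums \<alpha>} \<subseteq> {0<..<q}" by auto
  obtain \<gamma> where \<gamma>: "is_composition \<gamma>" "\<gamma> \<noteq> []" "sum_list \<gamma> = q" "psums \<gamma> = {x. 0 < x \<and> x < q \<and> m * x \<in> psums \<alpha>}"
    using psums_surj[OF finite_subset[OF sub] sub pos(1)] by auto
  have "psums (comp_circ \<gamma> \<delta>) = psums \<alpha>"
  proof (intro set_eqI)
    fix x
    have 1: "x \<in> (*) m ` psums \<gamma> \<longleftrightarrow> m dvd x \<and> x \<in> psums \<alpha>"
    proof
      assume "x \<in> (*) m ` psums \<gamma>"
      then show "m dvd x \<and> x \<in> psums \<alpha>" using \<gamma>(4) by force
    next
      assume "m dvd x \<and> x \<in> psums \<alpha>"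
      then obtain y where y: "x = m * y" "m * y \<in> psums \<alpha>" by (auto simp: dvd_def)
      then have "0 < y" "y < q" using b\<alpha> by (auto simp: mult.commute)
      then show "x \<in> (*) m ` psums \<gamma>" using y unfolding \<gamma>(4) by blast
    qed
    have 2: "x \<in> (\<Union>j<q. (\<lambda>y. j * m + y) ` psums \<delta>) \<longleftrightarrow> \<not> m dvd x \<and> x \<in> psums \<alpha>"
    proof
      assume "x \<in> (\<Union>j<q. (\<lambda>y. j * m + y) ` psums \<delta>)"
      then obtain j y where jy: "j < q" "y \<in> psums \<delta>" "x = j * m + y" by auto
      have y: "0 < y" "y < m" using jy b\<delta> by auto
      have "x < Suc j * m" using jy y by simp
      also have "\<dots> \<le> q * m" using jy by (intro mult_right_mono) auto
      finally have "x < q * m" .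
      moreover have "x mod m = y" using jy y by simp
      moreover have "\<not> m dvd x" using calculation y by (metis dvd_imp_mod_0 less_irrefl)
      ultimately show "\<not> m dvd x \<and> x \<in> psums \<alpha>" using per[of x] jy by auto
    next
      assume x: "\<not> m dvd x \<and> x \<in> psums \<alpha>"
      then have xn: "x < q * m" using b\<alpha> by auto
      then have "x mod m \<in> psums \<delta>" using per x by auto
      moreover have "x div m < q" using xn pos by (simp add: less_mult_imp_div_less)
      moreover have "x = x div m * m + x mod m" by simp
      ultimately show "x \<in> (\<Union>j<q. (\<lambda>y. j * m + y) ` psums \<delta>)" by blast
    qed
    show "x \<in> psums (comp_circ \<gamma> \<delta>) \<longleftrightarrow> x \<in> psums \<alpha>"
      using 1 2 by (auto simp: psums_comp_circ[OF \<gamma>(1) \<delta>(2)] \<gamma>(3) \<delta>(3))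
  qed
  then have "\<alpha> = comp_circ \<gamma> \<delta>"
    using \<alpha> \<gamma> \<delta> by (intro psums_inj) (auto simp: comp_circ_comp sum_list_comp_circ)
  then show ?thesis using that \<gamma> by blast
qed

lemma psums_map_mult: "psums (map ((*) m) L) = (*) m ` psums L"
  by (induction L rule: psums.induct) (auto simp: image_image distrib_left)

text \<open>A coarsening with all parts divisible by the size of \<delta> uses only cuts at its
  multiples, and these stem from \<gamma>.\<close>

lemma coarse_types_comp_circ_cancel:
  assumes \<gamma>: "is_composition \<gamma>" "\<gamma> \<noteq> []" and \<delta>: "is_composition \<delta>" "\<delta> \<noteq> []"
  shows "count (coarse_types \<gamma>) N = count (coarse_types (comp_circ \<gamma> \<delta>)) (image_mset ((*) (sum_list \<delta>)) N)"
proof -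
  define m where "m = sum_list \<delta>"
  have m: "0 < m" unfolding m_def using \<delta> by (rule sum_list_pos)
  have sum: "sum_list (comp_circ \<gamma> \<delta>) = sum_list \<gamma> * m"
    unfolding m_def by (rule sum_list_comp_circ[OF \<gamma>(1) \<delta>(2)])
  have b\<delta>: "psums \<delta> \<subseteq> {0<..<m}" using psums_bounds[OF \<delta>(1)] by (simp add: m_def)
  have inj: "inj ((*) m)" by (rule injI) (metis m mult_cancel1 less_not_refl)
  have iff: "map ((*) m) L \<in> coarse (comp_circ \<gamma> \<delta>) \<longleftrightarrow> L \<in> coarse \<gamma>" for L
  proof -
    have "(*) m ` psums L \<subseteq> psums (comp_circ \<gamma> \<delta>) \<longleftrightarrow> psums L \<subseteq> psums \<gamma>"
    proof -
      have "m * x \<notin> (\<Union>j<sum_list \<gamma>. (\<lambda>y. j * m + y) ` psums \<delta>)" for x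
      proof
        assume "m * x \<in> (\<Union>j<sum_list \<gamma>. (\<lambda>y. j * m + y) ` psums \<delta>)"
        then obtain j y where jy: "y \<in> psums \<delta>" "m * x = j * m + y" by auto
        then have "y mod m = 0" by (metis mod_mult_self1_is_0 mod_mult_self3)
        moreover have "0 < y" "y < m" using jy(1) b\<delta> by auto
        ultimately show False by simp
      qed
      then have "m * x \<in> psums (comp_circ \<gamma> \<delta>) \<longleftrightarrow> x \<in> psums \<gamma>" for x
        using m by (auto simp: psums_comp_circ[OF \<gamma>(1) \<delta>(2), folded m_def])
      then show ?thesis by auto
    qed
    moreover have "is_composition (map ((*) m) L) \<longleftrightarrow> is_composition L"
      using m by (auto simp: is_composition_def)
    moreover have "sum_list (map ((*) m) L) = m * sum_list L"
      by (simp add: sum_list_const_mult)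
    ultimately show ?thesis using \<gamma> \<delta> m
      by (auto simp: coarse_def psums_map_mult sum mult.commute)
  qed
  have "bij_betw (map ((*) m)) {L \<in> coarse \<gamma>. mset L = N}
    {L \<in> coarse (comp_circ \<gamma> \<delta>). mset L = image_mset ((*) m) N}"
    unfolding bij_betw_def
  proof
    show "inj_on (map ((*) m)) {L \<in> coarse \<gamma>. mset L = N}"
      using inj by (meson inj_mapI inj_on_subset subset_UNIV)
    show "map ((*) m) ` {L \<in> coarse \<gamma>. mset L = N} =
      {L \<in> coarse (comp_circ \<gamma> \<delta>). mset L = image_mset ((*) m) N}" (is "?l = ?r")
    proof
      show "?l \<subseteq> ?r" by (auto simp: iff)
      show "?r \<subseteq> ?l"
      proof
        fix L assume L: "L \<in> ?r"
        then have "set L = (*) m ` set_mset N" by (metis (mono_tags, lifting) mem_Collect_eq set_image_mset set_mset_mset)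
        then have div: "map ((*) m) (map (\<lambda>x. x div m) L) = L"
          by (auto intro!: map_idI)
        have "mset (map (\<lambda>x. x div m) L) = image_mset (\<lambda>x. x div m) (image_mset ((*) m) N)"
          using L by simp
        also have "\<dots> = N" using m by (simp add: multiset.map_comp comp_def)
        finally show "L \<in> ?l" using L div iff[of "map (\<lambda>x. x div m) L"]
          by (intro image_eqI[of _ _ "map (\<lambda>x. x div m) L"]) auto
      qed
    qed
  qed
  then show ?thesis by (simp add: count_coarse_types bij_betw_same_card m_def)
qed

section \<open>Closure properties of the equivalence\<close>

lemma comp_equiv_refl: "is_composition \<alpha> \<Longrightarrow> \<alpha> \<noteq> [] \<Longrightarrow> comp_equiv \<alpha> \<alpha>"
  unfolding comp_equiv_def
  by (intro exI[of _ "[\<alpha>]"] exI[of _ "[\<alpha>]"]) (auto simp: comp_circ_list_def)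

lemma comp_circ_list_snoc: "as \<noteq> [] \<Longrightarrow> comp_circ_list (as @ [a]) = comp_circ (comp_circ_list as) a"
  by (cases as) (auto simp: comp_circ_list_def)

lemma comp_equiv_comp_circ:
  assumes "comp_equiv \<gamma> \<gamma>'" "is_composition \<delta>" "\<delta> \<noteq> []"
  shows "comp_equiv (comp_circ \<gamma> \<delta>) (comp_circ \<gamma>' \<delta>)"
proof -
  obtain as bs where as: "as \<noteq> []" "length bs = length as" "\<forall>a\<in>set as. is_composition a \<and> a \<noteq> []"
    "\<forall>b\<in>set bs. is_composition b \<and> b \<noteq> []" "\<gamma> = comp_circ_list as" "\<gamma>' = comp_circ_list bs"
    "\<forall>i<length as. bs ! i = as ! i \<or> bs ! i = rev (as ! i)"
    using assms(1) unfolding comp_equiv_def by blast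
  then have "bs \<noteq> []" by auto
  then show ?thesis unfolding comp_equiv_def
    using as assms by (intro exI[of _ "as @ [\<delta>]"] exI[of _ "bs @ [\<delta>]"])
      (auto simp: comp_circ_list_snoc nth_append)
qed

lemma comp_equiv_rev:
  assumes "comp_equiv \<alpha> \<beta>"
  shows "comp_equiv \<alpha> (rev \<beta>)"
proof -
  obtain as bs where as: "as \<noteq> []" "length bs = length as" "\<forall>a\<in>set as. is_composition a \<and> a \<noteq> []"
    and bs: "\<forall>b\<in>set bs. is_composition b \<and> b \<noteq> []" and eq: "\<alpha> = comp_circ_list as" "\<beta> = comp_circ_list bs"
    and rev: "\<forall>i<length as. bs ! i = as ! i \<or> bs ! i = rev (as ! i)"
    using assms(1) unfolding comp_equiv_def by blast
  have *: "rev (comp_circ_list xs) = comp_circ_list (map rev xs) \<and> is_composition (comp_circ_list xs)"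
    if "xs \<noteq> []" "\<forall>b\<in>set xs. is_composition b \<and> b \<noteq> []" for xs
    using that
  proof (induction xs rule: rev_nonempty_induct)
    case (single x)
    then show ?case by (simp add: comp_circ_list_def)
  next
    case (snoc x xs)
    then show ?case by (simp add: comp_circ_list_snoc rev_comp_circ comp_circ_comp)
  qed
  have "bs \<noteq> []" using as by auto
  then have "rev \<beta> = comp_circ_list (map rev bs)" using *[OF _ bs] eq by simp
  moreover have "\<forall>i<length as. map rev bs ! i = as ! i \<or> map rev bs ! i = rev (as ! i)"
    using rev as(2) by (metis nth_map rev_rev_ident)
  ultimately show ?thesis unfolding comp_equiv_def
    using as bs eq(1) by (intro exI[of _ as] exI[of _ "map rev bs"]) auto
qed

section \<open>From equal coarsening types to equivalence\<close>

lemma sum_list_eq_if_coarse_types_eq: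
  assumes "is_composition \<alpha>" "\<alpha> \<noteq> []" "coarse_types \<alpha> = coarse_types \<beta>"
  shows "sum_list \<alpha> = sum_list \<beta>"
proof -
  obtain L where "L \<in> coarse \<beta>" "mset L = mset \<alpha>" using coarse_with_parts[OF assms] by blast
  then show ?thesis by (metis (mono_tags, lifting) coarse_def mem_Collect_eq sum_mset_sum_list)
qed

lemma equal_products_if_coarse_types_eq:
  assumes \<alpha>: "is_composition \<alpha>" "\<alpha> \<noteq> []" and \<beta>: "is_composition \<beta>" "\<beta> \<noteq> []"
    and eq: "coarse_types \<alpha> = coarse_types \<beta>"
  shows "equal_products (sum_list \<alpha>) (psums \<alpha>) (psums \<beta>)"
proof
  have sum: "sum_list \<beta> = sum_list \<alpha>" using sum_list_eq_if_coarse_types_eq[OF \<alpha> eq] by simp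
  show S: "psums \<alpha> \<subseteq> {0<..<sum_list \<alpha>}" by (rule psums_bounds[OF \<alpha>(1)])
  show T: "psums \<beta> \<subseteq> {0<..<sum_list \<alpha>}" using psums_bounds[OF \<beta>(1)] sum by simp
  show "0 < sum_list \<alpha>" by (rule sum_list_pos[OF \<alpha>])
  fix M :: "nat multiset" assume M: "sum_mset M < sum_list \<alpha>"
  have "card {L \<in> coarsenings (sum_list \<alpha>) (psums \<alpha>). mset L = N} =
      card {L \<in> coarsenings (sum_list \<alpha>) (psums \<beta>). mset L = N}" for N
    using eq sum by (metis coarse_eq_coarsenings count_coarse_types)
  then show "cf (chain_series (psums \<alpha>) * chain_series ((\<lambda>x. sum_list \<alpha> - x) ` psums \<alpha>)) M =
      cf (chain_series (psums \<beta>) * chain_series ((\<lambda>x. sum_list \<alpha> - x) ` psums \<beta>)) M"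
    unfolding chain_series_product[OF S M] chain_series_product[OF T M] by simp
qed

theorem comp_equiv_if_coarse_types_eq:
  assumes "is_composition \<alpha>" "\<alpha> \<noteq> []" "is_composition \<beta>" "\<beta> \<noteq> []" "coarse_types \<alpha> = coarse_types \<beta>"
  shows "comp_equiv \<alpha> \<beta>"
  using assms
proof (induction "sum_list \<alpha>" arbitrary: \<alpha> \<beta> rule: less_induct)
  case less
  note \<alpha> = less.prems(1,2) and \<beta> = less.prems(3,4) and eq = less.prems(5)
  let ?n = "sum_list \<alpha>" and ?S = "psums \<alpha>" and ?T = "psums \<beta>"
  have sum: "sum_list \<beta> = ?n" using sum_list_eq_if_coarse_types_eq[OF \<alpha> eq] by simp
  have rev\<beta>: "psums (rev \<beta>) = (\<lambda>x. ?n - x) ` ?T" using psums_rev[OF \<beta>(1)] sum by simp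
  have ep: "equal_products ?n ?S ?T" by (rule equal_products_if_coarse_types_eq[OF \<alpha> \<beta> eq])
  consider "?S = ?T" | "?S = (\<lambda>x. ?n - x) ` ?T" | "?S \<noteq> ?T" "?S \<noteq> (\<lambda>x. ?n - x) ` ?T" by blast
  then show ?case
  proof cases
    case 1
    then have "\<alpha> = \<beta>" using \<alpha> \<beta> sum by (intro psums_inj) auto
    then show ?thesis using comp_equiv_refl \<alpha> by simp
  next
    case 2
    then have "rev \<beta> = \<alpha>" using \<alpha> \<beta> sum rev\<beta> by (intro psums_inj) (auto simp: sum_list_rev)
    then show ?thesis using comp_equiv_rev[OF comp_equiv_refl[OF \<alpha>]] by (metis rev_rev_ident)
  next
    case 3
    obtain h R where R: "R \<in> {?T, (\<lambda>x. ?n - x) ` ?T}" and h: "1 < h" "h < int ?n" "h dvd int ?n"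
      and per: "\<And>x. \<not> h dvd x \<Longrightarrow> ind ?n ?S (x + h) = ind ?n ?S x \<and> ind ?n ?S x = ind ?n R x"
      using equal_products_period[OF ep 3] by blast
    define m where "m = nat h"
    have m: "1 < m" "m < ?n" "m dvd ?n" "h = int m"
      using h by (auto simp: m_def nat_dvd_iff int_dvd_int_iff[symmetric] simp del: int_dvd_int_iff)
    obtain q where q: "?n = q * m" using m(3) by (auto simp: dvd_def mult.commute)
    have "\<exists>\<beta>0. (\<beta>0 = \<beta> \<or> \<beta>0 = rev \<beta>) \<and> psums \<beta>0 = R" using R rev\<beta> by auto
    then obtain \<beta>0 where \<beta>0: "\<beta>0 = \<beta> \<or> \<beta>0 = rev \<beta>" "psums \<beta>0 = R" by blast
    have c0: "is_composition \<beta>0" "\<beta>0 \<noteq> []" "sum_list \<beta>0 = q * m" "coarse_types \<beta>0 = coarse_types \<alpha>"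
      using \<beta>0 \<beta> sum q eq by (auto simp: coarse_types_rev sum_list_rev)
    \<comment> \<open>The common right factor consists of the cuts of \<alpha> below m, with m as
      total.\<close>
    obtain \<delta> where \<delta>: "is_composition \<delta>" "\<delta> \<noteq> []" "sum_list \<delta> = m" "psums \<delta> = ?S \<inter> {0<..<m}"
      using psums_surj[of "?S \<inter> {0<..<m}" m] m(1) by auto
    have mem: "x \<in> X \<longleftrightarrow> ind ?n X (int x) = 1" if "x < ?n" for x X
      using that by (simp add: ind_nat of_bool_def)
    have perS: "x \<in> ?S \<longleftrightarrow> x mod m \<in> psums \<delta>" and perR: "x \<in> R \<longleftrightarrow> x \<in> ?S"
      if x: "\<not> m dvd x" "x < q * m" for x
    proof -
      \<comment> \<open>Iterating the period reduces x to its remainder modulo m.\<close>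
      have "ind ?n ?S (int y + int j * h) = ind ?n ?S (int y)" if "\<not> m dvd y" for y j
      proof (induction j)
        case (Suc j)
        have "\<not> int m dvd int (y + j * m)"
          using that dvd_add_left_iff[of m "j * m" y] unfolding int_dvd_int_iff by simp
        then have "\<not> h dvd int y + int j * h" unfolding m(4) by simp
        then show ?case using per[of "int y + int j * h"] Suc by (simp add: algebra_simps)
      qed simp
      from this[of "x mod m" "x div m"] x have "ind ?n ?S (int x) = ind ?n ?S (int (x mod m))"
        unfolding m(4) by (simp add: dvd_mod_iff flip: of_nat_mult of_nat_add)
      moreover have "x mod m < m" using m(1) by simp
      moreover have "x mod m \<noteq> 0" using x(1) mod_0_imp_dvd by blast
      moreover have "x mod m < ?n" using \<open>x mod m < m\<close> m(2) by linarith
      ultimately show "x \<in> ?S \<longleftrightarrow> x mod m \<in> psums \<delta>"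
        using mem[of x ?S] mem[of "x mod m" ?S] x(2) q \<delta>(4) by auto
      have "\<not> h dvd int x" using x(1) unfolding m(4) by simp
      then show "x \<in> R \<longleftrightarrow> x \<in> ?S" using per mem x(2) q by metis
    qed
    obtain \<gamma> where \<gamma>: "is_composition \<gamma>" "\<gamma> \<noteq> []" "sum_list \<gamma> = q" "\<alpha> = comp_circ \<gamma> \<delta>"
      using comp_circ_recognise[OF \<alpha> q perS \<delta>(1-3)] by blast
    obtain \<gamma>' where \<gamma>': "is_composition \<gamma>'" "\<gamma>' \<noteq> []" "sum_list \<gamma>' = q" "\<beta>0 = comp_circ \<gamma>' \<delta>"
      using comp_circ_recognise[OF c0(1-3) _ \<delta>(1-3)] perS perR \<beta>0(2) by metis
    have "coarse_types \<gamma> = coarse_types \<gamma>'"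
      using c0(4) \<gamma> \<gamma>' coarse_types_comp_circ_cancel[OF _ _ \<delta>(1,2)] by (intro multiset_eqI) simp
    moreover have "sum_list \<gamma> < ?n"
      using \<gamma>(1-3) sum_list_pos[of \<gamma>] q m(1) by simp
    ultimately have "comp_equiv \<gamma> \<gamma>'" using less.hyps \<gamma> \<gamma>' by blast
    then have "comp_equiv \<alpha> \<beta>0" using comp_equiv_comp_circ \<delta> \<gamma>(4) \<gamma>'(4) by metis
    then show ?thesis using \<beta>0(1) comp_equiv_rev by (metis rev_rev_ident)
  qed
qed

section \<open>Path colourings\<close>

definition word_monomial :: "nat list \<Rightarrow> nat list \<Rightarrow> (nat \<Rightarrow>\<^sub>0 nat)" where
  "word_monomial \<kappa> L = sum_list (map2 Poly_Mapping.single \<kappa> L)"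

lemma word_monomial_simps [simp]:
  "word_monomial [] L = 0" "word_monomial (i # \<kappa>) (a # L) = Poly_Mapping.single i a + word_monomial \<kappa> L"
  by (simp_all add: word_monomial_def)

text \<open>Only r colours are allowed, so that generating functions of colourings are
  polynomials.\<close>

definition colour_lists :: "nat \<Rightarrow> nat \<Rightarrow> nat list set" where
  "colour_lists r n = {\<kappa>. length \<kappa> = n \<and> set \<kappa> \<subseteq> {1..r}}"

lemma finite_colour_lists [simp]: "finite (colour_lists r n)"
  using finite_lists_length_eq[of "{1..r}" n] by (simp add: colour_lists_def conj_commute)

lemma colour_lists_Suc: "colour_lists r (Suc n) = (\<lambda>(i, \<kappa>). i # \<kappa>) ` ({1..r} \<times> colour_lists r n)"
  by (auto simp: colour_lists_def length_Suc_conv image_iff)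

definition power_sum :: "nat \<Rightarrow> nat \<Rightarrow> ((nat \<Rightarrow>\<^sub>0 nat) \<Rightarrow>\<^sub>0 int)" where
  "power_sum r a = gen (\<lambda>i. Poly_Mapping.single i a) {1..r}"

definition path_poly :: "nat \<Rightarrow> nat list \<Rightarrow> ((nat \<Rightarrow>\<^sub>0 nat) \<Rightarrow>\<^sub>0 int)" where
  "path_poly r L = gen (\<lambda>\<kappa>. word_monomial \<kappa> L) {\<kappa> \<in> colour_lists r (length L). distinct_adj \<kappa>}"

lemma gen_image: "inj_on h X \<Longrightarrow> gen \<mu> (h ` X) = gen (\<lambda>x. \<mu> (h x)) X"
  by (simp add: gen_def sum.reindex)

lemma gen_union: "finite X \<Longrightarrow> finite Y \<Longrightarrow> X \<inter> Y = {} \<Longrightarrow> gen \<mu> (X \<union> Y) = gen \<mu> X + gen \<mu> Y"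
  by (simp add: gen_def sum.union_disjoint)

lemma gen_cong: "(\<And>x. x \<in> X \<Longrightarrow> \<mu> x = \<nu> x) \<Longrightarrow> gen \<mu> X = gen \<nu> X"
  by (simp add: gen_def)

lemma prod_power_sums:
  "prod_list (map (power_sum r) L) = gen (\<lambda>\<kappa>. word_monomial \<kappa> L) (colour_lists r (length L))"
proof (induction L)
  case Nil
  have "colour_lists r 0 = {[]}" by (auto simp: colour_lists_def)
  then show ?case by (simp add: gen_def)
next
  case (Cons a L)
  have "prod_list (map (power_sum r) (a # L)) =
      gen (\<lambda>(i, \<kappa>). Poly_Mapping.single i a + word_monomial \<kappa> L) ({1..r} \<times> colour_lists r (length L))"
    by (simp add: Cons power_sum_def gen_times)
  also have "\<dots> = gen (\<lambda>\<kappa>. word_monomial \<kappa> (a # L)) (colour_lists r (length (a # L)))"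
    by (simp add: colour_lists_Suc gen_image inj_on_def case_prod_unfold)
  finally show ?case .
qed

text \<open>Deletion and contraction of the first edge.\<close>

lemma path_poly_Cons:
  "path_poly r (a # b # l) = power_sum r a * path_poly r (b # l) - path_poly r ((a + b) # l)"
proof -
  let ?K = "{\<kappa> \<in> colour_lists r (Suc (length l)). distinct_adj \<kappa>}"
  let ?\<mu> = "\<lambda>(i, \<kappa>). Poly_Mapping.single i a + word_monomial \<kappa> (b # l)"
  let ?E = "{(i, \<kappa>). i \<in> {1..r} \<and> \<kappa> \<in> ?K \<and> i \<noteq> hd \<kappa>}"
  let ?D = "{(i, \<kappa>). i \<in> {1..r} \<and> \<kappa> \<in> ?K \<and> i = hd \<kappa>}"
  have split: "{1..r} \<times> ?K = ?E \<union> ?D" "?E \<inter> ?D = {}" by auto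
  have fin: "finite ?E" "finite ?D"
    by (rule finite_subset[of _ "{1..r} \<times> ?K"]; auto)+
  have "power_sum r a * path_poly r (b # l) = gen ?\<mu> ({1..r} \<times> ?K)"
    by (simp add: power_sum_def path_poly_def gen_times)
  also have "\<dots> = gen ?\<mu> ?E + gen ?\<mu> ?D"
    unfolding split(1) by (rule gen_union[OF fin split(2)])
  also have "gen ?\<mu> ?E = path_poly r (a # b # l)"
  proof -
    have "{\<kappa> \<in> colour_lists r (length (a # b # l)). distinct_adj \<kappa>} = (\<lambda>(i, \<kappa>). i # \<kappa>) ` ?E"
    proof (intro set_eqI)
      fix \<kappa>
      show "\<kappa> \<in> {\<kappa> \<in> colour_lists r (length (a # b # l)). distinct_adj \<kappa>} \<longleftrightarrow>
          \<kappa> \<in> (\<lambda>(i, \<kappa>). i # \<kappa>) ` ?E"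
      proof (cases \<kappa>)
        case (Cons i \<kappa>')
        then show ?thesis
          by (cases \<kappa>') (auto simp: colour_lists_def image_iff)
      qed (auto simp: colour_lists_def)
    qed
    then show ?thesis
      by (simp add: path_poly_def gen_image inj_on_def case_prod_unfold)
  qed
  also have "gen ?\<mu> ?D = path_poly r ((a + b) # l)"
  proof -
    have D: "?D = (\<lambda>\<kappa>. (hd \<kappa>, \<kappa>)) ` ?K"
    proof -
      have "hd \<kappa> \<in> {1..r}" if "\<kappa> \<in> ?K" for \<kappa>
        using that by (cases \<kappa>) (auto simp: colour_lists_def)
      then show ?thesis by force
    qed
    have "gen ?\<mu> ?D = gen (\<lambda>\<kappa>. Poly_Mapping.single (hd \<kappa>) a + word_monomial \<kappa> (b # l)) ?K"
      unfolding D by (simp add: gen_image inj_on_def)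
    also have "\<dots> = gen (\<lambda>\<kappa>. word_monomial \<kappa> ((a + b) # l)) ?K"
    proof (rule gen_cong)
      fix \<kappa> assume "\<kappa> \<in> ?K"
      then show "Poly_Mapping.single (hd \<kappa>) a + word_monomial \<kappa> (b # l) = word_monomial \<kappa> ((a + b) # l)"
        by (cases \<kappa>) (auto simp: colour_lists_def single_add add.assoc)
    qed
    finally show ?thesis by (simp add: path_poly_def)
  qed
  finally show ?thesis by simp
qed

text \<open>Negating the power sums and multiplying by the sign of the length turns the plus in
  \<open>coarse_poly_Cons\<close> into the minus of \<open>path_poly_Cons\<close>.\<close>

lemma path_poly_eq_coarse_poly:
  assumes "is_composition \<alpha>" "\<alpha> \<noteq> []"
  shows "path_poly r \<alpha> = (- 1) ^ length \<alpha> * coarse_poly (\<lambda>k. - power_sum r k) \<alpha>"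
  using assms
proof (induction "length \<alpha>" arbitrary: \<alpha> rule: less_induct)
  case less
  show ?case
  proof (cases \<alpha> rule: psums.cases)
    case (2 a)
    have "path_poly r [a] = prod_list (map (power_sum r) [a])"
      unfolding prod_power_sums path_poly_def
      by (rule arg_cong[of _ _ "gen _"]) (auto simp: colour_lists_def length_Suc_conv)
    then show ?thesis using less.prems 2 by (simp add: coarse_poly_single)
  next
    case (3 a b l)
    then show ?thesis using less.prems less.hyps[of "b # l"] less.hyps[of "(a + b) # l"]
      by (simp add: path_poly_Cons coarse_poly_Cons algebra_simps)
  qed (use less.prems in auto)
qed

lemma path_poly_expand:
  assumes "is_composition \<alpha>" "\<alpha> \<noteq> []"
  shows "path_poly r \<alpha> = (\<Sum>L\<in>coarse \<alpha>. (- 1) ^ (length \<alpha> + length L) * prod_list (map (power_sum r) L))"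
proof -
  have "prod_list (map (\<lambda>k. - power_sum r k) L) = (- 1) ^ length L * prod_list (map (power_sum r) L)" for L
    by (induction L) simp_all
  then show ?thesis
    by (simp add: path_poly_eq_coarse_poly[OF assms] coarse_poly_def sum_distrib_left power_add mult.assoc)
qed

section \<open>Comparing coefficients of the power sum expansion\<close>

lemma keys_word_monomial: "is_composition L \<Longrightarrow> length \<kappa> = length L \<Longrightarrow> Poly_Mapping.keys (word_monomial \<kappa> L) = set \<kappa>"
proof (induction \<kappa> arbitrary: L)
  case (Cons i \<kappa>)
  then obtain a L' where L: "L = a # L'" by (cases L) auto
  have "Poly_Mapping.keys (Poly_Mapping.single i a + word_monomial \<kappa> L') =
      Poly_Mapping.keys (Poly_Mapping.single i a) \<union> Poly_Mapping.keys (word_monomial \<kappa> L')"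
    by (auto simp: in_keys_iff lookup_add lookup_single when_def split: if_splits)
  then show ?case using Cons L by auto
qed simp

lemma mset_eq_lookup_monomial:
  assumes "length \<kappa> = length L" "distinct \<kappa>"
  shows "mset L = image_mset (Poly_Mapping.lookup (word_monomial \<kappa> L)) (mset_set (set \<kappa>))"
proof -
  have "map (Poly_Mapping.lookup (word_monomial \<kappa> L)) \<kappa> = L"
    using assms
  proof (induction \<kappa> L rule: list_induct2)
    case (Cons i \<kappa> a L)
    have 0: "Poly_Mapping.lookup (word_monomial \<kappa> L) i = 0"
    proof -
      have "Poly_Mapping.lookup (word_monomial \<kappa>' L') i = 0" if "length \<kappa>' = length L'" "i \<notin> set \<kappa>'" for \<kappa>' L'
        using that by (induction \<kappa>' L' rule: list_induct2) (auto simp: lookup_add lookup_single when_def)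
      then show ?thesis using Cons by simp
    qed
    have "map (Poly_Mapping.lookup (word_monomial (i # \<kappa>) (a # L))) \<kappa> = map (Poly_Mapping.lookup (word_monomial \<kappa> L)) \<kappa>"
      using Cons by (intro map_cong) (auto simp: lookup_add lookup_single when_def)
    moreover have "Poly_Mapping.lookup (word_monomial (i # \<kappa>) (a # L)) i = a" using 0 by (simp add: lookup_add)
    ultimately show ?case using Cons.IH Cons.prems by (metis distinct.simps(2) list.map(2))
  qed simp
  then have "mset L = mset (map (Poly_Mapping.lookup (word_monomial \<kappa> L)) \<kappa>)" by simp
  also have "\<dots> = image_mset (Poly_Mapping.lookup (word_monomial \<kappa> L)) (mset_set (set \<kappa>))"
    using assms by (simp add: mset_set_set)
  finally show ?thesis .
qed

text \<open>The chosen monomial has as many different variables as L0 has parts. A product of at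
  most that many power sums reaches it only if each factor contributes its own variable, and then
  the exponents are the parts. This is the form of algebraic independence used below.\<close>

lemma power_sums_triangular:
  assumes L0: "is_composition L0" and L: "is_composition L" and len: "length L \<le> length L0"
  shows "(Poly_Mapping.lookup (prod_list (map (power_sum (length L0)) L)) (word_monomial [1..<Suc (length L0)] L0) \<noteq> 0)
    \<longleftrightarrow> mset L = mset L0"
proof -
  let ?r = "length L0" and ?\<kappa> = "[1..<Suc (length L0)]"
  let ?m = "word_monomial ?\<kappa> L0"
  have keys: "Poly_Mapping.keys ?m = {1..?r}"
    using keys_word_monomial[OF L0, of ?\<kappa>] by (simp add: atLeastLessThanSuc_atLeastAtMost del: upt_Suc)
  have len\<kappa>: "length ?\<kappa> = length L0" by (simp del: upt_Suc)
  have nz: "Poly_Mapping.lookup (prod_list (map (power_sum ?r) L')) m \<noteq> 0 \<longleftrightarrow>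
      (\<exists>\<kappa>\<in>colour_lists ?r (length L'). word_monomial \<kappa> L' = m)" for L' m
    by (auto simp: prod_power_sums lookup_gen)
  show ?thesis
  proof
    assume "mset L = mset L0"
    then have "prod_list (map (power_sum ?r) L) = prod_list (map (power_sum ?r) L0)"
      by (metis mset_map prod_mset_prod_list)
    moreover have "?\<kappa> \<in> colour_lists ?r ?r" unfolding colour_lists_def by (auto simp del: upt_Suc)
    ultimately show "Poly_Mapping.lookup (prod_list (map (power_sum ?r) L)) ?m \<noteq> 0"
      using nz[of L0 ?m] by metis
  next
    assume "Poly_Mapping.lookup (prod_list (map (power_sum ?r) L)) ?m \<noteq> 0"
    then obtain \<kappa> where \<kappa>: "\<kappa> \<in> colour_lists ?r (length L)" "word_monomial \<kappa> L = ?m" using nz by blast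
    then have l: "length \<kappa> = length L" by (simp add: colour_lists_def)
    then have s: "set \<kappa> = {1..?r}" using keys_word_monomial[OF L l] \<kappa>(2) keys by simp
    then have "card (set \<kappa>) = ?r" by simp
    then have d: "distinct \<kappa>" using l len card_length[of \<kappa>] by (intro card_distinct) simp
    have "mset L = image_mset (Poly_Mapping.lookup ?m) (mset_set {1..?r})"
      using mset_eq_lookup_monomial[OF l d] s \<kappa>(2) by simp
    also have "\<dots> = mset L0"
      using mset_eq_lookup_monomial[OF len\<kappa>] by (simp add: atLeastLessThanSuc_atLeastAtMost del: upt_Suc)
    finally show "mset L = mset L0" .
  qed
qed

text \<open>As the weights are positive, every colour used occurs in m; so r colours suffice.
  Colourings become lists by reading them along the path.\<close>

lemma path_csf_eq_lookup:
  assumes \<alpha>: "is_composition \<alpha>" and m: "Poly_Mapping.keys m \<subseteq> {1..r}"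
  shows "path_csf \<alpha> m = Poly_Mapping.lookup (path_poly r \<alpha>) m"
proof -
  let ?n = "length \<alpha>"
  let ?P = "{\<kappa> \<in> proper_colourings (path_vertices ?n) (path_edges ?n).
      colouring_monomial (path_vertices ?n) (\<lambda>i. \<alpha> ! (i - 1)) \<kappa> = m}"
  let ?Q = "{\<kappa> \<in> {\<kappa> \<in> colour_lists r ?n. distinct_adj \<kappa>}. word_monomial \<kappa> \<alpha> = m}"
  let ?list = "\<lambda>\<kappa>. map (\<lambda>i. \<kappa> (Suc i)) [0..<?n]"
  have monomial_nth: "word_monomial l L = (\<Sum>i<length L. Poly_Mapping.single (l ! i) (L ! i))"
    if "length l = length L" for l L
    using that by (simp add: word_monomial_def sum_list_sum_nth atLeast0LessThan)
  have monomial: "colouring_monomial (path_vertices ?n) (\<lambda>i. \<alpha> ! (i - 1)) \<kappa> = word_monomial (?list \<kappa>) \<alpha>" for \<kappa>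
  proof -
    have "colouring_monomial (path_vertices ?n) (\<lambda>i. \<alpha> ! (i - 1)) \<kappa> =
        (\<Sum>i\<in>Suc ` {..<?n}. Poly_Mapping.single (\<kappa> i) (\<alpha> ! (i - 1)))"
      by (simp add: colouring_monomial_def path_vertices_def image_Suc_lessThan)
    also have "\<dots> = word_monomial (?list \<kappa>) \<alpha>"
      by (simp add: monomial_nth sum.reindex)
    finally show ?thesis .
  qed
  have proper: "\<kappa> \<in> proper_colourings (path_vertices ?n) (path_edges ?n) \<longleftrightarrow>
      \<kappa> \<in> extensional {1..?n} \<and> set (?list \<kappa>) \<subseteq> {1..} \<and> distinct_adj (?list \<kappa>)" for \<kappa>
  proof -
    have "(\<forall>u\<in>{1..?n}. \<forall>v\<in>{1..?n}. {u, v} \<in> path_edges ?n \<longrightarrow> \<kappa> u \<noteq> \<kappa> v) \<longleftrightarrow>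
        (\<forall>i<?n - 1. \<kappa> (Suc i) \<noteq> \<kappa> (Suc (Suc i)))" (is "?l \<longleftrightarrow> ?r")
    proof
      assume l: ?l
      show ?r
      proof (intro allI impI)
        fix i assume i: "i < ?n - 1"
        then have "{Suc i, Suc (Suc i)} \<in> path_edges ?n"
          unfolding path_edges_def by (intro CollectI exI[of _ "Suc i"]) auto
        then show "\<kappa> (Suc i) \<noteq> \<kappa> (Suc (Suc i))" using l i by auto
      qed
    next
      assume r: ?r
      show ?l
      proof (intro ballI impI)
        fix u v assume "{u, v} \<in> path_edges ?n"
        then obtain i where i: "{u, v} = {i, i + 1}" "1 \<le> i" "i \<le> ?n - 1"
          by (auto simp: path_edges_def)
        then have "\<kappa> i \<noteq> \<kappa> (i + 1)" using r[rule_format, of "i - 1"] by auto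
        then show "\<kappa> u \<noteq> \<kappa> v" using i(1) by (auto simp: doubleton_eq_iff)
      qed
    qed
    moreover have "distinct_adj (?list \<kappa>) \<longleftrightarrow> (\<forall>i<?n - 1. \<kappa> (Suc i) \<noteq> \<kappa> (Suc (Suc i)))"
      by (auto simp: distinct_adj_conv_nth)
    moreover have "\<kappa> \<in> {1..?n} \<rightarrow>\<^sub>E {1..} \<longleftrightarrow> \<kappa> \<in> extensional {1..?n} \<and> set (?list \<kappa>) \<subseteq> {1..}"
    proof -
      have "{1..?n} = Suc ` {0..<?n}" by (simp add: image_Suc_atLeastLessThan atLeastLessThanSuc_atLeastAtMost)
      then have "set (?list \<kappa>) = \<kappa> ` {1..?n}" by (simp only: image_image set_map set_upt)
      then show ?thesis by (auto simp: PiE_iff simp del: set_map)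
    qed
    ultimately show ?thesis by (simp add: proper_colourings_def path_vertices_def)
  qed
  have "bij_betw ?list ?P ?Q"
  proof (rule bij_betwI[where g = "\<lambda>l. \<lambda>i\<in>{1..?n}. l ! (i - 1)"])
    show "?list \<in> ?P \<rightarrow> ?Q"
    proof
      fix \<kappa> assume \<kappa>: "\<kappa> \<in> ?P"
      then have m': "word_monomial (?list \<kappa>) \<alpha> = m" unfolding mem_Collect_eq monomial by blast
      then have "set (?list \<kappa>) = Poly_Mapping.keys m" using keys_word_monomial[OF \<alpha>, of "?list \<kappa>"] by simp
      then show "?list \<kappa> \<in> ?Q" using \<kappa> m' m by (auto simp: proper colour_lists_def)
    qed
    have inv: "?list (\<lambda>i\<in>{1..?n}. l ! (i - 1)) = l" if "l \<in> ?Q" for l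
      using that by (intro nth_equalityI) (auto simp: colour_lists_def)
    show "(\<lambda>l. \<lambda>i\<in>{1..?n}. l ! (i - 1)) \<in> ?Q \<rightarrow> ?P"
    proof
      fix l assume l: "l \<in> ?Q"
      then show "(\<lambda>i\<in>{1..?n}. l ! (i - 1)) \<in> ?P"
        unfolding mem_Collect_eq proper monomial inv[OF l] by (auto simp: colour_lists_def)
    qed
    show "?list (\<lambda>i\<in>{1..?n}. l ! (i - 1)) = l" if "l \<in> ?Q" for l by (rule inv[OF that])
    show "(\<lambda>i\<in>{1..?n}. ?list \<kappa> ! (i - 1)) = \<kappa>" if "\<kappa> \<in> ?P" for \<kappa>
      using that by (auto simp: proper extensional_def fun_eq_iff)
  qed
  then show ?thesis
    by (simp add: path_csf_def extended_csf_def path_poly_def lookup_gen bij_betw_same_card)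
qed

lemma card_psums: "is_composition L \<Longrightarrow> card (psums L) = length L - 1"
proof (induction L rule: psums.induct)
  case (3 a b l)
  have "a \<notin> (+) a ` psums (b # l)" using psums_bounds[of "b # l"] 3 by auto
  then show ?case using 3 by (simp add: card_image)
qed auto

lemma length_coarse_le:
  assumes "is_composition \<alpha>" "\<alpha> \<noteq> []" "L \<in> coarse \<alpha>"
  shows "length L \<le> length \<alpha>"
proof -
  have "card (psums L) \<le> card (psums \<alpha>)" using assms by (intro card_mono) (auto simp: coarse_def)
  moreover have "0 < length \<alpha>" using assms by simp
  moreover have "0 < length L" "is_composition L" using assms by (auto simp: coarse_def)
  ultimately show ?thesis using card_psums[of L] card_psums[OF assms(1)] by linarith
qed

lemma length_le_if_coarse_types_eq:
  assumes "is_composition \<alpha>" "\<alpha> \<noteq> []" "is_composition \<beta>" "\<beta> \<noteq> []" "coarse_types \<alpha> = coarse_types \<beta>"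
  shows "length \<alpha> \<le> length \<beta>"
proof -
  obtain L where "L \<in> coarse \<beta>" "mset L = mset \<alpha>" using coarse_with_parts[OF assms(1,2,5)] by blast
  then show ?thesis using length_coarse_le[OF assms(3,4)] by (metis size_mset)
qed

text \<open>The coefficient of a power sum product in the expansion. Its sign depends only on the
  numbers of parts, so coarsenings of one type do not cancel.\<close>

definition signed_count :: "nat list \<Rightarrow> nat multiset \<Rightarrow> int" where
  "signed_count \<alpha> N = (- 1) ^ (length \<alpha> + size N) * int (count (coarse_types \<alpha>) N)"

lemma lookup_path_poly:
  assumes "is_composition \<alpha>" "\<alpha> \<noteq> []" "finite U" "mset ` coarse \<alpha> \<subseteq> U"
  shows "Poly_Mapping.lookup (path_poly r \<alpha>) m =
    (\<Sum>N\<in>U. signed_count \<alpha> N * Poly_Mapping.lookup (\<Prod>k\<in>#N. power_sum r k) m)"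
proof -
  have sign: "Poly_Mapping.lookup ((- 1) ^ j * p) m = (- 1) ^ j * Poly_Mapping.lookup p m"
    for j and p :: "(nat \<Rightarrow>\<^sub>0 nat) \<Rightarrow>\<^sub>0 int"
    by (cases "even j") simp_all
  have "Poly_Mapping.lookup (path_poly r \<alpha>) m =
      (\<Sum>L\<in>coarse \<alpha>. (- 1) ^ (length \<alpha> + length L) * Poly_Mapping.lookup (prod_list (map (power_sum r) L)) m)"
    by (simp add: path_poly_expand[OF assms(1,2)] lookup_sum sign)
  also have "\<dots> = (\<Sum>L\<in>coarse \<alpha>. (- 1) ^ (length \<alpha> + size (mset L)) * Poly_Mapping.lookup (\<Prod>k\<in>#mset L. power_sum r k) m)"
    by (simp add: prod_mset_prod_list flip: mset_map)
  also have "\<dots> = (\<Sum>N\<in>U. \<Sum>L\<in>{L \<in> coarse \<alpha>. mset L = N}.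
      (- 1) ^ (length \<alpha> + size (mset L)) * Poly_Mapping.lookup (\<Prod>k\<in>#mset L. power_sum r k) m)"
    using assms by (intro sum.group[symmetric]) auto
  also have "\<dots> = (\<Sum>N\<in>U. signed_count \<alpha> N * Poly_Mapping.lookup (\<Prod>k\<in>#N. power_sum r k) m)"
    by (rule sum.cong) (auto simp: signed_count_def count_coarse_types)
  finally show ?thesis .
qed

text \<open>Among the types where the signed counts differ take one with the most parts. By
  \<open>power_sums_triangular\<close> a monomial in that many distinct colours isolates its
  coefficient. Absolute values finally remove the signs.\<close>

lemma coarse_types_eq_if_path_csf_eq:
  assumes \<alpha>: "is_composition \<alpha>" "\<alpha> \<noteq> []" and \<beta>: "is_composition \<beta>" "\<beta> \<noteq> []"
    and eq: "path_csf \<alpha> = path_csf \<beta>"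
  shows "coarse_types \<alpha> = coarse_types \<beta>"
proof -
  let ?U = "mset ` coarse \<alpha> \<union> mset ` coarse \<beta>"
  define E where "E N = signed_count \<alpha> N - signed_count \<beta> N" for N
  have out: "count (coarse_types \<alpha>) N = 0" "count (coarse_types \<beta>) N = 0" if "N \<notin> ?U" for N
    using that by (auto simp: count_coarse_types card_eq_0_iff)
  have rep: "\<exists>L. is_composition L \<and> mset L = N" if "N \<in> ?U" for N
    using that by (auto simp: coarse_def)
  have E: "E N = 0" for N
  proof (rule ccontr)
    assume "E N \<noteq> 0"
    have "N \<in> ?U"
    proof (rule ccontr)
      assume "N \<notin> ?U"
      then show False using out[of N] \<open>E N \<noteq> 0\<close> by (simp add: E_def signed_count_def)
    qed
    define V where "V = {N \<in> ?U. E N \<noteq> 0}"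
    have V: "finite V" "V \<noteq> {}" using \<open>N \<in> ?U\<close> \<open>E N \<noteq> 0\<close> by (auto simp: V_def)
    have "Max (size ` V) \<in> size ` V" using V by (intro Max_in) auto
    then obtain N0 where N0: "N0 \<in> V" "size N0 = Max (size ` V)" by auto
    have max: "size N \<le> size N0" if "N \<in> V" for N unfolding N0(2) using V that by (intro Max_ge) auto
    have repV: "\<exists>L. is_composition L \<and> mset L = N" if "N \<in> V" for N
      using rep that unfolding V_def by blast
    obtain L0 where L0: "is_composition L0" "mset L0 = N0" using repV[OF N0(1)] by blast
    let ?r = "length L0"
    let ?m = "word_monomial [1..<Suc ?r] L0"
    let ?c = "\<lambda>N. Poly_Mapping.lookup (\<Prod>k\<in>#N. power_sum ?r k) ?m"
    have tri: "?c N \<noteq> 0 \<longleftrightarrow> N = N0" if N: "N \<in> V" for N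
    proof -
      obtain L where L: "is_composition L" "mset L = N" using repV[OF N] by blast
      have "length L \<le> ?r" using max[OF N] L L0 by (metis size_mset)
      moreover have "(\<Prod>k\<in>#N. power_sum ?r k) = prod_list (map (power_sum ?r) L)"
        unfolding L(2)[symmetric] by (simp add: prod_mset_prod_list flip: mset_map)
      ultimately show ?thesis using power_sums_triangular[OF L0(1) L(1)] L(2) L0(2) by metis
    qed
    have "Poly_Mapping.keys ?m \<subseteq> {1..?r}" using keys_word_monomial[OF L0(1), of "[1..<Suc ?r]"] by (simp add: atLeastLessThanSuc_atLeastAtMost del: upt_Suc)
    then have "Poly_Mapping.lookup (path_poly ?r \<alpha>) ?m = Poly_Mapping.lookup (path_poly ?r \<beta>) ?m"
      using eq path_csf_eq_lookup[OF \<alpha>(1)] path_csf_eq_lookup[OF \<beta>(1)] by metis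
    then have "(\<Sum>N\<in>?U. E N * ?c N) = 0"
      by (simp add: lookup_path_poly[OF \<alpha>, of ?U] lookup_path_poly[OF \<beta>, of ?U] E_def
          left_diff_distrib sum_subtractf)
    moreover have "(\<Sum>N\<in>?U. E N * ?c N) = (\<Sum>N\<in>{N0}. E N * ?c N)"
    proof (rule sum.mono_neutral_right)
      show "{N0} \<subseteq> ?U" using N0(1) unfolding V_def by blast
      show "\<forall>N\<in>?U - {N0}. E N * ?c N = 0"
      proof
        fix N assume "N \<in> ?U - {N0}"
        then have "E N = 0 \<or> ?c N = 0" using tri[of N] unfolding V_def by blast
        then show "E N * ?c N = 0" by auto
      qed
    qed simp
    moreover have "E N0 \<noteq> 0" "?c N0 \<noteq> 0" using tri[OF N0(1)] N0(1) unfolding V_def by blast+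
    ultimately show False by (simp del: upt_Suc)
  qed
  show ?thesis
  proof (rule multiset_eqI)
    fix N
    have "\<bar>signed_count \<alpha> N\<bar> = \<bar>signed_count \<beta> N\<bar>" using E[of N] by (simp add: E_def)
    then show "count (coarse_types \<alpha>) N = count (coarse_types \<beta>) N"
      by (simp add: signed_count_def abs_mult)
  qed
qed

text \<open>Equal types force equal lengths, hence equal signs in
  \<open>path_poly_eq_coarse_poly\<close>.\<close>

lemma path_csf_eq_if_coarse_types_eq:
  assumes \<alpha>: "is_composition \<alpha>" "\<alpha> \<noteq> []" and \<beta>: "is_composition \<beta>" "\<beta> \<noteq> []"
    and eq: "coarse_types \<alpha> = coarse_types \<beta>"
  shows "path_csf \<alpha> = path_csf \<beta>"
proof
  fix m
  have len: "length \<alpha> = length \<beta>"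
    using length_le_if_coarse_types_eq[OF \<alpha> \<beta> eq] length_le_if_coarse_types_eq[OF \<beta> \<alpha> eq[symmetric]] by simp
  have poly: "path_poly r \<alpha> = path_poly r \<beta>" for r
    unfolding path_poly_eq_coarse_poly[OF \<alpha>] path_poly_eq_coarse_poly[OF \<beta>] len coarse_poly_cong[OF eq] ..
  show "path_csf \<alpha> m = path_csf \<beta> m"
  proof (cases "0 \<in> Poly_Mapping.keys m")
    case False
    have "finite (Poly_Mapping.keys m)" by simp
    then have "Poly_Mapping.keys m \<subseteq> {1..Max (insert 0 (Poly_Mapping.keys m))}"
      using False by (auto simp: Suc_le_eq intro!: gr0I)
    then show ?thesis using poly path_csf_eq_lookup \<alpha>(1) \<beta>(1) by metis
  next
    case True
    \<comment> \<open>Colours start at 1, so a monomial involving the variable of index 0 never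
      occurs.\<close>
    have "path_csf \<gamma> m = 0" if \<gamma>: "is_composition \<gamma>" for \<gamma>
    proof -
      have none: "{\<kappa> \<in> proper_colourings (path_vertices (length \<gamma>)) (path_edges (length \<gamma>)).
        colouring_monomial (path_vertices (length \<gamma>)) (\<lambda>i. \<gamma> ! (i - 1)) \<kappa> = m} = {}"
      proof (rule ccontr)
        assume "\<not> ?thesis"
        then obtain \<kappa> where \<kappa>: "\<kappa> \<in> proper_colourings (path_vertices (length \<gamma>)) (path_edges (length \<gamma>))"
          "colouring_monomial (path_vertices (length \<gamma>)) (\<lambda>i. \<gamma> ! (i - 1)) \<kappa> = m" by auto
        have "Poly_Mapping.lookup m 0 = (\<Sum>v\<in>path_vertices (length \<gamma>).
            Poly_Mapping.lookup (Poly_Mapping.single (\<kappa> v) (\<gamma> ! (v - 1))) 0)"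
          using \<kappa>(2) by (auto simp: colouring_monomial_def lookup_sum)
        also have "\<dots> = 0"
          using \<kappa>(1) by (intro sum.neutral ballI)
            (auto simp: proper_colourings_def PiE_iff lookup_single when_def)
        finally show False using True by (simp add: in_keys_iff)
      qed
      show ?thesis by (simp only: path_csf_def extended_csf_def none card.empty of_nat_0)
    qed
    then show ?thesis using \<alpha>(1) \<beta>(1) by simp
  qed
qed

theorem theorem4p12:
  fixes \<alpha> \<beta> :: "nat list"
  assumes "is_composition \<alpha>" and "\<alpha> \<noteq> []"
    and "is_composition \<beta>" and "\<beta> \<noteq> []"
  shows "path_csf \<alpha> = path_csf \<beta> \<longleftrightarrow> comp_equiv \<alpha> \<beta>"
  using coarse_types_eq_if_path_csf_eq[OF assms] path_csf_eq_if_coarse_types_eq[OF assms]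
    comp_equiv_if_coarse_types_eq[OF assms] coarse_types_eq_if_comp_equiv by blast

end
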